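(* (i) Let $\mathbf{W}=\mathbf{X}^*\mathbf{X}$ be an $N\times N$ quaternionic Wishart matrix, where $\mathbf{X}$ is an $M\times N$ matrix with independent standard quaternion Gaussian entries, and write $M=\lambda N$. Let $j_1,\dots,j_m$ be positive integers and $n=j_1+\dots+j_m$. Then $$\mathbb{E}\big(\mathrm{tr}(\mathbf{W}^{j_1})\,\mathrm{tr}(\mathbf{W}^{j_2})\cdots\mathrm{tr}(\mathbf{W}^{j_m})\big)=N^{n-m}\,4^{n-m}\sum_{\Gamma}\lambda^{w(\Gamma)}(-2N)^{\chi(\Gamma)},$$ where the sum is over the bipartite Möbius graphs $\Gamma$ with black vertices having degrees $j_1,\dots,j_m$, $n$ is the number of edges, $w(\Gamma)$ is the number of white vertices, and $\chi(\Gamma)$ is the Euler characteristic. (ii) More generally, let $\mathbf{W}_1,\dots,\mathbf{W}_s$ be independent $N\times N$ quaternionic Wishart matrices with parameters $M_1,\dots,M_s$, and put $\lambda_j=M_j/N$. Let $j_1,\dots,j_m$ be positive integers with $j_1+\dots+j_m=n$, let $t:\{1,\dots,n\}\to\{1,\dots,s\}$ be fixed, and put $\alpha_1=1$, $\alpha_k=j_1+\dots+j_{k-1}+1$, $\beta_k=j_1+\dots+j_k$. Then $$\frac{1}{(4N)^{n-m}}\,\mathbb{E}\Big(\Re(\mathrm{tr}(\mathbf{W}_{t(1)}\cdots\mathbf{W}_{t(\beta_1)}))\,\Re(\mathrm{tr}(\mathbf{W}_{t(\alpha_2)}\cdots\mathbf{W}_{t(\beta_2)}))\times\cdots\times\Re(\mathrm{tr}(\mathbf{W}_{t(\alpha_m)}\cdots\mathbf{W}_{t(\beta_m)}))\Big)=\sum_{\Gamma}\lambda_1^{w_1(\Gamma)}\lambda_2^{w_2(\Gamma)}\cdots\lambda_s^{w_s(\Gamma)}(-2N)^{\chi(\Gamma)},$$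 where the sum is over the bipartite Möbius graphs $\Gamma$ with $m$ black vertices of degrees $j_1,\dots,j_m$, whose ribbons are colored according to $t$ by the colors $1,\dots,s$, and with white vertices that are colored to match the ribbons; $w_j(\Gamma)$ is the number of white vertices of color $j$, and $\chi(\Gamma)$ is the Euler characteristic.
   Context: Quaternions: $\mathbb{H}\ni q=x_0+ix_1+jx_2+kx_3$ with $i^2=j^2=k^2=ijk=-1$, $x_0,\dots,x_3\in\mathbb{R}$; $\overline q=x_0-ix_1-jx_2-kx_3$; $\Re(q)=(q+\overline q)/2=x_0$. For an $M\times N$ quaternionic matrix $\mathbf{A}$, the adjoint is $(\mathbf{A}^* )_{i,j}=\overline{A_{j,i}}$; for an $N\times N$ matrix, $\mathrm{tr}(\mathbf{A})=\sum_{j=1}^N A_{jj}$. A standard quaternion Gaussian random variable is $Z=\xi_0+i\xi_1+j\xi_2+k\xi_3$ with $\xi_0,\xi_1,\xi_2,\xi_3$ independent real $N(0,1)$ random variables. An $N\times N$ quaternionic Wishart matrix with parameter $M$ is $\mathbf{W}=\mathbf{X}^*\mathbf{X}$ with $\mathbf{X}$ an $M\times N$ matrix whose entries are independent standard quaternion Gaussian random variables. Bipartite Möbius graphs with (labeled) black vertices of degrees $j_1,\dots,j_m$, $n=j_1+\dots+j_m$, are built from three pair partitions (partitions into two-element sets) of the set $\{\pm1,\dots,\pm n\}$: (1) $\delta$ consists of the pairs $\{j,-j\}$, $1\le j\le n$; (2) $\sigma$ consists, for each block of consecutive integers $\alpha_r=j_1+\dots+j_{r-1}+1,\dots,\beta_r=j_1+\dots+j_r$,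 $r=1,\dots,m$, of the pairs $\{\alpha_r,-(\alpha_r+1)\},\{\alpha_r+1,-(\alpha_r+2)\},\dots,\{\beta_r-1,-\beta_r\},\{\beta_r,-\alpha_r\}$; (3) $\gamma$ is an arbitrary pair partition of $\{\pm1,\dots,\pm n\}$. The bipartite Möbius graph $\Gamma$ determined by $\gamma$ has one black vertex for each of the $m$ cycles of the 2-regular (multi)graph $\delta\cup\sigma$, one white vertex for each cycle of $\delta\cup\gamma$, and $n$ edges (ribbons), the $j$-th ribbon having its two sides labeled $j$ and $-j$ and joining the black vertex whose cycle contains $\{j,-j\}$ to the white vertex whose cycle contains $\{j,-j\}$. Black vertices are oriented counterclockwise and white vertices clockwise, the labeled lines around a vertex being drawn following its cycle; a ribbon is twisted if the order of its two sides $-j,j$ at the black vertex does not match their order at the white vertex. Graphs that differ only by a choice of orientation at some white vertices (twists propagated through a white vertex) are identified, so the bipartite Möbius graphs in the sum are in bijection with the pair partitions $\gamma$. Faces are the cycles obtained by following the sides of the ribbons through the vertices; equivalently, they are the cycles of the 2-regular (multi)graph $\sigma\cup\gamma$. Euler characteristic: $\chi(\Gamma)=v(\Gamma)-e(\Gamma)+f(\Gamma)$, where $v(\Gamma)=m+w(\Gamma)$ with $w(\Gamma)$ the number of white vertices (cycles of $\delta\cup\gamma$), $e(\Gamma)=n$, and $f(\Gamma)$ is the number of faces (cycles of $\sigma\cup\gamma$). The graph need not be connected. Coloring: in the multi-matrix case the ribbon with sides $\pm j$ has color $t(j)$, and only ribbons of the same color may be attached to a common white vertex, which then has that color; i.e.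 the sum is over those $\gamma$ with $t(|j|)=t(|k|)$ for every $\{j,k\}\in\gamma$. *)

theory Defs
  imports "HOL-Probability.Probability" "Jordan_Normal_Form.Matrix"
begin

section \<open>Quaternions\<close>

text \<open>\<open>Quat x0 x1 x2 x3\<close> is $x_0 + i x_1 + j x_2 + k x_3$.  The Euclidean structure is the one
  of the coordinates; it makes the Borel sets and the Bochner integral available on the type.\<close>

datatype quat = Quat (qRe: real) (qI: real) (qJ: real) (qK: real)

lemma quat_eq_iff: "x = y \<longleftrightarrow> qRe x = qRe y \<and> qI x = qI y \<and> qJ x = qJ y \<and> qK x = qK y"
  by (cases x; cases y) simp

definition qcnj :: "quat \<Rightarrow> quat" where
  "qcnj q = Quat (qRe q) (- qI q) (- qJ q) (- qK q)"

instantiation quat :: ring_1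
begin

definition zero_quat where "0 = Quat 0 0 0 0"
definition one_quat where "1 = Quat 1 0 0 0"
definition plus_quat where
  "x + y = Quat (qRe x + qRe y) (qI x + qI y) (qJ x + qJ y) (qK x + qK y)"
definition minus_quat where
  "x - y = Quat (qRe x - qRe y) (qI x - qI y) (qJ x - qJ y) (qK x - qK y)"
definition uminus_quat where
  "- x = Quat (- qRe x) (- qI x) (- qJ x) (- qK x)"
definition times_quat where
  "x * y = Quat
     (qRe x * qRe y - qI x * qI y - qJ x * qJ y - qK x * qK y)
     (qRe x * qI y + qI x * qRe y + qJ x * qK y - qK x * qJ y)
     (qRe x * qJ y - qI x * qK y + qJ x * qRe y + qK x * qI y)
     (qRe x * qK y + qI x * qJ y - qJ x * qI y + qK x * qRe y)"

instance
proof
  fix x y z :: quat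
  show "x * y * z = x * (y * z)"
    by (simp add: quat_eq_iff times_quat_def) (intro conjI; simp add: algebra_simps)
  show "(x + y) * z = x * z + y * z" "x * (y + z) = x * y + x * z"
    by (simp_all add: quat_eq_iff plus_quat_def times_quat_def algebra_simps)
qed (simp_all add: quat_eq_iff zero_quat_def one_quat_def plus_quat_def minus_quat_def
      uminus_quat_def times_quat_def)

end

instantiation quat :: real_algebra_1
begin

definition scaleR_quat where
  "c *\<^sub>R x = Quat (c * qRe x) (c * qI x) (c * qJ x) (c * qK x)"

instance
  by standard
    (simp_all add: scaleR_quat_def plus_quat_def times_quat_def quat_eq_iff algebra_simps)

end

instantiation quat :: real_inner
begin

definition inner_quat where
  "x \<bullet> y = qRe x * qRe y + qI x * qI y + qJ x * qJ y + qK x * qK y"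
definition norm_quat where "norm (x::quat) = sqrt (x \<bullet> x)"
definition sgn_quat where "sgn (x::quat) = x /\<^sub>R norm x"
definition dist_quat where "dist (x::quat) y = norm (x - y)"
definition uniformity_quat where
  "(uniformity :: (quat \<times> quat) filter) = (INF e\<in>{0 <..}. principal {(x, y). dist x y < e})"
definition open_quat where
  "open (U :: quat set) \<longleftrightarrow> (\<forall>x\<in>U. eventually (\<lambda>(x', y). x' = x \<longrightarrow> y \<in> U) uniformity)"

instance
proof
  fix x y z :: quat and a :: real and U :: "quat set"
  show "x \<bullet> y = y \<bullet> x" "(x + y) \<bullet> z = x \<bullet> z + y \<bullet> z" "(a *\<^sub>R x) \<bullet> y = a * (x \<bullet> y)"
    by (auto simp: inner_quat_def scaleR_quat_def plus_quat_def algebra_simps)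
  show nonneg: "0 \<le> x \<bullet> x"
    by (simp add: inner_quat_def)
  have "x \<bullet> x = 0 \<longleftrightarrow> (qRe x)\<^sup>2 = 0 \<and> (qI x)\<^sup>2 = 0 \<and> (qJ x)\<^sup>2 = 0 \<and> (qK x)\<^sup>2 = 0"
    unfolding inner_quat_def power2_eq_square[symmetric]
    by (smt (verit) zero_le_power2)
  then show "x \<bullet> x = 0 \<longleftrightarrow> x = 0"
    by (simp add: quat_eq_iff zero_quat_def)
qed (simp_all only: norm_quat_def sgn_quat_def dist_quat_def uniformity_quat_def open_quat_def)

end

instance quat :: real_normed_algebra_1
proof
  fix x y :: quat
  have "(x * y) \<bullet> (x * y) = (x \<bullet> x) * (y \<bullet> y)"
    unfolding inner_quat_def times_quat_def quat.sel by (simp add: algebra_simps)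
  then show "norm (x * y) \<le> norm x * norm y"
    by (simp add: norm_quat_def real_sqrt_mult)
  show "norm (1 :: quat) = 1"
    by (simp add: norm_quat_def inner_quat_def one_quat_def)
qed

instantiation quat :: euclidean_space
begin

definition Basis_quat where
  "Basis = {Quat 1 0 0 0, Quat 0 1 0 0, Quat 0 0 1 0, Quat 0 0 0 1}"

instance
proof
  fix u v :: quat
  show "u \<in> Basis \<Longrightarrow> v \<in> Basis \<Longrightarrow> u \<bullet> v = (if u = v then 1 else 0)"
    unfolding Basis_quat_def inner_quat_def insert_iff empty_iff
    by (elim disjE; simp)
  show "(\<forall>b\<in>Basis. u \<bullet> b = 0) \<longleftrightarrow> u = 0"
    by (cases u) (simp add: Basis_quat_def inner_quat_def zero_quat_def)
qed (simp_all add: Basis_quat_def)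

end

section \<open>Quaternionic matrices\<close>

definition qadjoint :: "quat mat \<Rightarrow> quat mat" where
  "qadjoint A = Matrix.mat (dim_col A) (dim_row A) (\<lambda>(a, b). qcnj (A $$ (b, a)))"

definition qtrace :: "quat mat \<Rightarrow> quat" where
  "qtrace A = (\<Sum>a<dim_row A. A $$ (a, a))"

text \<open>The ordered product of a list of \<open>N \<times> N\<close> matrices.\<close>

definition mat_prod :: "nat \<Rightarrow> quat mat list \<Rightarrow> quat mat" where
  "mat_prod N As = foldr (*) As (1\<^sub>m N)"

section \<open>Quaternionic Wishart matrices\<close>

definition std_quat_gaussian :: "'a measure \<Rightarrow> ('a \<Rightarrow> quat) \<Rightarrow> bool" where
  "std_quat_gaussian P Z \<longleftrightarrow> (\<exists>\<xi> :: nat \<Rightarrow> 'a \<Rightarrow> real.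
     prob_space.indep_vars P (\<lambda>_. borel) \<xi> {0..3} \<and>
     (\<forall>i\<in>{0..3}. distributed P lborel (\<xi> i) std_normal_density) \<and>
     (\<forall>\<omega>\<in>space P. Z \<omega> = Quat (\<xi> 0 \<omega>) (\<xi> 1 \<omega>) (\<xi> 2 \<omega>) (\<xi> 3 \<omega>)))"

definition quat_gaussian_matrix :: "'a measure \<Rightarrow> nat \<Rightarrow> nat \<Rightarrow> ('a \<Rightarrow> quat mat) \<Rightarrow> bool" where
  "quat_gaussian_matrix P M N X \<longleftrightarrow>
     (\<forall>\<omega>\<in>space P. X \<omega> \<in> carrier_mat M N) \<and>
     (\<forall>a<M. \<forall>b<N. std_quat_gaussian P (\<lambda>\<omega>. X \<omega> $$ (a, b))) \<and>
     prob_space.indep_vars P (\<lambda>_. borel) (\<lambda>ab \<omega>. X \<omega> $$ ab) ({..<M} \<times> {..<N})"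

definition quat_wishart :: "'a measure \<Rightarrow> nat \<Rightarrow> nat \<Rightarrow> ('a \<Rightarrow> quat mat) \<Rightarrow> bool" where
  "quat_wishart P N M W \<longleftrightarrow> (\<exists>X. quat_gaussian_matrix P M N X \<and>
     (\<forall>\<omega>\<in>space P. W \<omega> = qadjoint (X \<omega>) * X \<omega>))"

text \<open>Independence of random \<open>N \<times> N\<close> matrices: a matrix is identified with the family of its
  entries, so that the matrices carry the product sigma algebra.\<close>

definition indep_matrices ::
    "'a measure \<Rightarrow> nat \<Rightarrow> (nat \<Rightarrow> 'a \<Rightarrow> quat mat) \<Rightarrow> nat set \<Rightarrow> bool" where
  "indep_matrices P N W L \<longleftrightarrow>
     prob_space.indep_vars P (\<lambda>_. PiM ({..<N} \<times> {..<N}) (\<lambda>_. borel))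
       (\<lambda>l \<omega>. \<lambda>ab\<in>{..<N} \<times> {..<N}. W l \<omega> $$ ab) L"

section \<open>Bipartite Moebius graphs\<close>

definition side_labels :: "nat \<Rightarrow> int set" where
  "side_labels n = {- int n..int n} - {0}"

definition pair_partition :: "'a set \<Rightarrow> 'a set set \<Rightarrow> bool" where
  "pair_partition A \<pi> \<longleftrightarrow> partition_on A \<pi> \<and> (\<forall>p\<in>\<pi>. card p = 2)"

text \<open>The block of the \<open>r\<close>-th black vertex, \<open>1 \<le> r \<le> m\<close>, is
  \<open>{block_first j r..block_last j r}\<close>; in particular \<open>block_last j m\<close> is the number \<open>n\<close> of edges.\<close>

definition block_first :: "(nat \<Rightarrow> nat) \<Rightarrow> nat \<Rightarrow> nat" where
  "block_first j r = (\<Sum>i=1..<r. j i) + 1"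

definition block_last :: "(nat \<Rightarrow> nat) \<Rightarrow> nat \<Rightarrow> nat" where
  "block_last j r = (\<Sum>i=1..r. j i)"

definition delta :: "nat \<Rightarrow> int set set" where
  "delta n = {{int k, - int k} |k. k \<in> {1..n}}"

definition sigma :: "nat \<Rightarrow> (nat \<Rightarrow> nat) \<Rightarrow> int set set" where
  "sigma m j = (\<Union>r\<in>{1..m}.
     {{int k, - (int k + 1)} |k. block_first j r \<le> k \<and> k < block_last j r} \<union>
     {{int (block_last j r), - int (block_first j r)}})"

text \<open>The cycles of the 2-regular multigraph formed by two pair partitions of the same set, each
  cycle being given by its set of points.  The edges of a cycle belong alternately to \<open>\<pi>\<close> and \<open>\<rho>\<close>;
  a pair in both \<open>\<pi>\<close> and \<open>\<rho>\<close> is a double edge and forms a cycle of length 2.\<close>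

definition alternating_cycle :: "'a set set \<Rightarrow> 'a set set \<Rightarrow> 'a list \<Rightarrow> bool" where
  "alternating_cycle \<pi> \<rho> xs \<longleftrightarrow> xs \<noteq> [] \<and> distinct xs \<and> even (length xs) \<and>
     (\<forall>i<length xs. {xs ! i, xs ! (Suc i mod length xs)} \<in> (if even i then \<pi> else \<rho>))"

definition cycles :: "'a set set \<Rightarrow> 'a set set \<Rightarrow> 'a set set" where
  "cycles \<pi> \<rho> = {set xs |xs. alternating_cycle \<pi> \<rho> xs}"

text \<open>A bipartite Moebius graph with \<open>m\<close> black vertices of degrees \<open>j 1, \<dots>, j m\<close> is represented by
  the pair partition \<open>\<gamma>\<close> that determines it (graphs differing by the choice of orientation at white
  vertices being identified).  The ribbon with sides \<open>k\<close> and \<open>-k\<close> is represented by the pair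
  \<open>{k, -k}\<close>; it joins the black and the white vertex that contain this pair.\<close>

definition moebius_graphs :: "nat \<Rightarrow> (nat \<Rightarrow> nat) \<Rightarrow> int set set set" where
  "moebius_graphs m j = {\<gamma>. pair_partition (side_labels (block_last j m)) \<gamma>}"

definition black_vertices :: "nat \<Rightarrow> (nat \<Rightarrow> nat) \<Rightarrow> int set set" where
  "black_vertices m j = cycles (delta (block_last j m)) (sigma m j)"

definition white_vertices :: "nat \<Rightarrow> (nat \<Rightarrow> nat) \<Rightarrow> int set set \<Rightarrow> int set set" where
  "white_vertices m j \<gamma> = cycles (delta (block_last j m)) \<gamma>"

definition ribbons :: "nat \<Rightarrow> (nat \<Rightarrow> nat) \<Rightarrow> int set set" where
  "ribbons m j = delta (block_last j m)"

definition faces :: "nat \<Rightarrow> (nat \<Rightarrow> nat) \<Rightarrow> int set set \<Rightarrow> int set set" where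
  "faces m j \<gamma> = cycles (sigma m j) \<gamma>"

definition euler_char :: "nat \<Rightarrow> (nat \<Rightarrow> nat) \<Rightarrow> int set set \<Rightarrow> int" where
  "euler_char m j \<gamma> =
     int (card (black_vertices m j) + card (white_vertices m j \<gamma>))
     - int (card (ribbons m j)) + int (card (faces m j \<gamma>))"

text \<open>Colored graphs: the ribbon with sides \<open>k\<close> and \<open>-k\<close> has color \<open>t k\<close>, and \<open>\<gamma>\<close> only pairs sides
  of ribbons of equal color, so that all ribbons at a white vertex have the color of the vertex.\<close>

definition side_color :: "(nat \<Rightarrow> nat) \<Rightarrow> int \<Rightarrow> nat" where
  "side_color t x = t (nat \<bar>x\<bar>)"

definition colored_moebius_graphs ::
    "nat \<Rightarrow> (nat \<Rightarrow> nat) \<Rightarrow> (nat \<Rightarrow> nat) \<Rightarrow> int set set set" where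
  "colored_moebius_graphs m j t =
     {\<gamma> \<in> moebius_graphs m j. \<forall>p\<in>\<gamma>. \<forall>x\<in>p. \<forall>y\<in>p. side_color t x = side_color t y}"

definition white_vertices_of_color ::
    "nat \<Rightarrow> (nat \<Rightarrow> nat) \<Rightarrow> (nat \<Rightarrow> nat) \<Rightarrow> int set set \<Rightarrow> nat \<Rightarrow> int set set" where
  "white_vertices_of_color m j t \<gamma> l =
     {C \<in> white_vertices m j \<gamma>. \<forall>x\<in>C. side_color t x = l}"

end

theory Submission
  imports Defs "HOL-Combinatorics.Permutations"
begin

text \<open>Quaternions are represented by complex \<open>2 \<times> 2\<close> matrices, so that \<open>Re q\<close> is half the trace of the
  matrix of \<open>q\<close>.  An \<open>M \<times> N\<close> quaternionic Gaussian matrix \<open>X\<close> becomes a \<open>2M \<times> 2N\<close> matrix \<open>Y\<close> of complex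
  Gaussian variables, which commute.  Two identities make this useful.  The entries of the matrix of
  \<open>qadjoint X\<close> are, up to signs and flipped spins, entries of \<open>Y\<close> again (\<open>qspin_qcnj\<close>).  And the
  covariance of two entries of \<open>Y\<close> is twice a symplectic form in the row indices times a symplectic
  form in the column indices (\<open>qunit_completeness\<close>).

  Expanding the product of \<open>m\<close> traces gives a sum of monomials in \<open>Y\<close> with one factor for each of the
  sides \<open>\<plusminus>1, \<dots>, \<plusminus>n\<close>.  The row indices at the sides are matched by \<open>\<delta>\<close>, since \<open>k\<close> and \<open>-k\<close> belong to the
  two factors of one Wishart matrix, and the column indices are matched by \<open>\<sigma>\<close>, which encodes the order
  of multiplication and the traces.  Wick's formula (\<open>wick\<close>) turns the expectation into a sum over the
  pairings \<open>\<gamma>\<close>.  For fixed \<open>\<gamma>\<close> the row indices are constrained along \<open>\<delta>\<close> and \<open>\<gamma>\<close> only, the column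
  indices along \<open>\<sigma>\<close> and \<open>\<gamma>\<close> only.  The two sums decouple into index loops (\<open>spin_sum\<close>): every cycle of
  \<open>\<delta> \<union> \<gamma>\<close>, a white vertex, contributes \<open>2M\<close>, with \<open>M\<close> the parameter of its color, and every cycle of
  \<open>\<sigma> \<union> \<gamma>\<close>, a face, contributes \<open>2N\<close>, up to a sign.

  The sign is the main point, since it turns \<open>2\<close> into \<open>-2\<close>.  The symplectic form is antisymmetric, so
  the pairs of the three matchings have to be oriented, and the orientations can be made consistent
  for \<open>\<delta>\<close> and \<open>\<gamma>\<close>, for \<open>\<sigma>\<close> and \<open>\<gamma>\<close>, and for \<open>\<delta>\<close> and \<open>\<sigma>\<close>, but in general not for all three at
  once.  The defect is the sign \<open>(-1) ^ (n + m + w + f)\<close>, where \<open>w\<close> and \<open>f\<close> count the white vertices and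
  the faces; its exponent has the parity of the Euler characteristic \<open>m + w - n + f\<close>.  This is
  \<open>three_matchings_parity\<close>, a statement about signs of permutations: for two matchings with a common
  orientation, the permutation carrying one to the other has a sign given by the number of cycles they
  form, and going around the three matchings gives an even permutation.  With a factor \<open>2\<close> from the covariance of
  each pair of \<open>\<gamma>\<close> and \<open>1 / 2\<close> from each of the \<open>m\<close> real parts, the powers of two and the sign combine to
  \<open>4 ^ (n - m)\<close> times the power of \<open>-2\<close> with exponent the Euler characteristic.

  The formula for a single matrix is the case of one color, because the trace of a power of a
  self-adjoint quaternionic matrix is real.
\<close>

section \<open>Signs of permutations and perfect matchings\<close>

text \<open>The functions constant on the cycles of \<open>p\<close> number \<open>2 ^ c\<close> with \<open>c\<close> the number of cycles, so this is
  the formula \<open>sgn p = (-1) ^ (|A| - c)\<close>, with cycles counted through the functions they carry.  Taking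
  a moved point out of its cycle by a transposition changes the sign and frees the value at that
  point, which doubles the number of functions.\<close>

lemma sign_eq_card_invariant_functions:
  fixes A :: "'b set"
  assumes "finite A" "p permutes A"
  shows "\<exists>c. card {f \<in> A \<rightarrow>\<^sub>E (UNIV::bool set). \<forall>x\<in>A. f (p x) = f x} = 2 ^ c \<and>
             sign p = (- 1) ^ (card A + c)"
  using assms(2)
proof (induction "card {x. p x \<noteq> x}" arbitrary: p rule: less_induct)
  case less
  note p = \<open>p permutes A\<close>
  define I where "I p = {f \<in> A \<rightarrow>\<^sub>E (UNIV::bool set). \<forall>x\<in>A. f (p x) = f x}" for p :: "'b \<Rightarrow> 'b"
  show ?case
  proof (cases "\<forall>x. p x = x")
    case True
    then have "p = id" by auto
    moreover have "{f \<in> A \<rightarrow>\<^sub>E (UNIV::bool set). \<forall>x\<in>A. f (id x) = f x} = A \<rightarrow>\<^sub>E UNIV"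
      by auto
    ultimately show ?thesis
      using \<open>finite A\<close> by (intro exI[of _ "card A"]) (simp add: card_PiE flip: mult_2 power_mult)
  next
    case False
    then obtain x where x: "p x \<noteq> x" by blast
    define q where "q = Transposition.transpose x (p x) \<circ> p"
    have xA: "x \<in> A" "p x \<in> A"
      using p x permutes_not_in permutes_in_image by metis+
    have q: "q permutes A"
      unfolding q_def using p xA by (intro permutes_compose permutes_swap_id)
    have qx: "q x = x" by (simp add: q_def)
    have inj: "inj p" using p permutes_inj by blast
    have fin: "finite {z. p z \<noteq> z}"
      using \<open>finite A\<close> by (rule finite_subset[rotated]) (use p in \<open>auto simp: permutes_def\<close>)
    have "{z. q z \<noteq> z} \<subseteq> {z. p z \<noteq> z}"
    proof
      fix z assume z: "z \<in> {z. q z \<noteq> z}"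
      show "z \<in> {z. p z \<noteq> z}"
      proof (rule ccontr)
        assume "z \<notin> {z. p z \<noteq> z}"
        then have pz: "p z = z" by simp
        then have "z \<noteq> x" "z \<noteq> p x" using x inj by (auto dest: injD)
        then show False using z pz by (simp add: q_def Transposition.transpose_def)
      qed
    qed
    moreover have "x \<in> {z. p z \<noteq> z} - {z. q z \<noteq> z}" using x qx by simp
    ultimately have "{z. q z \<noteq> z} \<subset> {z. p z \<noteq> z}" by blast
    then have "card {z. q z \<noteq> z} < card {z. p z \<noteq> z}"
      using fin by (rule psubset_card_mono[rotated])
    from less.hyps[OF this q] obtain c' where
      c': "card (I q) = 2 ^ c'" "sign q = (- 1) ^ (card A + c')"
      unfolding I_def by blast
    have eq: "q z = p z" if "z \<noteq> x" "p z \<noteq> x" for z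
      using that inj by (auto simp: q_def Transposition.transpose_def dest: injD)
    have eq2: "q z = p x" if "p z = x" for z
      using that by (auto simp: q_def Transposition.transpose_def)
    have "bij_betw (\<lambda>(f, b). f(x := b)) (I p \<times> UNIV) (I q)"
    proof (rule bij_betw_byWitness[where f' = "\<lambda>g. (g(x := g (p x)), g x)"])
      show "\<forall>a\<in>I p \<times> UNIV.
          (case (case a of (f, b) \<Rightarrow> f(x := b)) of g \<Rightarrow> (g(x := g (p x)), g x)) = a"
        using x xA by (auto simp: I_def)
      show "\<forall>g\<in>I q. (case (g(x := g (p x)), g x) of (f, b) \<Rightarrow> f(x := b)) = g"
        by auto
      show "(\<lambda>(f, b). f(x := b)) ` (I p \<times> UNIV) \<subseteq> I q"
      proof clarify
        fix f b assume f: "f \<in> I p"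
        have "(f(x := b)) (q z) = (f(x := b)) z" if z: "z \<in> A" for z
        proof (cases "z = x")
          case False
          then have "q z \<noteq> x" using qx q permutes_inj by (metis injD)
          moreover have "f (q z) = f z"
          proof (cases "p z = x")
            case True
            then have "f x = f z" using f z unfolding I_def by force
            moreover have "f (p x) = f x" using f xA by (auto simp: I_def)
            ultimately show ?thesis using eq2[OF True] by simp
          qed (use eq[OF False] f z in \<open>auto simp: I_def\<close>)
          ultimately show ?thesis using False by simp
        qed (simp add: qx)
        moreover have "f(x := b) \<in> A \<rightarrow>\<^sub>E UNIV"
          using f xA by (auto simp: I_def PiE_def extensional_def)
        ultimately show "f(x := b) \<in> I q" unfolding I_def by blast
      qed
      show "(\<lambda>g. (g(x := g (p x)), g x)) ` I q \<subseteq> I p \<times> UNIV"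
      proof clarify
        fix g assume g: "g \<in> I q"
        let ?f = "g(x := g (p x))"
        have "?f (p z) = ?f z" if z: "z \<in> A" for z
        proof (cases "z = x")
          case True then show ?thesis using x by simp
        next
          case zx: False
          have "g (q z) = g z" using g z by (auto simp: I_def)
          then show ?thesis using zx eq[of z] eq2[of z] by (cases "p z = x") auto
        qed
        moreover have "?f \<in> A \<rightarrow>\<^sub>E UNIV"
          using g xA by (auto simp: I_def PiE_def extensional_def)
        ultimately show "?f \<in> I p \<and> g x \<in> UNIV" unfolding I_def by blast
      qed
    qed
    then have card2: "2 * card (I p) = 2 ^ c'"
      using c'(1) by (simp add: bij_betw_same_card[symmetric] card_cartesian_product)
    have "c' \<noteq> 0"
    proof
      assume "c' = 0"
      with card2 have "2 * card (I p) = 1" by simp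
      then show False by presburger
    qed
    then obtain c where c: "c' = Suc c" by (cases c') auto
    have "permutation p" using p \<open>finite A\<close> permutation_permutes by blast
    moreover have "permutation (Transposition.transpose x (p x))"
      by (simp add: permutation_swap_id)
    ultimately have "sign q = - sign p"
      using x by (simp add: q_def sign_compose sign_swap_id)
    then have "sign p = (- 1) ^ (card A + c)" using c'(2) c by simp
    moreover have "card (I p) = 2 ^ c" using card2 c by simp
    ultimately show ?thesis unfolding I_def by blast
  qed
qed

text \<open>A perfect matching of \<open>A\<close>, given by the involution that exchanges the two ends of every pair.  It is
  the identity off \<open>A\<close>, so that it is a permutation in the sense of \<open>permutes\<close>.\<close>

definition matching_on :: "'b set \<Rightarrow> ('b \<Rightarrow> 'b) \<Rightarrow> bool" where
  "matching_on A d \<longleftrightarrow> (\<forall>x\<in>A. d x \<in> A \<and> d x \<noteq> x \<and> d (d x) = x) \<and> (\<forall>x. x \<notin> A \<longrightarrow> d x = x)"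

text \<open>Choosing a transversal amounts to orienting the matching.\<close>

definition transversal :: "'b set \<Rightarrow> ('b \<Rightarrow> 'b) \<Rightarrow> 'b set \<Rightarrow> bool" where
  "transversal A d F \<longleftrightarrow> F \<subseteq> A \<and> (\<forall>x\<in>A. d x \<in> F \<longleftrightarrow> x \<notin> F)"

lemma matching_onD:
  assumes "matching_on A d"
  shows "x \<in> A \<Longrightarrow> d x \<in> A" "x \<in> A \<Longrightarrow> d x \<noteq> x" "d (d x) = x" "x \<notin> A \<Longrightarrow> d x = x"
proof -
  show "x \<in> A \<Longrightarrow> d x \<in> A" "x \<in> A \<Longrightarrow> d x \<noteq> x" "x \<notin> A \<Longrightarrow> d x = x"
    using assms by (simp_all add: matching_on_def)
  show "d (d x) = x" using assms unfolding matching_on_def by metis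
qed

lemma matching_on_permutes: "matching_on A d \<Longrightarrow> d permutes A"
  unfolding permutes_def by (metis matching_onD(3,4))

lemma transversalD:
  assumes "transversal A d F"
  shows "x \<in> F \<Longrightarrow> x \<in> A" "x \<in> A \<Longrightarrow> d x \<in> F \<longleftrightarrow> x \<notin> F"
  using assms unfolding transversal_def by auto

lemma transversal_bij:
  assumes "matching_on A d" "transversal A d F"
  shows "bij_betw d F (A - F)"
  by (rule bij_betw_byWitness[where f' = d])
     (use matching_onD[OF assms(1)] transversalD[OF assms(2)] in auto)

lemma card_transversal:
  assumes "matching_on A d" "transversal A d F" "finite A"
  shows "card A = 2 * card F"
proof -
  have "F \<subseteq> A" using assms(2) by (simp add: transversal_def)
  then have "card A = card F + card (A - F)"
    using assms(3) by (simp add: card_Diff_subset card_mono finite_subset)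
  then show ?thesis using transversal_bij[OF assms(1,2)] by (simp add: bij_betw_same_card)
qed

text \<open>The \<open>{0, 1}\<close>-functions constant on the components of the graph with edges \<open>d\<close> and \<open>g\<close>; their number
  stands for the number of these components.\<close>

definition invariant_colorings :: "'b set \<Rightarrow> ('b \<Rightarrow> 'b) \<Rightarrow> ('b \<Rightarrow> 'b) \<Rightarrow> ('b \<Rightarrow> bool) set" where
  "invariant_colorings A d g =
     {f \<in> A \<rightarrow>\<^sub>E UNIV. \<forall>x\<in>A. f (d x) = f x \<and> f (g x) = f x}"

text \<open>The permutation that moves the matching \<open>d\<close> to the matching \<open>g\<close>, both oriented by the common
  transversal \<open>F\<close>: the points of \<open>F\<close> stay, the other end of every \<open>d\<close>-pair becomes the other end of the
  \<open>g\<close>-pair.\<close>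

definition carry :: "'b set \<Rightarrow> 'b set \<Rightarrow> ('b \<Rightarrow> 'b) \<Rightarrow> ('b \<Rightarrow> 'b) \<Rightarrow> 'b \<Rightarrow> 'b" where
  "carry A F d g x = (if x \<in> A - F then g (d x) else x)"

context
  fixes A F :: "'b set" and d g :: "'b \<Rightarrow> 'b"
  assumes fin: "finite A" and d: "matching_on A d" and g: "matching_on A g"
    and Fd: "transversal A d F" and Fg: "transversal A g F"
begin

lemma carry_permutes: "carry A F d g permutes (A - F)"
proof (rule bij_imp_permutes)
  show "bij_betw (carry A F d g) (A - F) (A - F)"
    by (rule bij_betw_byWitness[where f' = "carry A F g d"])
       (use matching_onD[OF d] matching_onD[OF g] transversalD[OF Fd] transversalD[OF Fg]
         in \<open>simp_all add: carry_def image_subset_iff\<close>)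
qed (auto simp: carry_def)

lemma carry_intertwines: "x \<in> A \<Longrightarrow> carry A F d g (d x) = g (carry A F d g x)"
  using matching_onD[OF d] matching_onD[OF g] transversalD[OF Fd] transversalD[OF Fg]
  by (auto simp: carry_def)

text \<open>Off \<open>F\<close>, \<open>carry\<close> is \<open>g \<circ> d\<close>, and each cycle of \<open>d \<union> g\<close> meets the complement of \<open>F\<close> in exactly one
  cycle of \<open>g \<circ> d\<close>.\<close>

lemma sign_carry:
  assumes "card (invariant_colorings A d g) = 2 ^ c"
  shows "sign (carry A F d g) = (- 1) ^ (card F + c)"
proof -
  note D = matching_onD[OF d] and G = matching_onD[OF g]
    and FD = transversalD[OF Fd] and FG = transversalD[OF Fg]
  let ?e = "\<lambda>f. \<lambda>x\<in>A. if x \<in> F then f (d x) else f x"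
  let ?p = "carry A F d g"
  let ?I = "{f \<in> (A - F) \<rightarrow>\<^sub>E (UNIV::bool set). \<forall>x\<in>A - F. f (?p x) = f x}"
  have "bij_betw (\<lambda>f. restrict f (A - F)) (invariant_colorings A d g) ?I"
  proof (rule bij_betw_byWitness[where f' = ?e])
    show "\<forall>f\<in>invariant_colorings A d g.
        ?e (restrict f (A - F)) = f"
    proof
      fix f assume f: "f \<in> invariant_colorings A d g"
      show "?e (restrict f (A - F)) = f"
      proof
        fix x
        show "?e (restrict f (A - F)) x = f x"
          using f D(1)[of x] FD(2)[of x]
          by (cases "x \<in> A") (simp_all add: invariant_colorings_def PiE_def extensional_def)
      qed
    qed
    show "\<forall>f\<in>?I. restrict (?e f) (A - F) = f"
    proof clarify
      fix f assume f: "f \<in> (A - F) \<rightarrow>\<^sub>E (UNIV::bool set)"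
      show "restrict (?e f) (A - F) = f"
      proof
        fix x
        show "restrict (?e f) (A - F) x = f x"
          using f by (cases "x \<in> A - F") (auto simp: PiE_def extensional_def)
      qed
    qed
    show "(\<lambda>f. restrict f (A - F)) ` invariant_colorings A d g \<subseteq> ?I"
    proof clarify
      fix f assume f: "f \<in> invariant_colorings A d g"
      have "restrict f (A - F) (?p x) = restrict f (A - F) x" if x: "x \<in> A - F" for x
      proof -
        have "f (g (d x)) = f (d x)" "f (d x) = f x"
          using f x D(1)[of x] by (simp_all add: invariant_colorings_def)
        moreover have "g (d x) \<in> A - F" using x D G FD FG by simp
        ultimately show ?thesis using x by (simp add: carry_def)
      qed
      then show "restrict f (A - F) \<in> (A - F) \<rightarrow>\<^sub>E UNIV \<and>
          (\<forall>x\<in>A - F. restrict f (A - F) (?p x) = restrict f (A - F) x)"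
        by (intro conjI ballI) (simp_all only: restrict_PiE_iff, simp)
    qed
    show "?e ` ?I \<subseteq> invariant_colorings A d g"
    proof clarify
      fix f assume f: "f \<in> (A - F) \<rightarrow>\<^sub>E (UNIV::bool set)" "\<forall>x\<in>A - F. f (?p x) = f x"
      have step: "f (g (d x)) = f x" if "x \<in> A" "x \<notin> F" for x
        using f(2)[rule_format, of x] that by (simp add: carry_def)
      have "(if g x \<in> F then f (d (g x)) else f (g x)) = (if x \<in> F then f (d x) else f x)"
        if x: "x \<in> A" for x
      proof (cases "x \<in> F")
        case True
        then show ?thesis using step[of "d x"] D(1,3)[of x] FD(2)[of x] FG(2)[of x] x by simp
      next
        case False
        then show ?thesis
          using step[of "d (g x)"] D(1,3)[of "g x"] G(1,3)[of x] FD(2)[of "g x"] FG(2)[of x] x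
          by simp
      qed
      moreover have "(if d x \<in> F then f (d (d x)) else f (d x)) = (if x \<in> F then f (d x) else f x)"
        if "x \<in> A" for x
        using FD(2)[OF that] D(3)[of x] by simp
      ultimately show "(?e f) \<in> invariant_colorings A d g"
        unfolding invariant_colorings_def using D(1) G(1) by simp
    qed
  qed
  then have "card ?I = 2 ^ c" using assms by (simp add: bij_betw_same_card)
  moreover obtain c' where "card ?I = 2 ^ c'" "sign ?p = (- 1) ^ (card (A - F) + c')"
    using sign_eq_card_invariant_functions[OF finite_Diff[OF fin] carry_permutes] by metis
  moreover have "card (A - F) = card F"
    using transversal_bij[OF d Fd] by (simp add: bij_betw_same_card)
  ultimately show ?thesis by simp
qed

end

text \<open>Such a permutation acts on the second ends of the pairs as it does on the first ends, so its sign is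
  a square.\<close>

lemma even_centralizer:
  assumes "finite A" "matching_on A d" "transversal A d F" "p permutes A"
    and comm: "\<And>x. x \<in> A \<Longrightarrow> p (d x) = d (p x)" and F: "p ` F \<subseteq> F"
  shows "sign p = 1"
proof -
  note D = matching_onD[OF assms(2)] and FD = transversalD[OF assms(3)]
  define a where "a x = (if x \<in> F then p x else x)" for x
  have finF: "finite F" using assms(1) FD(1) by (meson finite_subset subsetI)
  have "inj p" using assms(4) permutes_inj by blast
  then have "bij_betw p F F"
    using F finF by (simp add: bij_betw_def endo_inj_surj inj_on_subset[of _ UNIV])
  then have "bij_betw a F F"
    by (rule bij_betw_cong[THEN iffD1, rotated]) (simp add: a_def)
  then have a: "a permutes F" by (rule bij_imp_permutes) (simp add: a_def)
  have "p = a \<circ> (d \<circ> a \<circ> d)"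
  proof
    fix x
    consider "x \<notin> A" | "x \<in> F" | "x \<in> A" "x \<notin> F" using FD by blast
    then show "p x = (a \<circ> (d \<circ> a \<circ> d)) x"
    proof cases
      case 1
      moreover have "x \<notin> F" using 1 FD by blast
      ultimately show ?thesis using D assms(4) by (simp add: a_def permutes_not_in)
    next
      case 2 then show ?thesis using D FD by (simp add: a_def)
    next
      case 3
      then have "d (p (d x)) = p x" using comm D by simp
      moreover have "p x \<notin> F"
      proof
        assume "p x \<in> F"
        moreover have "p (d x) \<in> F" using 3 FD F by blast
        moreover have "p x \<in> A" using 3 assms(4) by (simp add: permutes_in_image)
        ultimately show False using FD(2)[of "p x"] comm[of x] 3 by simp
      qed
      ultimately show ?thesis using 3 FD by (simp add: a_def)
    qed
  qed
  moreover have "permutation d" "permutation a"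
    using permutation_permutes a finF assms(1) matching_on_permutes[OF assms(2)] by blast+
  ultimately show ?thesis
    by (simp add: sign_compose permutation_compose) (simp add: sign_def)
qed

text \<open>Exchange the ends of the pairs that \<open>F\<close> and \<open>G\<close> orient differently, at the price of one transposition
  for each.\<close>

lemma swap_transversals:
  assumes "finite A" "matching_on A d" "transversal A d F" "transversal A d G"
  obtains k where "k permutes A" "\<And>x. x \<in> A \<Longrightarrow> k (d x) = d (k x)" "k ` F \<subseteq> G"
    "sign k = (- 1) ^ card (F - G)"
proof -
  note D = matching_onD[OF assms(2)] and FD = transversalD[OF assms(3)]
    and GD = transversalD[OF assms(4)]
  define k where "k B x = (if x \<in> B \<or> d x \<in> B then d x else x)" for B x
  have "k B permutes A \<and> sign (k B) = (- 1) ^ card B" if "finite B" "B \<subseteq> F" for B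
    using that
  proof (induction B)
    case empty
    have "k {} = id" by (auto simp: k_def)
    then show ?case by (simp only: permutes_id sign_id) simp
  next
    case (insert y B)
    have y: "y \<in> A" "d y \<in> A" "d y \<notin> F" "y \<in> F" using insert FD D by auto
    have inj: "d u = d v \<longleftrightarrow> u = v" "d u = y \<longleftrightarrow> u = d y" for u v using D(3) by metis+
    have "k (insert y B) = Transposition.transpose y (d y) \<circ> k B"
    proof
      fix x
      show "k (insert y B) x = (Transposition.transpose y (d y) \<circ> k B) x"
        using insert.hyps(2) insert.prems y D(2,3)[of x] D(2,3)[of y] D(3)[of "d x"]
        by (cases "x = y"; cases "x = d y") (auto simp: k_def Transposition.transpose_def inj D(3))
    qed
    moreover have "Transposition.transpose y (d y) permutes A" using y by (simp add: permutes_swap_id)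
    moreover have IH: "k B permutes A" "sign (k B) = (- 1) ^ card B" using insert by auto
    moreover have "permutation (k B)" using IH assms(1) permutation_permutes by blast
    moreover have "sign (Transposition.transpose y (d y)) = - 1"
      using D(2)[OF y(1)] by (simp add: sign_swap_id)
    ultimately show ?case
      using insert.hyps permutes_compose[of "k B" A "Transposition.transpose y (d y)"]
      by (simp only: sign_compose permutation_swap_id) simp
  qed
  moreover have "finite F" using assms(1) FD(1) by (meson finite_subset subsetI)
  ultimately have "k (F - G) permutes A" "sign (k (F - G)) = (- 1) ^ card (F - G)" by auto
  moreover have "k (F - G) (d x) = d (k (F - G) x)" for x using D by (auto simp: k_def)
  moreover have "k (F - G) ` F \<subseteq> G" using FD GD by (auto simp: k_def)
  ultimately show ?thesis using that by blast
qed

text \<open>Moving the matchings around the triangle \<open>g \<rightarrow> d \<rightarrow> s \<rightarrow> g\<close>, and changing the transversal by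
  \<open>swap_transversals\<close> at each corner, ends with a permutation that commutes with \<open>g\<close> and preserves \<open>F\<close>.
  It is even, so the signs of the six factors multiply to \<open>1\<close>.  This is what determines the parity of
  the Euler characteristic.\<close>

lemma three_matchings_parity:
  fixes A :: "'b set"
  assumes fin: "finite A" and d: "matching_on A d" and s: "matching_on A s" and g: "matching_on A g"
    and P: "transversal A d P" "transversal A s P"
    and F: "transversal A d F" "transversal A g F"
    and G: "transversal A s G" "transversal A g G"
    and card: "card (invariant_colorings A d s) = 2 ^ m" "card (invariant_colorings A d g) = 2 ^ w"
      "card (invariant_colorings A s g) = 2 ^ f"
  shows "(- 1 :: int) ^ (card P + m + w + f) = (- 1) ^ (card (F - P) + card (P - G) + card (G - F))"
proof -
  have card': "card (invariant_colorings A g d) = 2 ^ w"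
    using card(2) by (simp add: invariant_colorings_def conj_commute)
  obtain k1 where k1: "k1 permutes A" "\<And>x. x \<in> A \<Longrightarrow> k1 (d x) = d (k1 x)" "k1 ` F \<subseteq> P"
    "sign k1 = (- 1) ^ card (F - P)" using swap_transversals[OF fin d F(1) P(1)] by blast
  obtain k2 where k2: "k2 permutes A" "\<And>x. x \<in> A \<Longrightarrow> k2 (s x) = s (k2 x)" "k2 ` P \<subseteq> G"
    "sign k2 = (- 1) ^ card (P - G)" using swap_transversals[OF fin s P(2) G(1)] by blast
  obtain k3 where k3: "k3 permutes A" "\<And>x. x \<in> A \<Longrightarrow> k3 (g x) = g (k3 x)" "k3 ` G \<subseteq> F"
    "sign k3 = (- 1) ^ card (G - F)" using swap_transversals[OF fin g G(2) F(2)] by blast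
  let ?t1 = "carry A F g d" and ?t2 = "carry A P d s" and ?t3 = "carry A G s g"
  have t: "?t1 permutes A" "?t2 permutes A" "?t3 permutes A"
    using carry_permutes[OF fin g d F(2,1)] carry_permutes[OF fin d s P(1,2)]
      carry_permutes[OF fin s g G(1,2)] by (auto intro: permutes_subset)
  let ?p = "k3 \<circ> ?t3 \<circ> k2 \<circ> ?t2 \<circ> k1 \<circ> ?t1"
  have p: "?p permutes A" using t k1 k2 k3 by (intro permutes_compose)
  define I where "I p a c \<longleftrightarrow> p permutes A \<and> (\<forall>x\<in>A. p (a x) = c (p x))" for p a c
  have trans: "I (q \<circ> p) a c" if "I p a b" "I q b c" for p q a b c
    using that by (auto simp: I_def permutes_in_image intro: permutes_compose)
  have "I ?t1 g d" using t(1) carry_intertwines[OF fin g d F(2,1)] unfolding I_def by blast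
  moreover have "I ?t2 d s" using t(2) carry_intertwines[OF fin d s P] unfolding I_def by blast
  moreover have "I ?t3 s g" using t(3) carry_intertwines[OF fin s g G] unfolding I_def by blast
  moreover have "I k1 d d" using k1(1,2) unfolding I_def by blast
  moreover have "I k2 s s" using k2(1,2) unfolding I_def by blast
  moreover have "I k3 g g" using k3(1,2) unfolding I_def by blast
  ultimately have "I ?p g g" unfolding o_assoc[symmetric] by (blast intro: trans)
  then have "?p (g x) = g (?p x)" if x: "x \<in> A" for x using x unfolding I_def by blast
  moreover have "?p ` F \<subseteq> F"
  proof clarify
    fix x assume "x \<in> F"
    moreover have "?t1 x = x" if "x \<in> F" for x using that by (simp add: carry_def)
    moreover have "?t2 x = x" if "x \<in> P" for x using that by (simp add: carry_def)
    moreover have "?t3 x = x" if "x \<in> G" for x using that by (simp add: carry_def)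
    ultimately show "?p x \<in> F" using k1(3) k2(3) k3(3) by (auto simp: image_subset_iff)
  qed
  ultimately have "sign ?p = 1" using even_centralizer[OF fin g F(2) p] by blast
  moreover have "permutation k1" "permutation k2" "permutation k3"
    "permutation ?t1" "permutation ?t2" "permutation ?t3"
    using k1(1) k2(1) k3(1) t fin by (auto simp: permutation_permutes)
  ultimately have "sign k3 * sign ?t3 * sign k2 * sign ?t2 * sign k1 * sign ?t1 = 1"
    by (simp add: sign_compose permutation_compose)
  moreover have "sign ?t1 = (- 1) ^ (card P + w)" "sign ?t2 = (- 1) ^ (card P + m)"
    "sign ?t3 = (- 1) ^ (card P + f)"
  proof -
    have "card F = card P" "card G = card P"
      using card_transversal[OF d F(1) fin] card_transversal[OF s G(1) fin]
        card_transversal[OF d P(1) fin] by simp_all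
    then show "sign ?t1 = (- 1) ^ (card P + w)" "sign ?t2 = (- 1) ^ (card P + m)"
      "sign ?t3 = (- 1) ^ (card P + f)"
      using sign_carry[OF fin g d F(2,1) card'] sign_carry[OF fin d s P(1,2) card(1)]
        sign_carry[OF fin s g G(1,2) card(3)] by simp_all
  qed
  ultimately have "(-1::int) ^ ((card P + m + w + f) + (card P + card P)
      + (card (F - P) + card (P - G) + card (G - F))) = 1"
    using k1(4) k2(4) k3(4) by (simp only: power_add mult_ac)
  then show ?thesis
    by (auto simp: uminus_power_if split: if_splits)
qed

section \<open>Cycles formed by two pair partitions\<close>

text \<open>A point outside all pairs is its own partner, which makes \<open>partner \<pi>\<close> an involution as required by
  \<open>matching_on\<close>.\<close>

definition partner :: "'b set set \<Rightarrow> 'b \<Rightarrow> 'b" where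
  "partner \<pi> x = (if \<exists>y. y \<noteq> x \<and> {x, y} \<in> \<pi> then THE y. y \<noteq> x \<and> {x, y} \<in> \<pi> else x)"

lemma pair_partition_unique:
  assumes "pair_partition A \<pi>" "{x, y} \<in> \<pi>" "{x, z} \<in> \<pi>"
  shows "y = z"
proof -
  have "{x, y} \<inter> {x, z} \<noteq> {}" by simp
  moreover have "disjoint \<pi>" using assms(1) by (simp add: pair_partition_def partition_on_def)
  ultimately have "{x, y} = {x, z}" using assms(2,3) by (meson disjointD)
  then show ?thesis by (metis doubleton_eq_iff)
qed

lemma pair_partition_pair:
  assumes "pair_partition A \<pi>" "{x, y} \<in> \<pi>"
  shows "x \<in> A" "y \<in> A" "x \<noteq> y"
proof -
  show "x \<in> A" "y \<in> A" using assms unfolding pair_partition_def partition_on_def by blast+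
  show "x \<noteq> y" using assms unfolding pair_partition_def by force
qed

lemma pair_partition_ex:
  assumes "pair_partition A \<pi>" "x \<in> A"
  shows "\<exists>y. y \<noteq> x \<and> {x, y} \<in> \<pi>"
proof -
  obtain p where p: "p \<in> \<pi>" "x \<in> p"
    using assms unfolding pair_partition_def partition_on_def by blast
  then have "card p = 2" using assms by (simp add: pair_partition_def)
  then obtain a b where "p = {a, b}" "a \<noteq> b" by (meson card_2_iff)
  then show ?thesis using p by (metis doubleton_eq_iff empty_iff insert_iff)
qed

lemma partner_eqI:
  assumes "pair_partition A \<pi>" "{x, y} \<in> \<pi>"
  shows "partner \<pi> x = y"
proof -
  have "y \<noteq> x" using pair_partition_pair[OF assms] by simp
  then have "(THE y. y \<noteq> x \<and> {x, y} \<in> \<pi>) = y"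
    using assms pair_partition_unique[OF assms(1)] by (intro the_equality) auto
  then show ?thesis using \<open>y \<noteq> x\<close> assms(2) by (auto simp: partner_def)
qed

lemma partner_mem:
  assumes "pair_partition A \<pi>" "x \<in> A"
  shows "{x, partner \<pi> x} \<in> \<pi>"
  using pair_partition_ex[OF assms] partner_eqI[OF assms(1)] by auto

lemma matching_on_partner:
  assumes "pair_partition A \<pi>"
  shows "matching_on A (partner \<pi>)"
  unfolding matching_on_def
proof (intro conjI ballI allI impI)
  fix x assume x: "x \<in> A"
  note p = partner_mem[OF assms x]
  show "partner \<pi> x \<in> A" "partner \<pi> x \<noteq> x" using pair_partition_pair[OF assms p] by auto
  show "partner \<pi> (partner \<pi> x) = x" using p by (intro partner_eqI[OF assms]) (simp add: insert_commute)
next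
  fix x assume "x \<notin> A"
  then show "partner \<pi> x = x" using pair_partition_pair[OF assms] by (auto simp: partner_def)
qed

lemma pair_partition_eq_partner:
  assumes "pair_partition A \<pi>"
  shows "\<pi> = (\<lambda>x. {x, partner \<pi> x}) ` A"
proof
  show "(\<lambda>x. {x, partner \<pi> x}) ` A \<subseteq> \<pi>" using partner_mem[OF assms] by auto
  show "\<pi> \<subseteq> (\<lambda>x. {x, partner \<pi> x}) ` A"
  proof
    fix p assume p: "p \<in> \<pi>"
    then have "card p = 2" using assms by (simp add: pair_partition_def)
    then obtain a b where "p = {a, b}" by (meson card_2_iff)
    then show "p \<in> (\<lambda>x. {x, partner \<pi> x}) ` A"
      using p pair_partition_pair[OF assms] partner_eqI[OF assms] by force
  qed
qed

lemma pair_partition_transversal: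
  assumes "pair_partition A \<pi>" "transversal A (partner \<pi>) F"
  shows "bij_betw (\<lambda>x. {x, partner \<pi> x}) F \<pi>"
proof (rule bij_betw_imageI)
  note D = matching_onD[OF matching_on_partner[OF assms(1)]] and FD = transversalD[OF assms(2)]
  show "inj_on (\<lambda>x. {x, partner \<pi> x}) F"
    using D FD by (auto simp: inj_on_def doubleton_eq_iff)
  show "(\<lambda>x. {x, partner \<pi> x}) ` F = \<pi>"
  proof
    show "(\<lambda>x. {x, partner \<pi> x}) ` F \<subseteq> \<pi>" using partner_mem[OF assms(1)] FD by auto
    show "\<pi> \<subseteq> (\<lambda>x. {x, partner \<pi> x}) ` F"
    proof
      fix p assume "p \<in> \<pi>"
      then obtain x where x: "x \<in> A" "p = {x, partner \<pi> x}"
        using pair_partition_eq_partner[OF assms(1)] by blast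
      show "p \<in> (\<lambda>x. {x, partner \<pi> x}) ` F"
      proof (cases "x \<in> F")
        case False
        then have "partner \<pi> x \<in> F" "p = {partner \<pi> x, partner \<pi> (partner \<pi> x)}"
          using x D FD by auto
        then show ?thesis by blast
      qed (use x in blast)
    qed
  qed
qed

context
  fixes A :: "'b set" and \<pi> \<rho> :: "'b set set" and d g :: "'b \<Rightarrow> 'b"
  assumes fin: "finite A" and \<pi>: "pair_partition A \<pi>" and \<rho>: "pair_partition A \<rho>"
    and d_def: "d = partner \<pi>" and g_def: "g = partner \<rho>"
begin

private lemma D: "matching_on A d" using matching_on_partner[OF \<pi>] by (simp add: d_def)
private lemma G: "matching_on A g" using matching_on_partner[OF \<rho>] by (simp add: g_def)

text \<open>An alternating walk that returned with the wrong parity would, folded at its middle, give a fixed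
  point of \<open>d\<close> or of \<open>g\<close>.  The induction takes one application of \<open>g \<circ> d\<close> off each end.\<close>

lemma alternation_never_closes_oddly: "x \<in> A \<Longrightarrow> ((g \<circ> d) ^^ k) x \<noteq> d x"
proof (induction k arbitrary: x rule: less_induct)
  case (less k)
  note d = matching_onD[OF D] and g = matching_onD[OF G]
  consider "k = 0" | "k = 1" | l where "k = Suc (Suc l)" by (metis One_nat_def not0_implies_Suc)
  then show ?case
  proof cases
    case (3 l)
    have y: "g (d x) \<in> A" using less.prems d g by simp
    have "((g \<circ> d) ^^ l) (g (d x)) \<noteq> d (g (d x))" using less.IH[of l "g (d x)"] 3 y by (simp del: o_apply)
    then have "d (((g \<circ> d) ^^ l) (g (d x))) \<noteq> g (d x)" using d(3) by metis
    then have "g (d (((g \<circ> d) ^^ l) (g (d x)))) \<noteq> d x" using g(3) by metis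
    moreover have "((g \<circ> d) ^^ k) x = g (d (((g \<circ> d) ^^ l) (g (d x))))"
      using funpow_swap1[of "g \<circ> d" l x] 3 by simp
    ultimately show ?thesis by (simp del: o_apply)
  next
    case 1
    then show ?thesis using d(2)[OF less.prems, symmetric] by simp
  next
    case 2
    then show ?thesis using g(2)[OF d(1)[OF less.prems]] by simp
  qed
qed

text \<open>Follow \<open>g \<circ> d\<close> from \<open>x\<close> until the first return, inserting after each point its image under \<open>d\<close>.\<close>

lemma alternating_cycle_through:
  assumes x: "x \<in> A"
  obtains xs where "alternating_cycle \<pi> \<rho> xs" "x \<in> set xs"
proof -
  note d = matching_onD[OF D] and g = matching_onD[OF G]
  define p where "p = g \<circ> d"
  have p: "p permutes A"
    unfolding p_def by (intro permutes_compose matching_on_permutes D G)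
  have inj: "inj (p ^^ k)" for k using p permutes_inj inj_fn by blast
  have inA: "(p ^^ k) y \<in> A" if "y \<in> A" for k y
    using that p by (induction k) (auto simp: permutes_in_image)
  have "\<exists>k>0. (p ^^ k) x = x"
  proof -
    have "\<not> inj_on (\<lambda>k. (p ^^ k) x) (UNIV :: nat set)"
    proof
      assume "inj_on (\<lambda>k. (p ^^ k) x) (UNIV :: nat set)"
      then have "infinite (range (\<lambda>k. (p ^^ k) x))" using finite_imageD by blast
      moreover have "range (\<lambda>k. (p ^^ k) x) \<subseteq> A" using inA x by auto
      ultimately show False using fin finite_subset by blast
    qed
    then obtain i j where ij: "i \<noteq> j" "(p ^^ i) x = (p ^^ j) x" by (auto simp: inj_on_def)
    have main: "\<exists>k>0. (p ^^ k) x = x" if "i < j" "(p ^^ i) x = (p ^^ j) x" for i j :: nat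
    proof -
      have "(p ^^ i) ((p ^^ (j - i)) x) = (p ^^ (i + (j - i))) x" by (simp only: funpow_add o_apply)
      also have "\<dots> = (p ^^ i) x" using that by simp
      finally have "(p ^^ (j - i)) x = x" using inj_eq[OF inj[of i], of _ x] by simp
      then show ?thesis using that by (intro exI[of _ "j - i"]) auto
    qed
    show ?thesis using main[of i j] main[of j i] ij by (metis linorder_neqE_nat)
  qed
  define L where "L = (LEAST k. k > 0 \<and> (p ^^ k) x = x)"
  have L: "L > 0" "(p ^^ L) x = x"
    using LeastI_ex[OF \<open>\<exists>k>0. (p ^^ k) x = x\<close>] by (auto simp: L_def)
  have least: "(p ^^ k) x \<noteq> x" if "0 < k" "k < L" for k
    using that not_less_Least[of k "\<lambda>k. k > 0 \<and> (p ^^ k) x = x"] by (auto simp: L_def)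
  define v where "v i = (if even i then (p ^^ (i div 2)) x else d ((p ^^ (i div 2)) x))" for i :: nat
  have shift: "(p ^^ k) x = (p ^^ (k - i)) ((p ^^ i) x)" if "i \<le> k" for i k
  proof -
    have "(p ^^ (k - i)) ((p ^^ i) x) = (p ^^ ((k - i) + i)) x" by (simp only: funpow_add o_apply)
    then show ?thesis using that by simp
  qed
  have diff: "(p ^^ i) x \<noteq> (p ^^ k) x" if "i < k" "k < L" for i k
  proof
    assume "(p ^^ i) x = (p ^^ k) x"
    moreover have "(p ^^ k) x = (p ^^ i) ((p ^^ (k - i)) x)"
      using shift[of "k - i" k] that by simp
    ultimately have "(p ^^ (k - i)) x = x" using inj_eq[OF inj[of i], of x] by simp
    then show False using least[of "k - i"] that by simp
  qed
  have odd: "(p ^^ i) x \<noteq> d ((p ^^ k) x)" for i k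
  proof (cases "k \<le> i")
    case True
    then show ?thesis
      using shift[OF True] alternation_never_closes_oddly[OF inA[OF x, of k], of "i - k"]
      by (simp add: p_def)
  next
    case False
    then have "(p ^^ k) x = (p ^^ (k - i)) ((p ^^ i) x)" by (intro shift) simp
    then have "(p ^^ k) x \<noteq> d ((p ^^ i) x)"
      using alternation_never_closes_oddly[OF inA[OF x, of i], of "k - i"] by (simp add: p_def)
    then show ?thesis using d(3) by metis
  qed
  have diff': "(p ^^ i) x = (p ^^ k) x \<longleftrightarrow> i = k" if "i < L" "k < L" for i k
    using diff[of i k] diff[of k i] that by (metis linorder_neqE_nat)
  have dinj: "d a = d b \<longleftrightarrow> a = b" for a b using d(3) by metis
  let ?xs = "map v [0..<2 * L]"
  have "inj_on v {0..<2 * L}"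
  proof (rule inj_onI)
    fix i k assume ik: "i \<in> {0..<2 * L}" "k \<in> {0..<2 * L}" "v i = v k"
    then have "i div 2 < L" "k div 2 < L" by auto
    then have "even i = even k \<and> i div 2 = k div 2"
      using ik odd[of "i div 2" "k div 2"] odd[of "k div 2" "i div 2"] diff'
      by (auto simp: v_def dinj split: if_splits)
    then show "i = k" by (metis bit_eq_rec)
  qed
  then have "distinct ?xs" by (simp add: distinct_map)
  moreover have "{?xs ! i, ?xs ! (Suc i mod length ?xs)} \<in> (if even i then \<pi> else \<rho>)"
    if i: "i < length ?xs" for i
  proof (cases "even i")
    case True
    then have "Suc i < 2 * L" using i by (simp; presburger)
    then have "{?xs ! i, ?xs ! (Suc i mod length ?xs)} = {(p ^^ (i div 2)) x, d ((p ^^ (i div 2)) x)}"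
      using True by (simp add: v_def)
    then show ?thesis using partner_mem[OF \<pi> inA[OF x]] True by (simp add: d_def)
  next
    case False
    have "?xs ! (Suc i mod length ?xs) = g (?xs ! i)"
    proof (cases "Suc i = 2 * L")
      case True
      have "i div 2 = L - 1" using True by linarith
      then have "g (?xs ! i) = p ((p ^^ (L - 1)) x)" using i False by (simp add: v_def p_def)
      also have "\<dots> = (p ^^ Suc (L - 1)) x" by simp
      also have "\<dots> = x" using L by simp
      finally show ?thesis using True L by (simp add: v_def)
    next
      case neq: False
      then have "Suc i < 2 * L" using i by simp
      moreover have "Suc i div 2 = Suc (i div 2)" using False by simp
      ultimately show ?thesis using False by (simp add: v_def p_def)
    qed
    moreover have "?xs ! i \<in> A" using i False inA[OF x] d(1) by (simp add: v_def)
    ultimately show ?thesis using partner_mem[OF \<rho>, of "?xs ! i"] False by (simp add: g_def)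
  qed
  ultimately have "alternating_cycle \<pi> \<rho> ?xs"
    unfolding alternating_cycle_def using L by auto
  moreover have "x \<in> set ?xs" using L by (force simp: v_def intro!: image_eqI[of _ _ 0])
  ultimately show ?thesis using that by blast
qed

lemma alternating_cycle_step:
  assumes xs: "alternating_cycle \<pi> \<rho> xs" and i: "i < length xs"
  shows "xs ! i \<in> A" "(if even i then d else g) (xs ! i) = xs ! (Suc i mod length xs)"
    "(if even i then g else d) (xs ! i) = xs ! ((i + length xs - 1) mod length xs)"
proof -
  have step: "xs ! i \<in> A \<and> (if even i then d else g) (xs ! i) = xs ! (Suc i mod length xs)"
    if "i < length xs" for i
  proof -
    have "{xs ! i, xs ! (Suc i mod length xs)} \<in> (if even i then \<pi> else \<rho>)"
      using xs that unfolding alternating_cycle_def by blast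
    then show ?thesis
      using pair_partition_pair[OF \<pi>] pair_partition_pair[OF \<rho>] partner_eqI[OF \<pi>] partner_eqI[OF \<rho>]
      by (cases "even i") (auto simp: d_def g_def)
  qed
  show "xs ! i \<in> A" "(if even i then d else g) (xs ! i) = xs ! (Suc i mod length xs)"
    using step[OF i] by auto
  define k where "k = (i + length xs - 1) mod length xs"
  have len: "even (length xs)" "length xs > 0" using xs i by (auto simp: alternating_cycle_def)
  have k: "k < length xs" "Suc k mod length xs = i" "even k \<longleftrightarrow> odd i"
  proof -
    consider "i = 0" "k = length xs - 1" | "i > 0" "k = i - 1"
      using i by (cases i) (auto simp: k_def)
    then show "k < length xs" "Suc k mod length xs = i" "even k \<longleftrightarrow> odd i"
      using i len by (cases; auto)+
  qed
  have "(if even k then d else g) (xs ! k) = xs ! i" using step[OF k(1)] k(2) by simp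
  then have "(if even k then d else g) (xs ! i) = xs ! k"
    using matching_onD(3)[OF D, of "xs ! k"] matching_onD(3)[OF G, of "xs ! k"]
    by (cases "even k") auto
  then show "(if even i then g else d) (xs ! i) = xs ! ((i + length xs - 1) mod length xs)"
    using k(3) by (simp add: k_def split: if_splits)
qed

lemma alternating_cycle_closed:
  assumes "alternating_cycle \<pi> \<rho> xs" "x \<in> set xs"
  shows "x \<in> A" "d x \<in> set xs" "g x \<in> set xs"
proof -
  obtain i where i: "i < length xs" "x = xs ! i" using assms(2) by (metis in_set_conv_nth)
  then have "length xs > 0" by auto
  then show "x \<in> A" "d x \<in> set xs" "g x \<in> set xs"
    using alternating_cycle_step[OF assms(1) i(1)] i(2) by (auto split: if_splits)
qed

lemma alternating_cycle_connected:
  assumes xs: "alternating_cycle \<pi> \<rho> xs" "x \<in> set xs" "y \<in> set xs"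
    and f: "\<And>z. z \<in> A \<Longrightarrow> f (d z) = f z \<and> f (g z) = f z"
  shows "f x = f y"
proof -
  have "f (xs ! i) = f (xs ! 0)" if "i < length xs" for i
    using that
  proof (induction i)
    case (Suc i)
    then have "f (xs ! Suc i) = f (xs ! i)"
      using alternating_cycle_step(1,2)[OF xs(1), of i] f[of "xs ! i"] by (auto split: if_splits)
    then show ?case using Suc by simp
  qed simp
  then show ?thesis using xs(2,3) by (metis in_set_conv_nth)
qed

lemma cycles_cover: "x \<in> A \<Longrightarrow> \<exists>C\<in>cycles \<pi> \<rho>. x \<in> C"
  by (erule alternating_cycle_through) (auto simp: cycles_def)

lemma cycles_closed:
  assumes "C \<in> cycles \<pi> \<rho>" "x \<in> C"
  shows "x \<in> A" "d x \<in> C" "g x \<in> C"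
  using assms alternating_cycle_closed unfolding cycles_def by blast+

lemma cycles_connected:
  assumes "C \<in> cycles \<pi> \<rho>" "x \<in> C" "y \<in> C"
    and "\<And>z. z \<in> A \<Longrightarrow> f (d z) = f z \<and> f (g z) = f z"
  shows "f x = f y"
proof -
  obtain xs where "alternating_cycle \<pi> \<rho> xs" "C = set xs" using assms(1) by (auto simp: cycles_def)
  then show ?thesis using alternating_cycle_connected[of xs x y f] assms by blast
qed

lemma cycles_nonempty: "C \<in> cycles \<pi> \<rho> \<Longrightarrow> C \<noteq> {}"
  by (auto simp: cycles_def alternating_cycle_def)

lemma finite_cycles: "finite (cycles \<pi> \<rho>)"
proof (rule finite_subset)
  show "cycles \<pi> \<rho> \<subseteq> Pow A" using cycles_closed by blast
qed (simp add: fin)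

text \<open>A cycle is connected, so it lies inside every closed set that it meets.\<close>

lemma cycles_unique:
  assumes C: "C \<in> cycles \<pi> \<rho>" "x \<in> C" and B: "\<And>y. y \<in> B \<Longrightarrow> y \<in> A \<and> d y \<in> B \<and> g y \<in> B"
    and x: "x \<in> B"
  shows "C \<subseteq> B"
proof
  fix y assume y: "y \<in> C"
  have "(z \<in> B) = (d z \<in> B)" "(z \<in> B) = (g z \<in> B)" for z
  proof -
    have "d z \<in> B \<Longrightarrow> d (d z) \<in> B" "g z \<in> B \<Longrightarrow> g (g z) \<in> B" using B by blast+
    then show "(z \<in> B) = (d z \<in> B)" "(z \<in> B) = (g z \<in> B)"
      using B[of z] matching_onD(3)[OF D, of z] matching_onD(3)[OF G, of z] by argo+
  qed
  then have "(x \<in> B) = (y \<in> B)" using cycles_connected[OF C y, of "\<lambda>z. z \<in> B"] by blast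
  then show "y \<in> B" using x by simp
qed

lemma cycles_disjoint:
  assumes "C \<in> cycles \<pi> \<rho>" "C' \<in> cycles \<pi> \<rho>" "x \<in> C" "x \<in> C'"
  shows "C = C'"
  using cycles_unique[OF assms(1,3) _ assms(4)] cycles_unique[OF assms(2,4) _ assms(3)]
    cycles_closed[OF assms(1)] cycles_closed[OF assms(2)] by (intro equalityI) auto

text \<open>Every cycle alternates between the two matchings and has even length, so its points at even
  positions contain one end of each of its pairs.\<close>

lemma common_transversal:
  obtains F where "transversal A d F" "transversal A g F"
proof -
  define E where "E xs = {xs ! i |i. i < length xs \<and> even i}" for xs :: "'b list"
  have E: "E xs \<subseteq> set xs" for xs by (auto simp: E_def)
  have alt: "(d x \<in> E xs \<longleftrightarrow> x \<notin> E xs) \<and> (g x \<in> E xs \<longleftrightarrow> x \<notin> E xs)"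
    if xs: "alternating_cycle \<pi> \<rho> xs" and x: "x \<in> set xs" for x xs
  proof -
    obtain i where i: "i < length xs" "x = xs ! i" using x by (metis in_set_conv_nth)
    have len: "even (length xs)" "length xs > 0" and dist: "distinct xs"
      using xs i by (auto simp: alternating_cycle_def)
    have mem: "xs ! k \<in> E xs \<longleftrightarrow> even k" if "k < length xs" for k
      using that dist by (auto simp: E_def nth_eq_iff_index_eq)
    have par: "even (k mod length xs) \<longleftrightarrow> even k" for k
      using len(1) by (simp add: dvd_mod_iff)
    have "xs ! (Suc i mod length xs) \<in> E xs \<longleftrightarrow> odd i"
      "xs ! ((i + length xs - 1) mod length xs) \<in> E xs \<longleftrightarrow> odd i"
      using len by (subst mem; simp add: par)+
    then show ?thesis
      using alternating_cycle_step(2,3)[OF xs i(1)] mem[OF i(1)] i(2) by (auto split: if_splits)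
  qed
  define ch where "ch C = (SOME xs. alternating_cycle \<pi> \<rho> xs \<and> set xs = C)" for C
  have ch: "alternating_cycle \<pi> \<rho> (ch C)" "set (ch C) = C" if "C \<in> cycles \<pi> \<rho>" for C
  proof -
    have "\<exists>xs. alternating_cycle \<pi> \<rho> xs \<and> set xs = C" using that by (auto simp: cycles_def)
    from someI_ex[OF this] show "alternating_cycle \<pi> \<rho> (ch C)" "set (ch C) = C"
      by (auto simp: ch_def)
  qed
  define F where "F = (\<Union>C\<in>cycles \<pi> \<rho>. E (ch C))"
  have mem: "x \<in> F \<longleftrightarrow> x \<in> E (ch C)" if "C \<in> cycles \<pi> \<rho>" "x \<in> C" for x C
    using that E ch(2) cycles_disjoint unfolding F_def by blast
  have "F \<subseteq> A" using E ch(2) cycles_closed(1) unfolding F_def by blast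
  moreover have "(d x \<in> F \<longleftrightarrow> x \<notin> F) \<and> (g x \<in> F \<longleftrightarrow> x \<notin> F)" if x: "x \<in> A" for x
  proof -
    obtain C where C: "C \<in> cycles \<pi> \<rho>" "x \<in> C" using cycles_cover[OF x] by blast
    then show ?thesis using alt[OF ch(1)[OF C(1)], of x] mem[OF C(1)] cycles_closed[OF C] ch(2)[OF C(1)]
      by simp
  qed
  ultimately show ?thesis using that unfolding transversal_def by blast
qed

text \<open>An invariant function is the same as a choice of one value for each cycle.  The range may depend on
  the cycle: in the application its size is the number of rows of the matrix of the color of a white
  vertex.\<close>

lemma card_invariant_functions:
  assumes T: "\<And>C x. C \<in> cycles \<pi> \<rho> \<Longrightarrow> x \<in> C \<Longrightarrow> S x = T C"
  shows "card {f \<in> PiE A S. \<forall>x\<in>A. f (d x) = f x \<and> f (g x) = f x} = (\<Prod>C\<in>cycles \<pi> \<rho>. card (T C))"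
proof -
  let ?X = "cycles \<pi> \<rho>"
  let ?I = "{f \<in> PiE A S. \<forall>x\<in>A. f (d x) = f x \<and> f (g x) = f x}"
  define cyc where "cyc x = (THE C. C \<in> ?X \<and> x \<in> C)" for x
  have cyc_eq: "cyc x = C" if "C \<in> ?X" "x \<in> C" for x C
    unfolding cyc_def using that by (rule_tac the_equality) (simp, metis cycles_disjoint)
  have cyc: "cyc x \<in> ?X" "x \<in> cyc x" if "x \<in> A" for x
    using cycles_cover[OF that] cyc_eq by blast+
  define rep where "rep C = (SOME x. x \<in> C)" for C :: "'b set"
  have rep: "rep C \<in> C" if "C \<in> ?X" for C
    using cycles_nonempty[OF that] unfolding rep_def by (simp add: some_in_eq)
  let ?u = "\<lambda>\<phi>. \<lambda>x\<in>A. \<phi> (cyc x)" and ?r = "\<lambda>f. \<lambda>C\<in>?X. f (rep C)"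
  have "bij_betw ?u (PiE (?X) T) ?I"
  proof (rule bij_betw_byWitness[where f' = ?r])
    show "\<forall>\<phi>\<in>PiE (?X) T. ?r (?u \<phi>) = \<phi>"
    proof
      fix \<phi> assume \<phi>: "\<phi> \<in> PiE (?X) T"
      show "?r (?u \<phi>) = \<phi>"
      proof
        fix C
        show "?r (?u \<phi>) C = \<phi> C"
        proof (cases "C \<in> ?X")
          case True
          then show ?thesis using rep[OF True] cyc_eq[OF True] cycles_closed(1)[OF True] by simp
        qed (use \<phi> in \<open>auto simp: PiE_def extensional_def\<close>)
      qed
    qed
    show "\<forall>f\<in>?I. ?u (?r f) = f"
    proof
      fix f assume f: "f \<in> ?I"
      show "?u (?r f) = f"
      proof
        fix x
        show "?u (?r f) x = f x"
        proof (cases "x \<in> A")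
          case True
          then show ?thesis
            using f cycles_connected[OF cyc(1)[OF True] rep[OF cyc(1)[OF True]] cyc(2)[OF True], of f]
              cyc[OF True] by simp
        qed (use f in \<open>auto simp: PiE_def extensional_def\<close>)
      qed
    qed
    show "?u ` PiE (?X) T \<subseteq> ?I"
    proof clarify
      fix \<phi> assume \<phi>: "\<phi> \<in> PiE (?X) T"
      have "\<phi> (cyc x) \<in> S x" if "x \<in> A" for x
        using \<phi> cyc[OF that] T[OF cyc[OF that]] by auto
      moreover have "cyc (d x) = cyc x" "cyc (g x) = cyc x" if "x \<in> A" for x
        using cyc_eq[OF cyc(1)[OF that]] cycles_closed[OF cyc[OF that]] by auto
      ultimately show "(?u \<phi>) \<in> PiE A S \<and>
          (\<forall>x\<in>A. (?u \<phi>) (d x) = (?u \<phi>) x \<and>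
                 (?u \<phi>) (g x) = (?u \<phi>) x)"
        using matching_onD(1)[OF D] matching_onD(1)[OF G] by simp
    qed
    show "?r ` ?I \<subseteq> PiE (?X) T"
    proof clarify
      fix f assume f: "f \<in> PiE A S"
      have "f (rep C) \<in> T C" if C: "C \<in> ?X" for C
        using f T[OF C rep[OF C]] cycles_closed(1)[OF C rep[OF C]] by auto
      then show "?r f \<in> PiE (?X) T" by simp
    qed
  qed
  then have "card ?I = card (PiE (?X) T)" by (simp add: bij_betw_same_card)
  then show ?thesis by (simp add: card_PiE finite_cycles)
qed

lemma card_invariant_colorings: "card (invariant_colorings A d g) = 2 ^ card (cycles \<pi> \<rho>)"
  unfolding invariant_colorings_def
  using card_invariant_functions[of "\<lambda>_. UNIV :: bool set" "\<lambda>_. UNIV"] by simp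

end

section \<open>Sums over functions\<close>

text \<open>The distributive law for sums over functions that live on disjoint blocks of variables.  It is used
  for the index variables of the traces, with the black vertices as blocks, and for the index and
  coordinate variables of the Gaussian entries, with the colors as blocks.\<close>

lemma prod_sum_PiE_blocks:
  fixes F :: "'l \<Rightarrow> ('b \<Rightarrow> 'c) \<Rightarrow> 'd :: comm_semiring_1"
  assumes "finite L" "\<And>l l'. l \<in> L \<Longrightarrow> l' \<in> L \<Longrightarrow> l \<noteq> l' \<Longrightarrow> K l \<inter> K l' = {}"
  shows "(\<Prod>l\<in>L. \<Sum>\<alpha>\<in>PiE (K l) S. F l \<alpha>) = (\<Sum>\<alpha>\<in>PiE (\<Union>l\<in>L. K l) S. \<Prod>l\<in>L. F l (restrict \<alpha> (K l)))"
  using assms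
proof (induction L rule: finite_induct)
  case empty
  then show ?case by simp
next
  case (insert l L)
  let ?K = "\<Union>l\<in>L. K l"
  let ?j = "\<lambda>\<alpha> \<beta>. \<lambda>x\<in>K l \<union> ?K. if x \<in> K l then \<alpha> x else \<beta> x"
  have disj: "K l \<inter> ?K = {}" using insert.prems insert.hyps by auto
  have sub: "K l' \<subseteq> ?K" if "l' \<in> L" for l' using that by auto
  have bij: "bij_betw (\<lambda>\<alpha>. (restrict \<alpha> (K l), restrict \<alpha> ?K)) (PiE (K l \<union> ?K) S) (PiE (K l) S \<times> PiE ?K S)"
  proof (rule bij_betw_byWitness[where f' = "\<lambda>(\<alpha>, \<beta>). ?j \<alpha> \<beta>"])
    show "\<forall>\<alpha>\<in>PiE (K l \<union> ?K) S. (case (restrict \<alpha> (K l), restrict \<alpha> ?K) of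
        (\<alpha>, \<beta>) \<Rightarrow> ?j \<alpha> \<beta>) = \<alpha>"
      by (auto simp: fun_eq_iff PiE_def extensional_def)
    show "\<forall>ab\<in>PiE (K l) S \<times> PiE ?K S.
       (\<lambda>\<alpha>. (restrict \<alpha> (K l), restrict \<alpha> ?K)) (case ab of (\<alpha>, \<beta>) \<Rightarrow>
          ?j \<alpha> \<beta>) = ab"
    proof clarify
      fix \<alpha> \<beta> assume ab: "\<alpha> \<in> PiE (K l) S" "\<beta> \<in> PiE ?K S"
      have "restrict (?j \<alpha> \<beta>) (K l) x = \<alpha> x" for x
        using ab(1) by (auto simp: PiE_def extensional_def)
      moreover have "restrict (?j \<alpha> \<beta>) ?K x = \<beta> x" for x
        using ab(2) disj by (cases "x \<in> ?K") (auto simp: PiE_def extensional_def)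
      ultimately show "restrict (?j \<alpha> \<beta>) (K l) = \<alpha> \<and>
        restrict (?j \<alpha> \<beta>) ?K = \<beta>" by blast
    qed
    show "(\<lambda>\<alpha>. (restrict \<alpha> (K l), restrict \<alpha> ?K)) ` PiE (K l \<union> ?K) S \<subseteq> PiE (K l) S \<times> PiE ?K S"
      unfolding image_subset_iff by (auto simp: PiE_iff)
    show "(\<lambda>(\<alpha>, \<beta>). ?j \<alpha> \<beta>) ` (PiE (K l) S \<times> PiE ?K S)
       \<subseteq> PiE (K l \<union> ?K) S"
      unfolding image_subset_iff by (auto simp: PiE_iff)
  qed
  have rr: "restrict (restrict \<alpha> ?K) (K l') = restrict \<alpha> (K l')" if "l' \<in> L" for l' and \<alpha> :: "'b \<Rightarrow> 'c"
    using sub[OF that] by (auto simp: restrict_def fun_eq_iff)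
  have IH: "(\<Prod>l\<in>L. \<Sum>\<alpha>\<in>PiE (K l) S. F l \<alpha>) = (\<Sum>\<beta>\<in>PiE ?K S. \<Prod>l\<in>L. F l (restrict \<beta> (K l)))"
    by (rule insert.IH) (use insert.prems in blast)
  have "(\<Prod>l\<in>insert l L. \<Sum>\<alpha>\<in>PiE (K l) S. F l \<alpha>) =
      (\<Sum>\<alpha>\<in>PiE (K l) S. F l \<alpha>) * (\<Sum>\<beta>\<in>PiE ?K S. \<Prod>l\<in>L. F l (restrict \<beta> (K l)))"
    by (simp only: prod.insert[OF insert.hyps] IH)
  also have "\<dots> = (\<Sum>(\<alpha>, \<beta>)\<in>PiE (K l) S \<times> PiE ?K S. F l \<alpha> * (\<Prod>l\<in>L. F l (restrict \<beta> (K l))))"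
    by (simp add: sum_product sum.cartesian_product)
  also have "\<dots> = (\<Sum>\<alpha>\<in>PiE (K l \<union> ?K) S. F l (restrict \<alpha> (K l)) * (\<Prod>l\<in>L. F l (restrict (restrict \<alpha> ?K) (K l))))"
    by (subst sum.reindex_bij_betw[OF bij, symmetric]) simp
  also have "\<dots> = (\<Sum>\<alpha>\<in>PiE (K l \<union> ?K) S. \<Prod>l\<in>insert l L. F l (restrict \<alpha> (K l)))"
    using insert.hyps rr by (intro sum.cong refl) simp
  finally show ?case by (simp only: UN_insert)
qed

lemma bij_betw_restrict_transversal:
  assumes d: "matching_on A d" and F: "transversal A d F"
    and S: "\<And>x. x \<in> A \<Longrightarrow> S (d x) = S x"
    and \<tau>: "\<And>x s. x \<in> A \<Longrightarrow> s \<in> S x \<Longrightarrow> \<tau> s \<in> S x" "\<And>s. \<tau> (\<tau> s) = s"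
  shows "bij_betw (\<lambda>f. restrict f F) {f \<in> PiE A S. \<forall>x\<in>A. f (d x) = \<tau> (f x)} (PiE F S)"
proof (rule bij_betw_byWitness[where f' = "\<lambda>f. \<lambda>x\<in>A. if x \<in> F then f x else \<tau> (f (d x))"])
  note D = matching_onD[OF d] and FD = transversalD[OF F]
  let ?e = "\<lambda>f. \<lambda>x\<in>A. if x \<in> F then f x else \<tau> (f (d x))"
  let ?T = "{f \<in> PiE A S. \<forall>x\<in>A. f (d x) = \<tau> (f x)}"
  show "\<forall>f\<in>?T. ?e (restrict f F) = f"
  proof
    fix f assume f: "f \<in> ?T"
    show "?e (restrict f F) = f"
    proof
      fix x show "?e (restrict f F) x = f x"
        using f FD(2)[of x] \<tau>(2) by (cases "x \<in> A") (auto simp: PiE_def extensional_def)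
    qed
  qed
  show "\<forall>f\<in>PiE F S. restrict (?e f) F = f"
  proof
    fix f assume f: "f \<in> PiE F S"
    show "restrict (?e f) F = f"
    proof
      fix x show "restrict (?e f) F x = f x"
        using f FD(1)[of x] by (cases "x \<in> F") (auto simp: PiE_def extensional_def)
    qed
  qed
  show "(\<lambda>f. restrict f F) ` ?T \<subseteq> PiE F S" using FD(1) by auto
  show "?e ` PiE F S \<subseteq> ?T"
  proof clarify
    fix f assume f: "f \<in> PiE F S"
    have "(if x \<in> F then f x else \<tau> (f (d x))) \<in> S x" if "x \<in> A" for x
    proof (cases "x \<in> F")
      case False
      then have "f (d x) \<in> S x" using f FD(2)[OF that] S[OF that] by (auto simp: PiE_iff)
      then show ?thesis using \<tau>(1)[OF that] False by simp
    qed (use f in auto)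
    moreover have "(?e f) (d x) =
        \<tau> ((?e f) x)" if "x \<in> A" for x
      using that D(1,3)[of x] FD(2)[OF that] \<tau>(2) by auto
    ultimately show "(?e f) \<in> PiE A S \<and>
      (\<forall>x\<in>A. (?e f) (d x) =
        \<tau> ((?e f) x))" by simp
  qed
qed

lemma prod_pairs:
  fixes h :: "'b \<Rightarrow> 'c :: comm_monoid_mult"
  assumes "finite A" "matching_on A d" "transversal A d F"
  shows "(\<Prod>x\<in>A. h x) = (\<Prod>x\<in>F. h x * h (d x))"
proof -
  have F: "F \<subseteq> A" using assms(3) by (simp add: transversal_def)
  have "(\<Prod>x\<in>A. h x) = (\<Prod>x\<in>A - F. h x) * (\<Prod>x\<in>F. h x)"
    by (rule prod.subset_diff[OF F assms(1)])
  also have "(\<Prod>x\<in>A - F. h x) = (\<Prod>x\<in>F. h (d x))"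
    by (rule prod.reindex_bij_betw[OF transversal_bij[OF assms(2,3)], symmetric])
  finally show ?thesis by (simp add: prod.distrib mult.commute)
qed

section \<open>Wick's formula\<close>

text \<open>The moments of the standard normal distribution.\<close>

definition normal_moment :: "nat \<Rightarrow> real" where
  "normal_moment k = (if even k then fact k / (2 ^ (k div 2) * fact (k div 2)) else 0)"

lemma normal_moment_0 [simp]: "normal_moment 0 = 1"
  and normal_moment_1 [simp]: "normal_moment (Suc 0) = 0"
  by (simp_all add: normal_moment_def)

text \<open>The recursion mirrors the choice of a partner for one of \<open>k + 2\<close> points.\<close>

lemma normal_moment_rec: "normal_moment (Suc (Suc k)) = (real k + 1) * normal_moment k"
proof (cases "even k")
  case True
  then obtain l where "k = 2 * l" by (elim evenE)
  then show ?thesis by (simp add: normal_moment_def divide_simps)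
qed (simp add: normal_moment_def)

lemma pair_partition_insert_iff:
  assumes "x \<in> A" "y \<in> A" "x \<noteq> y" "{x, y} \<notin> \<gamma>"
  shows "pair_partition A (insert {x, y} \<gamma>) \<longleftrightarrow> pair_partition (A - {x, y}) \<gamma>"
proof -
  have "partition_on A (insert {x, y} \<gamma>) \<longleftrightarrow> partition_on (A - {x, y}) \<gamma>"
  proof
    assume L: "partition_on A (insert {x, y} \<gamma>)"
    have disj: "p \<inter> {x, y} = {}" if p: "p \<in> \<gamma>" for p
    proof -
      have "disjoint (insert {x, y} \<gamma>)" using L by (simp add: partition_on_def)
      moreover have "p \<noteq> {x, y}" using p assms(4) by blast
      ultimately show ?thesis using p disjointD[of "insert {x, y} \<gamma>" p "{x, y}"] by simp
    qed
    have "\<Union>\<gamma> = A - {x, y}"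
    proof -
      have "\<Union>\<gamma> \<union> {x, y} = A" using L by (auto simp: partition_on_def)
      moreover have "\<Union>\<gamma> \<inter> {x, y} = {}" using disj by blast
      ultimately show ?thesis by blast
    qed
    moreover have "disjoint \<gamma>" "{} \<notin> \<gamma>"
      using L by (auto simp: partition_on_def intro: pairwise_subset)
    ultimately show "partition_on (A - {x, y}) \<gamma>" by (simp add: partition_on_def)
  next
    assume R: "partition_on (A - {x, y}) \<gamma>"
    have "{} \<notin> \<gamma>" "disjoint \<gamma>" "\<Union>\<gamma> = A - {x, y}" using R by (auto simp: partition_on_def)
    moreover from this have "p \<inter> {x, y} = {}" if "p \<in> \<gamma>" for p using that by blast
    ultimately show "partition_on A (insert {x, y} \<gamma>)"
      using assms(1,2) by (auto simp: partition_on_def pairwise_insert disjnt_def Int_commute)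
  qed
  then show ?thesis using assms(3) by (auto simp: pair_partition_def)
qed

text \<open>The pairings that contribute to the Gaussian moment of the variables \<open>v x\<close>, \<open>x \<in> A\<close>: they pair equal
  variables only.\<close>

definition pairings :: "'b set \<Rightarrow> ('b \<Rightarrow> 'c) \<Rightarrow> 'b set set set" where
  "pairings A v = {\<gamma>. pair_partition A \<gamma> \<and> (\<forall>p\<in>\<gamma>. \<forall>x\<in>p. \<forall>y\<in>p. v x = v y)}"

lemma finite_pair_partitions: "finite A \<Longrightarrow> finite {\<gamma>. pair_partition A \<gamma>}"
  by (rule finite_subset[of _ "Pow (Pow A)"])
     (auto simp: pair_partition_def partition_on_def)

lemma finite_pairings: "finite A \<Longrightarrow> finite (pairings A v)"
  by (rule finite_subset[OF _ finite_pair_partitions]) (auto simp: pairings_def)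

lemma pairings_eq:
  assumes "\<gamma> \<in> pairings A v" "{x, y} \<in> \<gamma>"
  shows "v x = v y"
proof -
  have "\<forall>p\<in>\<gamma>. \<forall>x\<in>p. \<forall>y\<in>p. v x = v y" using assms(1)
    unfolding pairings_def mem_Collect_eq by (rule conjunct2)
  from bspec[OF this assms(2)] have "\<forall>x'\<in>{x, y}. \<forall>y'\<in>{x, y}. v x' = v y'" .
  then show ?thesis by blast
qed

lemma pairings_split:
  assumes x: "x \<in> A"
  shows "pairings A v =
    (\<Union>y\<in>{y \<in> A - {x}. v y = v x}. insert {x, y} ` pairings (A - {x, y}) v)"
proof (intro equalityI subsetI)
  fix \<gamma> assume \<gamma>: "\<gamma> \<in> pairings A v"
  then have pp: "pair_partition A \<gamma>" by (simp add: pairings_def)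
  define y where "y = partner \<gamma> x"
  have xy: "{x, y} \<in> \<gamma>" using partner_mem[OF pp x] by (simp add: y_def)
  have y: "y \<in> A" "x \<noteq> y" using pair_partition_pair[OF pp xy] by auto
  have "v y = v x" using pairings_eq[OF \<gamma> xy] by simp
  have eq: "insert {x, y} (\<gamma> - {{x, y}}) = \<gamma>" using xy by blast
  have "pair_partition (A - {x, y}) (\<gamma> - {{x, y}})"
    using pair_partition_insert_iff[OF x y(1,2), of "\<gamma> - {{x, y}}"] pp eq by simp
  then have "\<gamma> - {{x, y}} \<in> pairings (A - {x, y}) v"
    using \<gamma> unfolding pairings_def mem_Collect_eq by (meson DiffD1)
  then have "\<gamma> \<in> insert {x, y} ` pairings (A - {x, y}) v"
    using eq by (metis imageI)
  then show "\<gamma> \<in> (\<Union>y\<in>{y \<in> A - {x}. v y = v x}. insert {x, y} ` pairings (A - {x, y}) v)"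
    using y \<open>v y = v x\<close> by blast
next
  fix \<gamma> assume "\<gamma> \<in> (\<Union>y\<in>{y \<in> A - {x}. v y = v x}. insert {x, y} ` pairings (A - {x, y}) v)"
  then obtain y \<gamma>' where y: "y \<in> A" "x \<noteq> y" "v y = v x" and \<gamma>: "\<gamma> = insert {x, y} \<gamma>'"
    and \<gamma>': "pair_partition (A - {x, y}) \<gamma>'" "\<forall>p\<in>\<gamma>'. \<forall>x\<in>p. \<forall>y\<in>p. v x = v y"
    by (auto simp: pairings_def)
  have "{x, y} \<notin> \<gamma>'" using pair_partition_pair[OF \<gamma>'(1), of x y] by blast
  then have "pair_partition A \<gamma>" using pair_partition_insert_iff[OF x y(1,2)] \<gamma>'(1) \<gamma> by blast
  then show "\<gamma> \<in> pairings A v" using \<gamma>'(2) \<gamma> y(3)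
    unfolding pairings_def mem_Collect_eq ball_simps(7) by (metis insertE singletonD)
qed

text \<open>Wick's formula for a monomial in independent standard normal variables: the right-hand side is the
  expectation of \<open>\<Prod>x\<in>A. \<xi> (v x)\<close>.  Fixing \<open>x\<close>, there is one choice of the partner for each other point
  with the same variable, and removing the pair lowers the exponent of that variable by two; both
  sides satisfy the recursion \<open>normal_moment_rec\<close>.\<close>

lemma card_pairings:
  assumes "finite A" "finite V" "v ` A \<subseteq> V"
  shows "real (card (pairings A v)) = (\<Prod>u\<in>V. normal_moment (card {x \<in> A. v x = u}))"
  using assms
proof (induction "card A" arbitrary: A rule: less_induct)
  case less
  show ?case
  proof (cases "A = {}")
    case True
    have "pairings {} v = {{}}"
      by (auto simp: pairings_def pair_partition_def partition_on_def)
    then show ?thesis using True by simp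
  next
    case False
    then obtain x where x: "x \<in> A" by blast
    define B where "B = {y \<in> A - {x}. v y = v x}"
    have fB: "finite B" using less.prems by (simp add: B_def)
    have xV: "v x \<in> V" using x less.prems by blast
    define R where "R = (\<Prod>u\<in>V - {v x}. normal_moment (card {z \<in> A. v z = u}))"
    have fib: "{z \<in> A. v z = v x} = insert x B" using x by (auto simp: B_def)
    then have cf: "card {z \<in> A. v z = v x} = Suc (card B)" using fB by (simp add: B_def)
    have sub: "real (card (pairings (A - {x, y}) v)) = normal_moment (card B - 1) * R"
      if y: "y \<in> B" for y
    proof -
      have "card (A - {x, y}) < card A"
        using x less.prems by (intro psubset_card_mono) auto
      then have "real (card (pairings (A - {x, y}) v)) =
          (\<Prod>u\<in>V. normal_moment (card {z \<in> A - {x, y}. v z = u}))"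
        using less.prems by (intro less.hyps) auto
      also have "\<dots> = normal_moment (card {z \<in> A - {x, y}. v z = v x}) *
          (\<Prod>u\<in>V - {v x}. normal_moment (card {z \<in> A - {x, y}. v z = u}))"
        by (rule prod.remove[OF less.prems(2) xV])
      also have "{z \<in> A - {x, y}. v z = v x} = B - {y}" by (auto simp: B_def)
      also have "(\<Prod>u\<in>V - {v x}. normal_moment (card {z \<in> A - {x, y}. v z = u})) = R"
        unfolding R_def using y
        by (intro prod.cong refl arg_cong[of _ _ normal_moment] arg_cong[of _ _ card]) (auto simp: B_def)
      finally show ?thesis using y fB by (simp add: card_Diff_singleton)
    qed
    have inj: "inj_on (insert {x, y}) (pairings (A - {x, y}) v)" for y
    proof (rule inj_onI)
      fix \<gamma> \<gamma>' assume \<gamma>: "\<gamma> \<in> pairings (A - {x, y}) v"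
        "\<gamma>' \<in> pairings (A - {x, y}) v" "insert {x, y} \<gamma> = insert {x, y} \<gamma>'"
      then have "{x, y} \<notin> \<gamma>" "{x, y} \<notin> \<gamma>'"
        using pair_partition_pair[of "A - {x, y}" _ x y] by (auto simp: pairings_def)
      then show "\<gamma> = \<gamma>'" using \<gamma>(3) by (simp add: insert_ident)
    qed
    have "card (pairings A v) = card (\<Union>y\<in>B. insert {x, y} ` pairings (A - {x, y}) v)"
      using pairings_split[OF x, of v] by (simp add: B_def)
    also have "\<dots> = (\<Sum>y\<in>B. card (insert {x, y} ` pairings (A - {x, y}) v))"
    proof (rule card_UN_disjoint[OF fB])
      show "\<forall>y\<in>B. finite (insert {x, y} ` pairings (A - {x, y}) v)"
        using less.prems by (simp add: finite_pairings)
      show "\<forall>i\<in>B. \<forall>k\<in>B. i \<noteq> k \<longrightarrow> insert {x, i} ` pairings (A - {x, i}) v \<inter>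
          insert {x, k} ` pairings (A - {x, k}) v = {}"
      proof (intro ballI impI equals0I)
        fix i k \<gamma> assume ik: "i \<in> B" "k \<in> B" "i \<noteq> k"
          and \<gamma>: "\<gamma> \<in> insert {x, i} ` pairings (A - {x, i}) v \<inter>
            insert {x, k} ` pairings (A - {x, k}) v"
        have "\<gamma> \<in> pairings A v"
          unfolding pairings_split[OF x] B_def[symmetric] using \<gamma> ik(1) by blast
        then have "pair_partition A \<gamma>" by (simp add: pairings_def)
        moreover have "{x, i} \<in> \<gamma>" "{x, k} \<in> \<gamma>"
          using \<gamma> by (simp_all only: Int_iff image_iff) (elim conjE bexE; simp)+
        ultimately show False using pair_partition_unique ik(3) by metis
      qed
    qed
    also have "\<dots> = (\<Sum>y\<in>B. card (pairings (A - {x, y}) v))"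
      using inj by (simp add: card_image)
    finally have "real (card (pairings A v)) = real (card B) * (normal_moment (card B - 1) * R)"
      using sub by simp
    also have "real (card B) * normal_moment (card B - 1) = normal_moment (Suc (card B))"
      by (cases "card B") (simp_all add: normal_moment_rec)
    then have "real (card B) * (normal_moment (card B - 1) * R) = normal_moment (Suc (card B)) * R"
      by simp
    also have "\<dots> = (\<Prod>u\<in>V. normal_moment (card {z \<in> A. v z = u}))"
      using prod.remove[OF less.prems(2) xV, of "\<lambda>u. normal_moment (card {z \<in> A. v z = u})"] cf
      by (simp add: R_def)
    finally show ?thesis .
  qed
qed

lemma sum_over_compatible_functions:
  fixes c :: "'b \<Rightarrow> 'e \<Rightarrow> 'f :: comm_semiring_1"
  assumes "finite A" "finite U" "pair_partition A \<gamma>" "transversal A (partner \<gamma>) F"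
  shows "(\<Sum>u\<in>A \<rightarrow>\<^sub>E U. if \<forall>p\<in>\<gamma>. \<forall>x\<in>p. \<forall>y\<in>p. u x = u y then \<Prod>x\<in>A. c x (u x) else 0) =
    (\<Prod>x\<in>F. \<Sum>e\<in>U. c x e * c (partner \<gamma> x) e)"
proof -
  let ?g = "partner \<gamma>"
  note g = matching_on_partner[OF assms(3)]
  let ?T = "{u \<in> PiE A (\<lambda>_. U). \<forall>x\<in>A. u (?g x) = (\<lambda>e. e) (u x)}"
  have iff: "(\<forall>p\<in>\<gamma>. \<forall>x\<in>p. \<forall>y\<in>p. u x = u y) \<longleftrightarrow> (\<forall>x\<in>A. u (?g x) = u x)" for u :: "'b \<Rightarrow> 'e"
    by (subst pair_partition_eq_partner[OF assms(3)]) auto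
  have bij: "bij_betw (\<lambda>f. restrict f F) ?T (PiE F (\<lambda>_. U))"
    by (rule bij_betw_restrict_transversal[OF g assms(4)]) auto
  have FA: "F \<subseteq> A" using assms(4) by (simp add: transversal_def)
  have "(\<Sum>u\<in>A \<rightarrow>\<^sub>E U. if \<forall>p\<in>\<gamma>. \<forall>x\<in>p. \<forall>y\<in>p. u x = u y then \<Prod>x\<in>A. c x (u x) else 0) =
      (\<Sum>u\<in>?T. \<Prod>x\<in>A. c x (u x))"
    unfolding iff using assms(1,2) by (intro sum.mono_neutral_cong_right) (auto simp: finite_PiE)
  also have "\<dots> = (\<Sum>u\<in>?T. \<Prod>x\<in>F. c x (restrict u F x) * c (?g x) (restrict u F x))"
  proof (intro sum.cong refl)
    fix u assume u: "u \<in> ?T"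
    show "(\<Prod>x\<in>A. c x (u x)) = (\<Prod>x\<in>F. c x (restrict u F x) * c (?g x) (restrict u F x))"
      unfolding prod_pairs[OF assms(1) g assms(4)] using u FA by (intro prod.cong refl) auto
  qed
  also have "\<dots> = (\<Sum>u\<in>PiE F (\<lambda>_. U). \<Prod>x\<in>F. c x (u x) * c (?g x) (u x))"
    by (rule sum.reindex_bij_betw[OF bij, of "\<lambda>u. \<Prod>x\<in>F. c x (u x) * c (?g x) (u x)"])
  also have "\<dots> = (\<Prod>x\<in>F. \<Sum>e\<in>U. c x e * c (?g x) e)"
    using assms(1,2) FA finite_subset by (intro prod_sum_PiE[symmetric]) blast+
  finally show ?thesis .
qed


text \<open>Wick's formula for the variables \<open>\<Sum>e\<in>U. c x e * \<xi> (key x, e)\<close>, where the \<open>\<xi>\<close> are independent standard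
  normal: expanding the product leads to the left-hand side, and the inner sum on the right is the
  covariance of the variables at \<open>x\<close> and at its partner when their keys agree.\<close>

lemma wick:
  fixes c :: "'b \<Rightarrow> 'e \<Rightarrow> 'f :: comm_semiring_1" and key :: "'b \<Rightarrow> 'k"
  assumes "finite A" "finite U"
    and F: "\<And>\<gamma>. pair_partition A \<gamma> \<Longrightarrow> transversal A (partner \<gamma>) (F \<gamma>)"
  shows "(\<Sum>u\<in>A \<rightarrow>\<^sub>E U. (\<Prod>x\<in>A. c x (u x)) * of_nat (card (pairings A (\<lambda>x. (key x, u x))))) =
    (\<Sum>\<gamma>\<in>pairings A key. \<Prod>x\<in>F \<gamma>. \<Sum>e\<in>U. c x e * c (partner \<gamma> x) e)"
proof -
  let ?K = "pairings A key"
  have "(\<Prod>x\<in>A. c x (u x)) * of_nat (card (pairings A (\<lambda>x. (key x, u x)))) =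
      (\<Sum>\<gamma>\<in>?K. if \<forall>p\<in>\<gamma>. \<forall>x\<in>p. \<forall>y\<in>p. u x = u y then \<Prod>x\<in>A. c x (u x) else 0)" for u
  proof -
    have "pairings A (\<lambda>x. (key x, u x)) = {\<gamma> \<in> ?K. \<forall>p\<in>\<gamma>. \<forall>x\<in>p. \<forall>y\<in>p. u x = u y}"
      by (simp add: pairings_def set_eq_iff ball_conj_distrib conj_assoc)
    then show ?thesis
      using finite_pairings[OF assms(1), of key]
      by (simp add: sum.If_cases Int_def conj_commute mult.commute)
  qed
  then have "(\<Sum>u\<in>A \<rightarrow>\<^sub>E U. (\<Prod>x\<in>A. c x (u x)) * of_nat (card (pairings A (\<lambda>x. (key x, u x))))) =
    (\<Sum>u\<in>A \<rightarrow>\<^sub>E U. \<Sum>\<gamma>\<in>?K. if \<forall>p\<in>\<gamma>. \<forall>x\<in>p. \<forall>y\<in>p. u x = u y then \<Prod>x\<in>A. c x (u x) else 0)"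
    by (rule sum.cong[OF refl])
  also have "\<dots> = (\<Sum>\<gamma>\<in>?K. \<Sum>u\<in>A \<rightarrow>\<^sub>E U. if \<forall>p\<in>\<gamma>. \<forall>x\<in>p. \<forall>y\<in>p. u x = u y then \<Prod>x\<in>A. c x (u x) else 0)"
    by (rule sum.swap)
  also have "\<dots> = (\<Sum>\<gamma>\<in>?K. \<Prod>x\<in>F \<gamma>. \<Sum>e\<in>U. c x e * c (partner \<gamma> x) e)"
    using assms(1,2) F
    by (intro sum.cong refl sum_over_compatible_functions) (auto simp: pairings_def)
  finally show ?thesis .
qed

text \<open>Variables with different keys are independent, so the moment is a product over the keys.\<close>

lemma card_pairings_split:
  assumes "finite A" "finite L" "key ` A \<subseteq> L"
  shows "card (pairings A (\<lambda>x. (key x, v x))) =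
    (\<Prod>l\<in>L. card (pairings {x \<in> A. key x = l} v))"
proof -
  have "real (card (pairings A (\<lambda>x. (key x, v x)))) =
      (\<Prod>w\<in>L \<times> v ` A. normal_moment (card {x \<in> A. (key x, v x) = w}))"
    using assms by (intro card_pairings) auto
  also have "\<dots> = (\<Prod>l\<in>L. \<Prod>u\<in>v ` A. normal_moment (card {x \<in> {x \<in> A. key x = l}. v x = u}))"
    by (simp add: prod.cartesian_product case_prod_unfold conj_assoc prod_eq_iff)
  also have "\<dots> = (\<Prod>l\<in>L. real (card (pairings {x \<in> A. key x = l} v)))"
    using assms by (intro prod.cong refl card_pairings[symmetric]) auto
  finally show ?thesis by (simp flip: of_nat_prod)
qed

section \<open>Spin sums\<close>

definition spin_sign :: "bool \<Rightarrow> complex" where "spin_sign i = (if i then - 1 else 1)"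

text \<open>An index of the complex matrix representing a quaternionic matrix is a pair of a quaternionic index
  and a spin.  On these indices \<open>spin_form\<close> is the standard symplectic form: the identity on the first
  component times the antisymmetric form on the spins.\<close>

definition flip :: "'c \<times> bool \<Rightarrow> 'c \<times> bool" where "flip a = (fst a, \<not> snd a)"

definition spin_form :: "'c \<times> bool \<Rightarrow> 'c \<times> bool \<Rightarrow> complex" where
  "spin_form a b = (if b = flip a then spin_sign (snd a) else 0)"

lemma flip_flip [simp]: "flip (flip a) = a" and fst_flip [simp]: "fst (flip a) = fst a"
  and snd_flip [simp]: "snd (flip a) = (\<not> snd a)"
  by (simp_all add: flip_def)

lemma spin_sign_Not [simp]: "spin_sign (\<not> i) = - spin_sign i"
  and spin_sign_mult_self [simp]: "spin_sign i * spin_sign i = 1"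
  by (simp_all add: spin_sign_def)

text \<open>The sign changes along each pair, so every pair that \<open>F\<close> and \<open>P\<close> orient differently costs a factor
  \<open>-1\<close>.\<close>

lemma prod_sign_transversal:
  assumes d: "matching_on A d" and F: "transversal A d F" and P: "transversal A d P" and fin: "finite A"
    and f: "\<And>x. x \<in> A \<Longrightarrow> f (d x) = flip (f x)"
  shows "(\<Prod>x\<in>P. spin_sign (snd (f x))) = (- 1) ^ card (P - F) * (\<Prod>x\<in>F. spin_sign (snd (f x)))"
proof -
  note D = matching_onD[OF d] and FD = transversalD[OF F] and PD = transversalD[OF P]
  let ?h = "\<lambda>x. spin_sign (snd (f x))"
  have fP: "finite P" and fF: "finite F" using fin FD(1) PD(1) by (meson finite_subset subsetI)+
  have bij: "bij_betw d (P - F) (F - P)"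
    by (rule bij_betw_byWitness[where f' = d]) (use D FD PD in auto)
  have "(\<Prod>x\<in>F - P. ?h x) = (\<Prod>x\<in>P - F. ?h (d x))"
    by (rule prod.reindex_bij_betw[OF bij, symmetric])
  also have "\<dots> = (\<Prod>x\<in>P - F. - 1 * ?h x)" using f PD(1) by (intro prod.cong) auto
  also have "\<dots> = (- 1) ^ card (P - F) * (\<Prod>x\<in>P - F. ?h x)" unfolding prod.distrib by simp
  finally have 1: "(\<Prod>x\<in>F - P. ?h x) = (- 1) ^ card (P - F) * (\<Prod>x\<in>P - F. ?h x)" .
  have 2: "(\<Prod>x\<in>P. ?h x) = (\<Prod>x\<in>P \<inter> F. ?h x) * (\<Prod>x\<in>P - F. ?h x)"
    by (rule prod.Int_Diff[OF fP])
  have 3: "(\<Prod>x\<in>F. ?h x) = (\<Prod>x\<in>P \<inter> F. ?h x) * (\<Prod>x\<in>F - P. ?h x)"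
    using prod.Int_Diff[OF fF, of ?h P] by (simp add: Int_commute)
  show ?thesis unfolding 2 3 1 by (simp flip: mult.assoc power_add)
qed

text \<open>The evaluation of an index loop.  A term is nonzero only if \<open>f\<close> is flipped along both matchings;
  then all spins are determined by one spin on each cycle, and flipping \<open>f\<close> off the common transversal
  \<open>F\<close> makes it constant on the cycles.  This leaves \<open>2 * card (T C)\<close> choices for each cycle.  The
  antisymmetry of the form contributes the sign, which depends on the orientations \<open>P\<close> and \<open>Q\<close> of the
  two matchings only.\<close>

lemma spin_sum:
  assumes fin: "finite A" and pp: "pair_partition A \<pi>" "pair_partition A \<rho>"
    and F: "transversal A (partner \<pi>) F" "transversal A (partner \<rho>) F"
    and P: "transversal A (partner \<pi>) P" and Q: "transversal A (partner \<rho>) Q"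
    and R: "\<And>x. x \<in> A \<Longrightarrow> finite (R x)"
    and T: "\<And>C x. C \<in> cycles \<pi> \<rho> \<Longrightarrow> x \<in> C \<Longrightarrow> R x = T C"
  shows "(\<Sum>f\<in>{f \<in> PiE A (\<lambda>x. R x \<times> UNIV). \<forall>x\<in>A. f (partner \<pi> x) = flip (f x)}.
      (\<Prod>x\<in>P. spin_sign (snd (f x))) * (\<Prod>x\<in>Q. spin_form (f x) (f (partner \<rho> x)))) =
    (- 1) ^ (card (P - F) + card (Q - F)) * (\<Prod>C\<in>cycles \<pi> \<rho>. of_nat (2 * card (T C)))"
proof -
  let ?d = "partner \<pi>" and ?g = "partner \<rho>"
  note d = matching_on_partner[OF pp(1)] and g = matching_on_partner[OF pp(2)]
  note D = matching_onD[OF d] and G = matching_onD[OF g]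
  let ?S = "\<lambda>x. R x \<times> (UNIV :: bool set)"
  let ?E = "{f \<in> PiE A ?S. \<forall>x\<in>A. f (?d x) = flip (f x)}"
  let ?E2 = "{f \<in> PiE A ?S. \<forall>x\<in>A. f (?d x) = flip (f x) \<and> f (?g x) = flip (f x)}"
  let ?I = "{f \<in> PiE A ?S. \<forall>x\<in>A. f (?d x) = f x \<and> f (?g x) = f x}"
  have QA: "Q \<subseteq> A" and FA: "F \<subseteq> A" using Q F by (auto simp: transversal_def)
  have finE: "finite (PiE A ?S)" using fin R by (intro finite_PiE) auto
  have "(\<Sum>f\<in>?E. (\<Prod>x\<in>P. spin_sign (snd (f x))) * (\<Prod>x\<in>Q. spin_form (f x) (f (?g x)))) =
      (\<Sum>f\<in>?E2. (- 1) ^ (card (P - F) + card (Q - F)))"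
  proof (rule sum.mono_neutral_cong_right)
    show "finite ?E" using finE by simp
    show "?E2 \<subseteq> ?E" by blast
    show "\<forall>f\<in>?E - ?E2. (\<Prod>x\<in>P. spin_sign (snd (f x))) * (\<Prod>x\<in>Q. spin_form (f x) (f (?g x))) = 0"
    proof
      fix f assume f: "f \<in> ?E - ?E2"
      then obtain x where x: "x \<in> A" "f (?g x) \<noteq> flip (f x)" by blast
      have "\<exists>x\<in>Q. f (?g x) \<noteq> flip (f x)"
      proof (cases "x \<in> Q")
        case False
        then have "?g x \<in> Q" using transversalD(2)[OF Q x(1)] by simp
        moreover have "f (?g (?g x)) \<noteq> flip (f (?g x))" using x(2) G(3) flip_flip by metis
        ultimately show ?thesis by blast
      qed (use x in blast)
      moreover have "finite Q" using QA fin finite_subset by blast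
      ultimately have "(\<Prod>x\<in>Q. spin_form (f x) (f (?g x))) = 0" by (auto simp: spin_form_def)
      then show "(\<Prod>x\<in>P. spin_sign (snd (f x))) * (\<Prod>x\<in>Q. spin_form (f x) (f (?g x))) = 0" by simp
    qed
    fix f assume f: "f \<in> ?E2"
    have "(\<Prod>x\<in>Q. spin_form (f x) (f (?g x))) = (\<Prod>x\<in>Q. spin_sign (snd (f x)))"
      using f QA by (intro prod.cong) (auto simp: spin_form_def)
    also have "\<dots> = (- 1) ^ card (Q - F) * (\<Prod>x\<in>F. spin_sign (snd (f x)))"
      using f by (intro prod_sign_transversal[OF g F(2) Q fin]) auto
    finally have q: "(\<Prod>x\<in>Q. spin_form (f x) (f (?g x))) = \<dots>" .
    have p: "(\<Prod>x\<in>P. spin_sign (snd (f x))) = (- 1) ^ card (P - F) * (\<Prod>x\<in>F. spin_sign (snd (f x)))"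
      using f by (intro prod_sign_transversal[OF d F(1) P fin]) auto
    \<comment> \<open>Both sign products reduce to the one over \<open>F\<close>, so the dependence on \<open>f\<close> cancels.\<close>
    have "(\<Prod>x\<in>F. spin_sign (snd (f x))) * (\<Prod>x\<in>F. spin_sign (snd (f x))) = 1"
      unfolding prod.distrib[symmetric] by simp
    then show "(\<Prod>x\<in>P. spin_sign (snd (f x))) * (\<Prod>x\<in>Q. spin_form (f x) (f (?g x))) =
        (- 1) ^ (card (P - F) + card (Q - F))"
      unfolding p q by (simp add: power_add mult_ac)
  qed
  also have "\<dots> = (- 1) ^ (card (P - F) + card (Q - F)) * of_nat (card ?E2)" by simp
  also have "card ?E2 = card ?I"
  proof (rule bij_betw_same_card)
    let ?t = "\<lambda>f. \<lambda>x\<in>A. if x \<in> F then f x else flip (f x)"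
    have tt: "?t (?t f) = f" if "f \<in> PiE A ?S" for f
      using that by (auto simp: fun_eq_iff PiE_def extensional_def)
    have S: "flip s \<in> ?S x \<longleftrightarrow> s \<in> ?S x" for s x by (auto simp: mem_Times_iff)
    have tS: "?t f \<in> PiE A ?S" if "f \<in> PiE A ?S" for f
      using that S by (auto simp: PiE_iff)
    have FD: "?d x \<in> F \<longleftrightarrow> x \<notin> F" "?g x \<in> F \<longleftrightarrow> x \<notin> F" if "x \<in> A" for x
      using transversalD(2)[OF F(1) that] transversalD(2)[OF F(2) that] by auto
    show "bij_betw ?t ?E2 ?I"
    proof (rule bij_betw_byWitness[where f' = ?t])
      show "\<forall>f\<in>?E2. ?t (?t f) = f" "\<forall>f\<in>?I. ?t (?t f) = f" using tt by blast+
      show "?t ` ?E2 \<subseteq> ?I"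
      proof clarify
        fix f assume f: "f \<in> PiE A ?S" "\<forall>x\<in>A. f (?d x) = flip (f x) \<and> f (?g x) = flip (f x)"
        then show "?t f \<in> PiE A ?S \<and> (\<forall>x\<in>A. ?t f (?d x) = ?t f x \<and> ?t f (?g x) = ?t f x)"
          using tS[OF f(1)] FD D(1) G(1) by simp
      qed
      show "?t ` ?I \<subseteq> ?E2"
      proof clarify
        fix f assume f: "f \<in> PiE A ?S" "\<forall>x\<in>A. f (?d x) = f x \<and> f (?g x) = f x"
        then show "?t f \<in> PiE A ?S \<and> (\<forall>x\<in>A. ?t f (?d x) = flip (?t f x) \<and> ?t f (?g x) = flip (?t f x))"
          using tS[OF f(1)] FD D(1) G(1) by simp
      qed
    qed
  qed
  also have "card ?I = (\<Prod>C\<in>cycles \<pi> \<rho>. card (T C \<times> (UNIV :: bool set)))"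
    by (rule card_invariant_functions[OF fin pp refl refl]) (simp add: T)
  finally show ?thesis by (simp add: card_cartesian_product mult.commute)
qed

section \<open>Gaussian moments\<close>

definition qcoord :: "quat \<Rightarrow> nat \<Rightarrow> real" where
  "qcoord q c = (if c = 0 then qRe q else if c = 1 then qI q else if c = 2 then qJ q else qK q)"

lemma borel_measurable_qcoord [measurable]: "(\<lambda>q. qcoord q c) \<in> borel_measurable borel"
proof -
  have "(\<lambda>q. qcoord q c) = (\<lambda>q. q \<bullet> (if c = 0 then Quat 1 0 0 0 else if c = 1 then Quat 0 1 0 0
      else if c = 2 then Quat 0 0 1 0 else Quat 0 0 0 1))"
    by (auto simp: qcoord_def inner_quat_def)
  then show ?thesis by simp
qed

context prob_space
begin

lemma std_normal_power:
  assumes "distributed M lborel X std_normal_density"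
  shows "has_bochner_integral M (\<lambda>\<omega>. X \<omega> ^ k) (normal_moment k)"
proof -
  have "integrable lborel (\<lambda>x. std_normal_density x * x ^ k)"
    by (rule integrable_std_normal_moment)
  moreover have "integral\<^sup>L lborel (\<lambda>x. std_normal_density x * x ^ k) = normal_moment k"
  proof (cases "even k")
    case True
    then obtain l where "k = 2 * l" by (elim evenE)
    then show ?thesis using integral_std_normal_moment_even[of l] by (simp add: normal_moment_def)
  next
    case False
    then obtain l where "k = 2 * l + 1" by (elim oddE)
    then show ?thesis using integral_std_normal_moment_odd[of l] by (simp add: normal_moment_def)
  qed
  ultimately show ?thesis
    using distributed_integrable[OF assms, of "\<lambda>x. x ^ k"] distributed_integral[OF assms, of "\<lambda>x. x ^ k"]
    by (simp add: has_bochner_integral_iff)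
qed

lemma std_quat_gaussian_moments:
  assumes "std_quat_gaussian M Z"
  shows "has_bochner_integral M (\<lambda>\<omega>. \<Prod>c\<in>{0..3}. qcoord (Z \<omega>) c ^ e c) (\<Prod>c\<in>{0..3}. normal_moment (e c))"
proof -
  obtain \<xi> :: "nat \<Rightarrow> 'a \<Rightarrow> real" where ind: "indep_vars (\<lambda>_. borel) \<xi> {0..3}"
    and \<xi>: "\<And>i. i \<in> {0..3} \<Longrightarrow> distributed M lborel (\<xi> i) std_normal_density"
    and Z: "\<And>\<omega>. \<omega> \<in> space M \<Longrightarrow> Z \<omega> = Quat (\<xi> 0 \<omega>) (\<xi> 1 \<omega>) (\<xi> 2 \<omega>) (\<xi> 3 \<omega>)"
    using assms unfolding std_quat_gaussian_def by blast
  note int = std_normal_power[OF \<xi>, unfolded has_bochner_integral_iff]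
  have ind': "indep_vars (\<lambda>_. borel) (\<lambda>c \<omega>. \<xi> c \<omega> ^ e c) {0..3}"
    by (rule indep_vars_compose2[OF ind]) simp
  have "has_bochner_integral M (\<lambda>\<omega>. \<Prod>c\<in>{0..3}. \<xi> c \<omega> ^ e c) (\<Prod>c\<in>{0..3}. normal_moment (e c))"
    using indep_vars_integrable[OF _ ind'] indep_vars_lebesgue_integral[OF _ ind'] int
    by (simp add: has_bochner_integral_iff)
  moreover have "(\<Prod>c\<in>{0..3}. \<xi> c \<omega> ^ e c) = (\<Prod>c\<in>{0..3}. qcoord (Z \<omega>) c ^ e c)" if "\<omega> \<in> space M" for \<omega>
  proof (intro prod.cong refl)
    fix c :: nat assume "c \<in> {0..3}"
    then consider "c = 0" | "c = 1" | "c = 2" | "c = 3" by fastforce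
    then show "\<xi> c \<omega> ^ e c = qcoord (Z \<omega>) c ^ e c" by cases (simp_all add: Z[OF that] qcoord_def)
  qed
  ultimately show ?thesis by (simp cong: has_bochner_integral_cong)
qed

text \<open>The product is grouped first by entries of the matrix and then by coordinates; independence of the
  entries, and of the coordinates of one entry, factors the expectation into normal moments.\<close>

lemma quat_gaussian_matrix_moments:
  assumes X: "quat_gaussian_matrix M m n X" and B: "finite B"
    and entry: "\<And>x. x \<in> B \<Longrightarrow> entry x \<in> {..<m} \<times> {..<n}" and co: "\<And>x. x \<in> B \<Longrightarrow> co x \<in> {0..3}"
  shows "has_bochner_integral M (\<lambda>\<omega>. \<Prod>x\<in>B. qcoord (X \<omega> $$ entry x) (co x))
     (real (card (pairings B (\<lambda>x. (entry x, co x)))))"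
proof -
  let ?I = "{..<m} \<times> {..<n}"
  define e where "e ab c = card {x \<in> B. (entry x, co x) = (ab, c)}" for ab c
  define Z where "Z ab \<omega> = (\<Prod>c\<in>{0..3}. qcoord (X \<omega> $$ ab) c ^ e ab c)" for ab \<omega>
  have "indep_vars (\<lambda>_. borel) (\<lambda>ab \<omega>. X \<omega> $$ ab) ?I"
    using X by (simp add: quat_gaussian_matrix_def)
  then have ind: "indep_vars (\<lambda>_. borel) Z ?I"
    unfolding Z_def by (rule indep_vars_compose2) measurable
  have Z: "has_bochner_integral M (Z ab) (\<Prod>c\<in>{0..3}. normal_moment (e ab c))" if "ab \<in> ?I" for ab
  proof -
    have "std_quat_gaussian M (\<lambda>\<omega>. X \<omega> $$ ab)"
      using X that by (auto simp: quat_gaussian_matrix_def)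
    from std_quat_gaussian_moments[OF this] show ?thesis by (simp add: Z_def[abs_def])
  qed
  have "has_bochner_integral M (\<lambda>\<omega>. \<Prod>ab\<in>?I. Z ab \<omega>) (\<Prod>ab\<in>?I. \<Prod>c\<in>{0..3}. normal_moment (e ab c))"
    using indep_vars_integrable[OF _ ind] indep_vars_lebesgue_integral[OF _ ind] Z
    by (simp add: has_bochner_integral_iff del: mem_Sigma_iff)
  moreover have "(\<Prod>ab\<in>?I. \<Prod>c\<in>{0..3}. normal_moment (e ab c)) =
      real (card (pairings B (\<lambda>x. (entry x, co x))))"
    using B entry co
    by (subst card_pairings[where V = "?I \<times> {0..3}"])
       (auto simp: prod.cartesian_product case_prod_unfold e_def image_subset_iff prod_eq_iff)
  moreover have "(\<Prod>ab\<in>?I. Z ab \<omega>) = (\<Prod>x\<in>B. qcoord (X \<omega> $$ entry x) (co x))" for \<omega>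
  proof -
    have "Z ab \<omega> = (\<Prod>x\<in>{x \<in> B. entry x = ab}. qcoord (X \<omega> $$ entry x) (co x))" for ab
    proof -
      have "(\<Prod>x\<in>{x \<in> B. entry x = ab}. qcoord (X \<omega> $$ entry x) (co x)) =
          (\<Prod>c\<in>{0..3}. \<Prod>x\<in>{x \<in> {x \<in> B. entry x = ab}. co x = c}. qcoord (X \<omega> $$ entry x) (co x))"
        using B co by (intro prod.group[symmetric]) auto
      also have "\<dots> = (\<Prod>c\<in>{0..3}. \<Prod>x\<in>{x \<in> {x \<in> B. entry x = ab}. co x = c}. qcoord (X \<omega> $$ ab) c)"
        by (intro prod.cong) auto
      finally show ?thesis by (simp add: Z_def e_def)
    qed
    then have "(\<Prod>ab\<in>?I. Z ab \<omega>) =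
        (\<Prod>ab\<in>?I. \<Prod>x\<in>{x \<in> B. entry x = ab}. qcoord (X \<omega> $$ entry x) (co x))"
      by (simp only:)
    also have "\<dots> = (\<Prod>x\<in>B. qcoord (X \<omega> $$ entry x) (co x))"
      using entry by (intro prod.group B finite_cartesian_product finite_lessThan) blast
    finally show ?thesis .
  qed
  ultimately show ?thesis by simp
qed

end

section \<open>The spin representation\<close>

text \<open>The entries of the matrices of \<open>1, i, j, k\<close> in the representation of the quaternions by complex
  \<open>2 \<times> 2\<close> matrices; \<open>False\<close> is the first index and \<open>True\<close> the second.\<close>

definition qunit :: "nat \<Rightarrow> bool \<Rightarrow> bool \<Rightarrow> complex" where
  "qunit c i k = (if c = 0 then (if i = k then 1 else 0)
     else if c = 1 then (if i = k then (if i then - \<i> else \<i>) else 0)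
     else if c = 2 then (if i = k then 0 else if i then - 1 else 1)
     else (if i = k then 0 else \<i>))"

definition qspin :: "quat \<Rightarrow> bool \<Rightarrow> bool \<Rightarrow> complex" where
  "qspin q i k = (\<Sum>c\<in>{0..3}. of_real (qcoord q c) * qunit c i k)"

lemma sum_coords: "(\<Sum>c\<in>{0..3::nat}. f c) = f 0 + f 1 + f 2 + (f 3 :: 'b :: comm_monoid_add)"
  by (simp add: numeral_eq_Suc atLeast0_atMost_Suc add_ac)

lemma sum_bool: "(\<Sum>i\<in>(UNIV :: bool set). f i) = f False + (f True :: 'b :: comm_monoid_add)"
  by (simp add: UNIV_bool)

lemma qspin_explicit:
  "qspin q i k = (if i then if k then Complex (qRe q) (- qI q) else Complex (- qJ q) (qK q)
     else if k then Complex (qJ q) (qK q) else Complex (qRe q) (qI q))"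
  by (simp add: qspin_def sum_coords qunit_def qcoord_def complex_eq_iff)

text \<open>The covariance of two entries of the \<open>2 \<times> 2\<close> matrix of a standard quaternion Gaussian variable.  It
  separates into a factor for the row spins and a factor for the column spins, both symplectic.\<close>

lemma qunit_completeness:
  "(\<Sum>c\<in>{0..3}. qunit c i k * qunit c i' k') =
     2 * ((if i' = (\<not> i) then spin_sign i else 0) * (if k' = (\<not> k) then spin_sign k else 0))"
  by (cases i; cases k; cases i'; cases k') (simp_all add: sum_coords qunit_def spin_sign_def)

lemma qspin_add: "qspin (q + r) i k = qspin q i k + qspin r i k"
  by (simp add: qspin_explicit plus_quat_def complex_eq_iff)

lemma qspin_0 [simp]: "qspin 0 i k = 0"
  by (simp add: qspin_explicit zero_quat_def complex_eq_iff)

lemma qspin_sum: "qspin (\<Sum>x\<in>A. f x) i k = (\<Sum>x\<in>A. qspin (f x) i k)"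
  by (induction A rule: infinite_finite_induct) (simp_all add: qspin_add)

lemma qspin_mult: "qspin (q * r) i k = (\<Sum>l\<in>UNIV. qspin q i l * qspin r l k)"
  by (cases i; cases k) (simp_all add: sum_bool qspin_explicit times_quat_def complex_eq_iff)

lemma qspin_trace: "of_real (2 * qRe q) = (\<Sum>i\<in>UNIV. qspin q i i)"
  by (simp add: sum_bool qspin_explicit complex_eq_iff)

text \<open>Transposing the matrix of \<open>q\<close> and flipping all spins with signs gives the matrix of the conjugate, so
  \<open>qadjoint X\<close> can be expressed by the entries of \<open>X\<close> without complex conjugation.\<close>

lemma qspin_qcnj: "qspin (qcnj q) k i = spin_sign i * spin_sign k * qspin q (\<not> i) (\<not> k)"
  by (cases i; cases k) (simp_all add: qspin_explicit qcnj_def spin_sign_def complex_eq_iff)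

definition spin_entry :: "quat mat \<Rightarrow> nat \<times> bool \<Rightarrow> nat \<times> bool \<Rightarrow> complex" where
  "spin_entry A \<alpha> \<beta> = qspin (A $$ (fst \<alpha>, fst \<beta>)) (snd \<alpha>) (snd \<beta>)"

lemma spin_entry_mult:
  assumes "A \<in> carrier_mat m n" "B \<in> carrier_mat n l" "fst \<alpha> < m" "fst \<beta> < l"
  shows "spin_entry (A * B) \<alpha> \<beta> = (\<Sum>\<kappa>\<in>{..<n} \<times> UNIV. spin_entry A \<alpha> \<kappa> * spin_entry B \<kappa> \<beta>)"
proof -
  have "(A * B) $$ (fst \<alpha>, fst \<beta>) = (\<Sum>k<n. A $$ (fst \<alpha>, k) * B $$ (k, fst \<beta>))"
    using assms by (auto simp: scalar_prod_def lessThan_atLeast0 intro!: sum.cong)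
  then have "spin_entry (A * B) \<alpha> \<beta> = (\<Sum>k<n. \<Sum>i\<in>UNIV. spin_entry A \<alpha> (k, i) * spin_entry B (k, i) \<beta>)"
    by (simp add: spin_entry_def qspin_sum qspin_mult)
  then show ?thesis by (simp add: sum.cartesian_product case_prod_unfold)
qed

lemma spin_entry_wishart:
  assumes X: "X \<in> carrier_mat m n" and "fst \<beta> < n" "fst \<beta>' < n"
  shows "spin_entry (qadjoint X * X) \<beta> \<beta>' = (\<Sum>\<alpha>\<in>{..<m} \<times> UNIV.
    spin_sign (snd \<alpha>) * spin_sign (snd \<beta>) * (spin_entry X (flip \<alpha>) (flip \<beta>) * spin_entry X \<alpha> \<beta>'))"
proof -
  have "spin_entry (qadjoint X * X) \<beta> \<beta>' =
      (\<Sum>\<alpha>\<in>{..<m} \<times> UNIV. spin_entry (qadjoint X) \<beta> \<alpha> * spin_entry X \<alpha> \<beta>')"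
    using assms by (intro spin_entry_mult) (auto simp: qadjoint_def)
  also have "\<dots> = (\<Sum>\<alpha>\<in>{..<m} \<times> UNIV.
    spin_sign (snd \<alpha>) * spin_sign (snd \<beta>) * (spin_entry X (flip \<alpha>) (flip \<beta>) * spin_entry X \<alpha> \<beta>'))"
    using assms by (intro sum.cong refl) (auto simp: spin_entry_def qadjoint_def qspin_qcnj)
  finally show ?thesis .
qed

lemma spin_trace:
  assumes "A \<in> carrier_mat n n"
  shows "of_real (2 * qRe (qtrace A)) = (\<Sum>\<beta>\<in>{..<n} \<times> UNIV. spin_entry A \<beta> \<beta>)"
proof -
  have "of_real (2 * qRe (qtrace A)) = (\<Sum>i\<in>UNIV. \<Sum>b<n. qspin (A $$ (b, b)) i i)"
    using assms unfolding qspin_trace by (simp add: qtrace_def qspin_sum)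
  also have "\<dots> = (\<Sum>b<n. \<Sum>i\<in>UNIV. qspin (A $$ (b, b)) i i)" by (rule sum.swap)
  finally show ?thesis by (simp add: spin_entry_def sum.cartesian_product case_prod_unfold)
qed

section \<open>Mixed moments of Wishart matrices\<close>

text \<open>The index at a side of a ribbon.  Sides \<open>k\<close> and \<open>-k\<close> belong to the two factors of the Wishart matrix
  at position \<open>k\<close>; the flip at the negative side comes from \<open>qspin_qcnj\<close>.\<close>

definition side_val :: "(nat \<Rightarrow> 'c \<times> bool) \<Rightarrow> (nat \<Rightarrow> 'c \<times> bool) \<Rightarrow> int \<Rightarrow> 'c \<times> bool" where
  "side_val \<beta> \<beta>' x = (if x > 0 then \<beta>' (nat x) else flip (\<beta> (nat (- x))))"

definition sides :: "nat set \<Rightarrow> int set" where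
  "sides K = int ` K \<union> (\<lambda>k. - int k) ` K"

lemma finite_sides [simp]: "finite K \<Longrightarrow> finite (sides K)"
  by (simp add: sides_def)

lemma prod_sides:
  fixes h :: "int \<Rightarrow> 'c :: comm_monoid_mult"
  assumes "finite K" "0 \<notin> K"
  shows "(\<Prod>x\<in>sides K. h x) = (\<Prod>k\<in>K. h (- int k) * h (int k))"
proof -
  have "int ` K \<inter> (\<lambda>k. - int k) ` K = {}"
  proof -
    have "int a \<noteq> - int b" if "a \<in> K" for a b
    proof -
      have "a \<noteq> 0" using that assms(2) by metis
      then show ?thesis by linarith
    qed
    then show ?thesis by blast
  qed
  then have "(\<Prod>x\<in>sides K. h x) = (\<Prod>x\<in>int ` K. h x) * (\<Prod>x\<in>(\<lambda>k. - int k) ` K. h x)"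
    unfolding sides_def using assms(1) by (intro prod.union_disjoint) auto
  also have "\<dots> = (\<Prod>k\<in>K. h (int k)) * (\<Prod>k\<in>K. h (- int k))"
    by (simp add: prod.reindex inj_on_def)
  finally show ?thesis by (simp add: prod.distrib mult.commute)
qed

text \<open>The coefficient of the Gaussian monomial that takes coordinate \<open>u x\<close> at side \<open>x\<close>, in the expansion of a
  product of entries of Wishart matrices with indices \<open>\<beta> k\<close>, \<open>\<beta>' k\<close>; \<open>\<alpha> k\<close> is the summation index inside
  \<open>qadjoint X * X\<close>.\<close>

definition wishart_weight ::
    "nat set \<Rightarrow> (nat \<Rightarrow> nat \<times> bool) \<Rightarrow> (nat \<Rightarrow> nat \<times> bool) \<Rightarrow> (nat \<Rightarrow> nat \<times> bool) \<Rightarrow> (int \<Rightarrow> nat) \<Rightarrow> complex"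
  where "wishart_weight K \<beta> \<beta>' \<alpha> u =
    (\<Prod>k\<in>K. spin_sign (snd (\<alpha> k)) * spin_sign (snd (\<beta> k))) *
    (\<Prod>x\<in>sides K. qunit (u x) (snd (side_val \<alpha> \<alpha> x)) (snd (side_val \<beta> \<beta>' x)))"

context prob_space
begin

text \<open>Moments of one Wishart matrix: expand into coordinates of the Gaussian matrix and count pairings.\<close>

lemma wishart_entry_moments:
  assumes W: "quat_wishart M N m W" and K: "finite K" "0 \<notin> K"
    and \<beta>: "\<And>k. k \<in> K \<Longrightarrow> fst (\<beta> k) < N" "\<And>k. k \<in> K \<Longrightarrow> fst (\<beta>' k) < N"
  shows "has_bochner_integral M (\<lambda>\<omega>. \<Prod>k\<in>K. spin_entry (W \<omega>) (\<beta> k) (\<beta>' k))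
    (\<Sum>\<alpha>\<in>K \<rightarrow>\<^sub>E {..<m} \<times> UNIV. \<Sum>u\<in>sides K \<rightarrow>\<^sub>E {0..3}. wishart_weight K \<beta> \<beta>' \<alpha> u *
       of_nat (card (pairings (sides K)
         (\<lambda>x. ((fst (side_val \<alpha> \<alpha> x), fst (side_val \<beta> \<beta>' x)), u x)))))"
    (is "has_bochner_integral M ?lhs ?rhs")
proof -
  obtain X where X: "quat_gaussian_matrix M m N X"
    and WX: "\<And>\<omega>. \<omega> \<in> space M \<Longrightarrow> W \<omega> = qadjoint (X \<omega>) * X \<omega>"
    using W unfolding quat_wishart_def by blast
  have carrier: "X \<omega> \<in> carrier_mat m N" if "\<omega> \<in> space M" for \<omega>
    using X that by (simp add: quat_gaussian_matrix_def)
  let ?a = "\<lambda>\<alpha> x. side_val \<alpha> \<alpha> x" and ?b = "\<lambda>x. side_val \<beta> \<beta>' x"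
  let ?S = "{..<m} \<times> (UNIV :: bool set)"
  let ?entry = "\<lambda>\<alpha> x. (fst (?a \<alpha> x), fst (?b x))"
  have expand: "(\<Sum>\<alpha>\<in>K \<rightarrow>\<^sub>E ?S. \<Sum>u\<in>sides K \<rightarrow>\<^sub>E {0..3}. wishart_weight K \<beta> \<beta>' \<alpha> u *
      of_real (\<Prod>x\<in>sides K. qcoord (X \<omega> $$ ?entry \<alpha> x) (u x))) = ?lhs \<omega>" if \<omega>: "\<omega> \<in> space M" for \<omega>
  proof -
    have "?lhs \<omega> = (\<Prod>k\<in>K. \<Sum>\<alpha>\<in>?S. spin_sign (snd \<alpha>) * spin_sign (snd (\<beta> k)) *
        (spin_entry (X \<omega>) (flip \<alpha>) (flip (\<beta> k)) * spin_entry (X \<omega>) \<alpha> (\<beta>' k)))"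
      using \<beta> by (intro prod.cong refl) (simp add: WX[OF \<omega>] spin_entry_wishart[OF carrier[OF \<omega>]])
    also have "\<dots> = (\<Sum>\<alpha>\<in>K \<rightarrow>\<^sub>E ?S. \<Prod>k\<in>K. spin_sign (snd (\<alpha> k)) * spin_sign (snd (\<beta> k)) *
        (spin_entry (X \<omega>) (flip (\<alpha> k)) (flip (\<beta> k)) * spin_entry (X \<omega>) (\<alpha> k) (\<beta>' k)))"
      using K by (intro prod_sum_PiE) auto
    also have "\<dots> = (\<Sum>\<alpha>\<in>K \<rightarrow>\<^sub>E ?S. (\<Prod>k\<in>K. spin_sign (snd (\<alpha> k)) * spin_sign (snd (\<beta> k))) *
        (\<Prod>x\<in>sides K. spin_entry (X \<omega>) (?a \<alpha> x) (?b x)))"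
    proof (intro sum.cong refl)
      fix \<alpha>
      have "(\<Prod>x\<in>sides K. spin_entry (X \<omega>) (?a \<alpha> x) (?b x)) =
        (\<Prod>k\<in>K. spin_entry (X \<omega>) (flip (\<alpha> k)) (flip (\<beta> k)) * spin_entry (X \<omega>) (\<alpha> k) (\<beta>' k))"
        unfolding prod_sides[OF K] using K(2) by (intro prod.cong refl) (auto simp: side_val_def)
      then show "(\<Prod>k\<in>K. spin_sign (snd (\<alpha> k)) * spin_sign (snd (\<beta> k)) *
        (spin_entry (X \<omega>) (flip (\<alpha> k)) (flip (\<beta> k)) * spin_entry (X \<omega>) (\<alpha> k) (\<beta>' k))) =
        (\<Prod>k\<in>K. spin_sign (snd (\<alpha> k)) * spin_sign (snd (\<beta> k))) *
        (\<Prod>x\<in>sides K. spin_entry (X \<omega>) (?a \<alpha> x) (?b x))" by (simp only: prod.distrib)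
    qed
    also have "\<dots> = (\<Sum>\<alpha>\<in>K \<rightarrow>\<^sub>E ?S. \<Sum>u\<in>sides K \<rightarrow>\<^sub>E {0..3}. wishart_weight K \<beta> \<beta>' \<alpha> u *
      of_real (\<Prod>x\<in>sides K. qcoord (X \<omega> $$ ?entry \<alpha> x) (u x)))"
    proof (intro sum.cong refl)
      fix \<alpha>
      have "(\<Prod>x\<in>sides K. spin_entry (X \<omega>) (?a \<alpha> x) (?b x)) =
        (\<Sum>u\<in>sides K \<rightarrow>\<^sub>E {0..3}. \<Prod>x\<in>sides K. of_real (qcoord (X \<omega> $$ ?entry \<alpha> x) (u x)) *
           qunit (u x) (snd (?a \<alpha> x)) (snd (?b x)))"
        unfolding spin_entry_def qspin_def using K by (intro prod_sum_PiE) auto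
      then show "(\<Prod>k\<in>K. spin_sign (snd (\<alpha> k)) * spin_sign (snd (\<beta> k))) *
        (\<Prod>x\<in>sides K. spin_entry (X \<omega>) (?a \<alpha> x) (?b x)) =
        (\<Sum>u\<in>sides K \<rightarrow>\<^sub>E {0..3}. wishart_weight K \<beta> \<beta>' \<alpha> u *
         of_real (\<Prod>x\<in>sides K. qcoord (X \<omega> $$ ?entry \<alpha> x) (u x)))"
        by (simp only: wishart_weight_def sum_distrib_left prod.distrib of_real_prod mult_ac)
    qed
    finally show ?thesis by simp
  qed
  have "has_bochner_integral M (\<lambda>\<omega>. \<Sum>\<alpha>\<in>K \<rightarrow>\<^sub>E ?S. \<Sum>u\<in>sides K \<rightarrow>\<^sub>E {0..3}. wishart_weight K \<beta> \<beta>' \<alpha> u *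
      of_real (\<Prod>x\<in>sides K. qcoord (X \<omega> $$ ?entry \<alpha> x) (u x))) ?rhs"
  proof (intro has_bochner_integral_sum has_bochner_integral_mult_right)
    fix \<alpha> u assume \<alpha>: "\<alpha> \<in> K \<rightarrow>\<^sub>E ?S" and u: "u \<in> sides K \<rightarrow>\<^sub>E {0..3::nat}"
    have \<alpha>': "fst (\<alpha> k) < m" if "k \<in> K" for k using PiE_mem[OF \<alpha> that] by auto
    have "has_bochner_integral M (\<lambda>\<omega>. \<Prod>x\<in>sides K. qcoord (X \<omega> $$ ?entry \<alpha> x) (u x))
        (real (card (pairings (sides K) (\<lambda>x. (?entry \<alpha> x, u x)))))"
      using u \<alpha>' \<beta> K by (intro quat_gaussian_matrix_moments[OF X]) (auto simp: sides_def side_val_def)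
    from has_bochner_integral_of_real[OF this]
    show "has_bochner_integral M (\<lambda>\<omega>. of_real (\<Prod>x\<in>sides K. qcoord (X \<omega> $$ ?entry \<alpha> x) (u x)))
        (of_nat (card (pairings (sides K) (\<lambda>x. (?entry \<alpha> x, u x)))) :: complex)"
      by (simp only: of_real_of_nat_eq)
  qed
  then show ?thesis using expand by (simp only: cong: has_bochner_integral_cong)
qed

end

lemma borel_measurable_qspin [measurable]: "(\<lambda>q. qspin q i k) \<in> borel_measurable borel"
  unfolding qspin_def by measurable

lemma pairings_cong:
  assumes "\<And>x. x \<in> A \<Longrightarrow> v x = v' x"
  shows "pairings A v = pairings A v'"
proof -
  have "pairings A v \<subseteq> pairings A v'"
    if eq: "\<And>x. x \<in> A \<Longrightarrow> v x = v' x" for v v' :: "'a \<Rightarrow> 'b"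
  proof
    fix \<gamma> assume \<gamma>: "\<gamma> \<in> pairings A v"
    then have pp: "pair_partition A \<gamma>" and c: "\<forall>p\<in>\<gamma>. \<forall>x\<in>p. \<forall>y\<in>p. v x = v y"
      by (auto simp only: pairings_def mem_Collect_eq)
    have "x \<in> A" if "p \<in> \<gamma>" "x \<in> p" for p x
      using pp that by (auto simp: pair_partition_def partition_on_def)
    then have "\<forall>p\<in>\<gamma>. \<forall>x\<in>p. \<forall>y\<in>p. v' x = v' y" using c eq by metis
    then show "\<gamma> \<in> pairings A v'" using pp by (simp only: pairings_def mem_Collect_eq)
  qed
  then show ?thesis using assms by (intro equalityI) simp_all
qed

lemma wishart_weight_cong:
  assumes "\<And>k. k \<in> K \<Longrightarrow> \<alpha> k = \<alpha>' k" "\<And>x. x \<in> sides K \<Longrightarrow> u x = u' x" "0 \<notin> K"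
  shows "wishart_weight K \<beta> \<beta>' \<alpha> u = wishart_weight K \<beta> \<beta>' \<alpha>' u'"
  unfolding wishart_weight_def using assms
  by (intro arg_cong2[of _ _ _ _ "(*)"] prod.cong refl) (auto simp: side_val_def sides_def)

context prob_space
begin

text \<open>Independence is available for the Wishart matrices themselves and not for the Gaussian matrices
  they come from, so the expectation is factored over the colors before each factor is expanded; the
  expansions are then merged into one sum over all sides.\<close>

lemma wishart_joint_moments:
  fixes t :: "nat \<Rightarrow> nat"
  assumes L: "finite L" and W: "\<And>l. l \<in> L \<Longrightarrow> quat_wishart M N (m l) (W l)"
    and ind: "indep_matrices M N W L"
    and K: "finite K" "0 \<notin> K" and t: "t ` K \<subseteq> L"
    and \<beta>: "\<And>k. k \<in> K \<Longrightarrow> fst (\<beta> k) < N" "\<And>k. k \<in> K \<Longrightarrow> fst (\<beta>' k) < N"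
  shows "has_bochner_integral M (\<lambda>\<omega>. \<Prod>k\<in>K. spin_entry (W (t k) \<omega>) (\<beta> k) (\<beta>' k))
    (\<Sum>\<alpha>\<in>PiE K (\<lambda>k. {..<m (t k)} \<times> UNIV). \<Sum>u\<in>sides K \<rightarrow>\<^sub>E {0..3}. wishart_weight K \<beta> \<beta>' \<alpha> u *
       of_nat (card (pairings (sides K)
         (\<lambda>x. (t (nat \<bar>x\<bar>), (fst (side_val \<alpha> \<alpha> x), fst (side_val \<beta> \<beta>' x)), u x)))))"
    (is "has_bochner_integral M _ ?rhs")
proof -
  define Kl where "Kl l = {k \<in> K. t k = l}" for l
  have Kl: "finite (Kl l)" "0 \<notin> Kl l" "Kl l \<subseteq> K" for l using K by (auto simp: Kl_def)
  have \<beta>l: "fst (\<beta> k) < N" "fst (\<beta>' k) < N" if "k \<in> Kl l" for k l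
    using \<beta> that Kl(3)[of l] by auto
  have disj: "Kl l \<inter> Kl l' = {}" "sides (Kl l) \<inter> sides (Kl l') = {}" if "l \<noteq> l'" for l l'
  proof -
    show "Kl l \<inter> Kl l' = {}" using that by (auto simp: Kl_def)
    have "t (nat \<bar>x\<bar>) = l" if "x \<in> sides (Kl l)" for x l using that by (auto simp: sides_def Kl_def)
    then show "sides (Kl l) \<inter> sides (Kl l') = {}" using that by blast
  qed
  have UK: "(\<Union>l\<in>L. Kl l) = K" using t by (auto simp: Kl_def)
  have Us: "(\<Union>l\<in>L. sides (Kl l)) = sides K" unfolding UK[symmetric] by (auto simp: sides_def)
  have sK: "{x \<in> sides K. t (nat \<bar>x\<bar>) = l} = sides (Kl l)" for l
    by (auto simp: sides_def Kl_def)
  define Z where "Z l \<omega> = (\<Prod>k\<in>Kl l. spin_entry (W l \<omega>) (\<beta> k) (\<beta>' k))" for l \<omega>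
  define card' where "card' l \<alpha> u = (of_nat (card (pairings (sides (Kl l))
    (\<lambda>x. ((fst (side_val \<alpha> \<alpha> x), fst (side_val \<beta> \<beta>' x)), u x)))) :: complex)"
    for l and \<alpha> :: "nat \<Rightarrow> nat \<times> bool" and u :: "int \<Rightarrow> nat"
  define H where "H l \<alpha> u = wishart_weight (Kl l) \<beta> \<beta>' \<alpha> u * card' l \<alpha> u" for l \<alpha> u
  define G where "G l \<alpha> = (\<Sum>u\<in>sides (Kl l) \<rightarrow>\<^sub>E {0..3}. H l \<alpha> u)" for l \<alpha>
  let ?S = "\<lambda>k. {..<m (t k)} \<times> (UNIV :: bool set)"
  have Z: "has_bochner_integral M (Z l) (\<Sum>\<alpha>\<in>PiE (Kl l) ?S. G l \<alpha>)" if l: "l \<in> L" for l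
  proof -
    have "PiE (Kl l) ?S = Kl l \<rightarrow>\<^sub>E {..<m l} \<times> UNIV" by (intro PiE_cong) (simp add: Kl_def)
    moreover have "has_bochner_integral M (Z l) (\<Sum>\<alpha>\<in>Kl l \<rightarrow>\<^sub>E {..<m l} \<times> UNIV. G l \<alpha>)"
      unfolding Z_def[abs_def] G_def H_def card'_def
      using \<beta>l Kl(1,2) by (intro wishart_entry_moments[OF W[OF l]]) auto
    ultimately show ?thesis by (simp only:)
  qed
  \<comment> \<open>The factor of color \<open>l\<close> is a measurable function of the family of entries of \<open>W l\<close>.\<close>
  have "indep_vars (\<lambda>_. borel) (\<lambda>l \<omega>. (\<lambda>w. \<Prod>k\<in>Kl l. qspin (w (fst (\<beta> k), fst (\<beta>' k))) (snd (\<beta> k)) (snd (\<beta>' k)))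
      (\<lambda>ab\<in>{..<N} \<times> {..<N}. W l \<omega> $$ ab)) L"
  proof (rule indep_vars_compose2[OF ind[unfolded indep_matrices_def]])
    fix l
    show "(\<lambda>w. \<Prod>k\<in>Kl l. qspin (w (fst (\<beta> k), fst (\<beta>' k))) (snd (\<beta> k)) (snd (\<beta>' k)))
        \<in> borel_measurable (PiM ({..<N} \<times> {..<N}) (\<lambda>_. borel))"
    proof (rule borel_measurable_prod)
      fix k assume "k \<in> Kl l"
      then have "(fst (\<beta> k), fst (\<beta>' k)) \<in> {..<N} \<times> {..<N}" using \<beta>l by auto
      from measurable_component_singleton[OF this, of "\<lambda>_. borel"]
      show "(\<lambda>w. qspin (w (fst (\<beta> k), fst (\<beta>' k))) (snd (\<beta> k)) (snd (\<beta>' k)))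
        \<in> borel_measurable (PiM ({..<N} \<times> {..<N}) (\<lambda>_. borel))"
        by (rule measurable_compose) (rule borel_measurable_qspin)
    qed
  qed
  moreover have "(\<lambda>w. \<Prod>k\<in>Kl l. qspin (w (fst (\<beta> k), fst (\<beta>' k))) (snd (\<beta> k)) (snd (\<beta>' k)))
      (\<lambda>ab\<in>{..<N} \<times> {..<N}. W l \<omega> $$ ab) = Z l \<omega>" for l \<omega>
    unfolding Z_def using \<beta>l by (intro prod.cong refl) (auto simp: spin_entry_def)
  ultimately have indZ: "indep_vars (\<lambda>_. borel) Z L" by (simp only:)
  have "has_bochner_integral M (\<lambda>\<omega>. \<Prod>l\<in>L. Z l \<omega>) (\<Prod>l\<in>L. \<Sum>\<alpha>\<in>PiE (Kl l) ?S. G l \<alpha>)"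
    using indep_vars_integrable[OF L indZ] indep_vars_lebesgue_integral[OF L indZ] Z
    by (simp add: has_bochner_integral_iff)
  moreover have "(\<Prod>l\<in>L. Z l \<omega>) = (\<Prod>k\<in>K. spin_entry (W (t k) \<omega>) (\<beta> k) (\<beta>' k))" for \<omega>
  proof -
    have "(\<Prod>l\<in>L. Z l \<omega>) = (\<Prod>l\<in>L. \<Prod>k\<in>{k \<in> K. t k = l}. spin_entry (W (t k) \<omega>) (\<beta> k) (\<beta>' k))"
      unfolding Z_def Kl_def by (intro prod.cong refl) auto
    also have "\<dots> = (\<Prod>k\<in>K. spin_entry (W (t k) \<omega>) (\<beta> k) (\<beta>' k))"
      by (rule prod.group[OF K(1) L t])
    finally show ?thesis .
  qed
  moreover have "(\<Prod>l\<in>L. \<Sum>\<alpha>\<in>PiE (Kl l) ?S. G l \<alpha>) = ?rhs"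
  proof -
    have H_cong: "H l \<alpha> u = H l \<alpha>' u'"
      if "\<And>k. k \<in> Kl l \<Longrightarrow> \<alpha> k = \<alpha>' k" "\<And>x. x \<in> sides (Kl l) \<Longrightarrow> u x = u' x" for l \<alpha> \<alpha>' u u'
    proof -
      have sv: "side_val \<alpha> \<alpha> x = side_val \<alpha>' \<alpha>' x" if "x \<in> sides (Kl l)" for x
        using that \<open>\<And>k. k \<in> Kl l \<Longrightarrow> \<alpha> k = \<alpha>' k\<close> Kl(2)[of l] by (auto simp: side_val_def sides_def)
      have "wishart_weight (Kl l) \<beta> \<beta>' \<alpha> u = wishart_weight (Kl l) \<beta> \<beta>' \<alpha>' u'"
        by (rule wishart_weight_cong) (use that Kl(2) in auto)
      moreover have "card' l \<alpha> u = card' l \<alpha>' u'"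
        unfolding card'_def using sv that(2)
        by (intro arg_cong[of _ _ of_nat] arg_cong[of _ _ card] pairings_cong) simp
      ultimately show ?thesis by (simp only: H_def)
    qed
    have "(\<Prod>l\<in>L. \<Sum>\<alpha>\<in>PiE (Kl l) ?S. G l \<alpha>) = (\<Sum>\<alpha>\<in>PiE K ?S. \<Prod>l\<in>L. G l (restrict \<alpha> (Kl l)))"
      using prod_sum_PiE_blocks[OF L, of Kl G ?S] disj UK by simp
    also have "\<dots> = (\<Sum>\<alpha>\<in>PiE K ?S. \<Prod>l\<in>L. G l \<alpha>)"
      unfolding G_def by (intro sum.cong prod.cong refl H_cong) auto
    also have "\<dots> = (\<Sum>\<alpha>\<in>PiE K ?S. \<Sum>u\<in>sides K \<rightarrow>\<^sub>E {0..3}. \<Prod>l\<in>L. H l \<alpha> (restrict u (sides (Kl l))))"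
    proof (intro sum.cong refl)
      fix \<alpha>
      show "(\<Prod>l\<in>L. G l \<alpha>) = (\<Sum>u\<in>sides K \<rightarrow>\<^sub>E {0..3}. \<Prod>l\<in>L. H l \<alpha> (restrict u (sides (Kl l))))"
        unfolding G_def Us[symmetric] by (rule prod_sum_PiE_blocks[OF L]) (use disj in blast)
    qed
    also have "\<dots> = (\<Sum>\<alpha>\<in>PiE K ?S. \<Sum>u\<in>sides K \<rightarrow>\<^sub>E {0..3}. \<Prod>l\<in>L. H l \<alpha> u)"
      by (intro sum.cong prod.cong refl H_cong) auto
    also have "\<dots> = ?rhs"
    proof (intro sum.cong refl)
      fix \<alpha> u
      have "(\<Prod>l\<in>L. wishart_weight (Kl l) \<beta> \<beta>' \<alpha> u) = wishart_weight K \<beta> \<beta>' \<alpha> u"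
      proof -
        have "(\<lambda>x. t (nat \<bar>x\<bar>)) ` sides K \<subseteq> L" using t by (auto simp: sides_def)
        then have "(\<Prod>l\<in>L. \<Prod>x\<in>sides (Kl l). h x) = (\<Prod>x\<in>sides K. h x)" for h :: "int \<Rightarrow> complex"
          using prod.group[OF finite_sides[OF K(1)] L, of "\<lambda>x. t (nat \<bar>x\<bar>)" h] by (simp only: sK)
        moreover have "(\<Prod>l\<in>L. \<Prod>k\<in>Kl l. h k) = (\<Prod>k\<in>K. h k)" for h :: "nat \<Rightarrow> complex"
          using prod.group[OF K(1) L t, of h] by (simp only: Kl_def)
        ultimately show ?thesis
          unfolding wishart_weight_def prod.distrib[of _ _ L] by (simp only:)
      qed
      moreover have "(\<Prod>l\<in>L. card' l \<alpha> u) = of_nat (card (pairings (sides K)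
         (\<lambda>x. (t (nat \<bar>x\<bar>), (fst (side_val \<alpha> \<alpha> x), fst (side_val \<beta> \<beta>' x)), u x))))"
        unfolding card'_def
      proof (subst card_pairings_split[OF finite_sides[OF K(1)] L])
        show "(\<lambda>x. t (nat \<bar>x\<bar>)) ` sides K \<subseteq> L" using t by (auto simp: sides_def)
      qed (simp only: sK of_nat_prod)
      ultimately show "(\<Prod>l\<in>L. H l \<alpha> u) = wishart_weight K \<beta> \<beta>' \<alpha> u * of_nat (card (pairings (sides K)
         (\<lambda>x. (t (nat \<bar>x\<bar>), (fst (side_val \<alpha> \<alpha> x), fst (side_val \<beta> \<beta>' x)), u x))))"
        by (simp only: H_def prod.distrib)
    qed
    finally show ?thesis .
  qed
  ultimately show ?thesis by (simp only:)
qed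

end

section \<open>Traces of products as sums over closed index paths\<close>

lemma sum_PiE_insert:
  assumes "a \<notin> I"
  shows "(\<Sum>f\<in>PiE (insert a I) S. h f) = (\<Sum>x\<in>S a. \<Sum>f\<in>PiE I S. h (f(a := x)))"
proof -
  have "(\<Sum>f\<in>PiE (insert a I) S. h f) = (\<Sum>(x, f)\<in>S a \<times> PiE I S. h (f(a := x)))"
    unfolding PiE_insert_eq by (subst sum.reindex[OF inj_combinator[OF assms]]) (simp add: case_prod_unfold)
  then show ?thesis by (simp add: sum.cartesian_product)
qed

lemma mat_prod_Cons: "mat_prod N (A # As) = A * mat_prod N As"
  by (simp add: mat_prod_def)

lemma mat_prod_carrier:
  assumes "\<And>A. A \<in> set As \<Longrightarrow> A \<in> carrier_mat N N"
  shows "mat_prod N As \<in> carrier_mat N N"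
  using assms by (induction As) (auto simp: mat_prod_def intro!: mult_carrier_mat)

text \<open>The sum runs over the paths \<open>x, \<beta> (a + 1), \<dots>, \<beta> (a + l), y\<close>; updating \<open>\<beta>\<close> at \<open>a\<close> supplies the
  starting point.\<close>

lemma spin_entry_mat_prod:
  assumes A: "\<And>k. A k \<in> carrier_mat N N" and x: "fst x < N" "fst y < N"
  shows "spin_entry (mat_prod N (map A [a..<Suc (a + l)])) x y =
    (\<Sum>\<beta>\<in>{a<..a + l} \<rightarrow>\<^sub>E {..<N} \<times> UNIV. \<Prod>k\<in>{a..a + l}.
       spin_entry (A k) ((\<beta>(a := x)) k) (if k = a + l then y else \<beta> (Suc k)))"
  using x
proof (induction l arbitrary: a x)
  case 0
  have "mat_prod N (map A [a..<Suc (a + 0)]) = A a"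
    using right_mult_one_mat[OF A[of a]] by (simp add: mat_prod_def)
  then show ?case by simp
next
  case (Suc l)
  let ?S = "{..<N} \<times> (UNIV :: bool set)"
  let ?B = "mat_prod N (map A [Suc a..<Suc (Suc a + l)])"
  have B: "?B \<in> carrier_mat N N" using A by (intro mat_prod_carrier) auto
  have "[a..<Suc (a + Suc l)] = a # [Suc a..<Suc (Suc a + l)]" by (simp add: upt_conv_Cons)
  then have "spin_entry (mat_prod N (map A [a..<Suc (a + Suc l)])) x y = spin_entry (A a * ?B) x y"
    by (simp only: list.map mat_prod_Cons)
  also have "\<dots> = (\<Sum>z\<in>?S. spin_entry (A a) x z * spin_entry ?B z y)"
    by (rule spin_entry_mult[OF A B Suc.prems])
  also have "\<dots> = (\<Sum>z\<in>?S. \<Sum>\<beta>\<in>{Suc a<..Suc a + l} \<rightarrow>\<^sub>E ?S. \<Prod>k\<in>{a..a + Suc l}.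
       spin_entry (A k) ((\<beta>(Suc a := z, a := x)) k) (if k = a + Suc l then y else (\<beta>(Suc a := z)) (Suc k)))"
  proof (intro sum.cong refl)
    fix z assume "z \<in> ?S"
    then have z: "fst z < N" by auto
    have set: "{a..a + Suc l} = insert a {Suc a..Suc a + l}" by auto
    show "spin_entry (A a) x z * spin_entry ?B z y = (\<Sum>\<beta>\<in>{Suc a<..Suc a + l} \<rightarrow>\<^sub>E ?S. \<Prod>k\<in>{a..a + Suc l}.
       spin_entry (A k) ((\<beta>(Suc a := z, a := x)) k) (if k = a + Suc l then y else (\<beta>(Suc a := z)) (Suc k)))"
      unfolding Suc.IH[OF z Suc.prems(2)] sum_distrib_left set
      by (intro sum.cong refl, subst prod.insert) (auto intro!: prod.cong)
  qed
  also have "\<dots> = (\<Sum>\<beta>\<in>PiE (insert (Suc a) {Suc a<..Suc a + l}) (\<lambda>_. ?S). \<Prod>k\<in>{a..a + Suc l}.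
       spin_entry (A k) ((\<beta>(a := x)) k) (if k = a + Suc l then y else \<beta> (Suc k)))"
    by (subst sum_PiE_insert) auto
  also have "insert (Suc a) {Suc a<..Suc a + l} = {a<..a + Suc l}" by auto
  finally show ?case .
qed

lemma spin_trace_mat_prod:
  assumes "\<And>k. k \<in> {a..b} \<Longrightarrow> A k \<in> carrier_mat N N" and ab: "a \<le> b"
  shows "of_real (2 * qRe (qtrace (mat_prod N (map A [a..<b + 1])))) =
    (\<Sum>\<beta>\<in>{a..b} \<rightarrow>\<^sub>E {..<N} \<times> UNIV. \<Prod>k\<in>{a..b}. spin_entry (A k) (\<beta> k) (\<beta> (if k = b then a else Suc k)))"
proof -
  define A' where "A' k = (if k \<in> {a..b} then A k else 1\<^sub>m N)" for k
  have A: "A' k \<in> carrier_mat N N" for k using assms(1) by (simp add: A'_def)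
  have eq: "map A [a..<b + 1] = map A' [a..<b + 1]" by (auto simp: A'_def)
  obtain l where l: "b = a + l" using ab le_Suc_ex by blast
  let ?S = "{..<N} \<times> (UNIV :: bool set)"
  have "of_real (2 * qRe (qtrace (mat_prod N (map A [a..<b + 1])))) =
      (\<Sum>x\<in>?S. spin_entry (mat_prod N (map A' [a..<Suc (a + l)])) x x)"
    unfolding eq using A by (subst spin_trace[of _ N]) (auto simp: l intro!: mat_prod_carrier)
  also have "\<dots> = (\<Sum>x\<in>?S. \<Sum>\<beta>\<in>{a<..b} \<rightarrow>\<^sub>E ?S. \<Prod>k\<in>{a..b}.
       spin_entry (A' k) ((\<beta>(a := x)) k) ((\<beta>(a := x)) (if k = b then a else Suc k)))"
  proof (intro sum.cong refl)
    fix x assume "x \<in> ?S"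
    then have x: "fst x < N" by auto
    show "spin_entry (mat_prod N (map A' [a..<Suc (a + l)])) x x = (\<Sum>\<beta>\<in>{a<..b} \<rightarrow>\<^sub>E ?S. \<Prod>k\<in>{a..b}.
       spin_entry (A' k) ((\<beta>(a := x)) k) ((\<beta>(a := x)) (if k = b then a else Suc k)))"
      unfolding spin_entry_mat_prod[OF A x x] l by (intro sum.cong prod.cong refl) auto
  qed
  also have "\<dots> = (\<Sum>\<beta>\<in>PiE (insert a {a<..b}) (\<lambda>_. ?S). \<Prod>k\<in>{a..b}.
       spin_entry (A' k) (\<beta> k) (\<beta> (if k = b then a else Suc k)))"
    by (subst sum_PiE_insert) auto
  also have "insert a {a<..b} = {a..b}" using ab by auto
  also have "(\<Sum>\<beta>\<in>{a..b} \<rightarrow>\<^sub>E ?S. \<Prod>k\<in>{a..b}. spin_entry (A' k) (\<beta> k) (\<beta> (if k = b then a else Suc k))) =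
      (\<Sum>\<beta>\<in>{a..b} \<rightarrow>\<^sub>E ?S. \<Prod>k\<in>{a..b}. spin_entry (A k) (\<beta> k) (\<beta> (if k = b then a else Suc k)))"
    by (simp add: A'_def)
  finally show ?thesis .
qed

section \<open>The matchings \<open>\<delta>\<close> and \<open>\<sigma>\<close>\<close>

lemma side_labels_eq_sides: "side_labels n = sides {1..n}"
proof
  show "side_labels n \<subseteq> sides {1..n}"
  proof
    fix x assume x: "x \<in> side_labels n"
    show "x \<in> sides {1..n}"
    proof (cases "x > 0")
      case True
      then have "x = int (nat x)" "nat x \<in> {1..n}" using x by (auto simp: side_labels_def)
      then show ?thesis unfolding sides_def by blast
    next
      case False
      then have "x = - int (nat (- x))" "nat (- x) \<in> {1..n}" using x by (auto simp: side_labels_def)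
      then show ?thesis unfolding sides_def by blast
    qed
  qed
  show "sides {1..n} \<subseteq> side_labels n" by (auto simp: sides_def side_labels_def)
qed

text \<open>Both fixed matchings join positive to negative sides: \<open>\<delta>\<close> belongs to the identity and \<open>\<sigma>\<close> to the cyclic
  successor in the blocks.\<close>

definition matching_of :: "nat \<Rightarrow> (nat \<Rightarrow> nat) \<Rightarrow> int set set" where
  "matching_of n q = (\<lambda>k. {int k, - int (q k)}) ` {1..n}"

context
  fixes n :: nat and q :: "nat \<Rightarrow> nat"
  assumes q: "bij_betw q {1..n} {1..n}"
begin

lemma pair_partition_matching_of: "pair_partition (side_labels n) (matching_of n q)"
proof -
  have mem: "q k \<in> {1..n}" if "k \<in> {1..n}" for k using q that bij_betwE by blast
  have inj: "q k = q k' \<longleftrightarrow> k = k'" if "k \<in> {1..n}" "k' \<in> {1..n}" for k k'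
    using inj_on_eq_iff[OF bij_betw_imp_inj_on[OF q] that] .
  have neg: "- int (q k) \<noteq> int k'" if "k \<in> {1..n}" for k k'
    using mem[OF that] by auto
  have "partition_on (side_labels n) (matching_of n q)"
  proof (rule partition_onI)
    show "\<Union>(matching_of n q) = side_labels n"
    proof -
      have "\<Union>(matching_of n q) = int ` {1..n} \<union> (\<lambda>k. - int k) ` q ` {1..n}"
        by (auto simp: matching_of_def)
      then show ?thesis using q by (simp add: bij_betw_def side_labels_eq_sides sides_def)
    qed
    show "{} \<notin> matching_of n q" by (auto simp: matching_of_def)
    show "disjnt p p'" if "p \<in> matching_of n q" "p' \<in> matching_of n q" "p \<noteq> p'" for p p'
    proof -
      obtain k k' where k: "k \<in> {1..n}" "p = {int k, - int (q k)}" "k' \<in> {1..n}"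
        "p' = {int k', - int (q k')}" using \<open>p \<in> _\<close> \<open>p' \<in> _\<close> unfolding matching_of_def by blast
      then have "k \<noteq> k'" using \<open>p \<noteq> p'\<close> by auto
      then show ?thesis using k neg[OF k(1)] neg[OF k(3)] inj[OF k(1) k(3)] by (auto simp: disjnt_def)
    qed
  qed
  moreover have "card p = 2" if p: "p \<in> matching_of n q" for p
  proof -
    obtain k where k: "k \<in> {1..n}" "p = {int k, - int (q k)}" using p by (auto simp: matching_of_def)
    then show ?thesis using neg[OF k(1), of k] by simp
  qed
  ultimately show ?thesis by (simp add: pair_partition_def)
qed

lemma partner_matching_of:
  assumes "k \<in> {1..n}"
  shows "partner (matching_of n q) (int k) = - int (q k)" "partner (matching_of n q) (- int (q k)) = int k"
proof -
  have "{int k, - int (q k)} \<in> matching_of n q" using assms by (auto simp: matching_of_def)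
  then show "partner (matching_of n q) (int k) = - int (q k)"
    "partner (matching_of n q) (- int (q k)) = int k"
    by (auto intro!: partner_eqI[OF pair_partition_matching_of] simp: insert_commute)
qed

lemma transversal_matching_of:
  "transversal (side_labels n) (partner (matching_of n q)) (int ` {1..n})"
  unfolding transversal_def
proof (intro conjI ballI)
  have qim: "q ` {1..n} = {1..n}" using q by (simp add: bij_betw_def)
  show "int ` {1..n} \<subseteq> side_labels n" by (auto simp: side_labels_def)
  fix x assume "x \<in> side_labels n"
  then consider k where "k \<in> {1..n}" "x = int k" | k where "k \<in> {1..n}" "x = - int k"
    unfolding side_labels_eq_sides sides_def by blast
  then show "partner (matching_of n q) x \<in> int ` {1..n} \<longleftrightarrow> x \<notin> int ` {1..n}"
  proof cases
    case 1
    have "q k \<in> {1..n}" using qim 1 by blast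
    then have "- int (q k) \<notin> int ` {1..n}" by auto
    then show ?thesis using partner_matching_of(1)[OF 1(1)] 1 by auto
  next
    case 2
    obtain k' where k': "k' \<in> {1..n}" "k = q k'" using qim 2(1) by blast
    have "- int k \<notin> int ` {1..n}" using 2 by auto
    then show ?thesis using partner_matching_of(2)[OF k'(1)] 2 k' by auto
  qed
qed

text \<open>One index for each position is the same as one index for each side, flipped along the matching.\<close>

lemma bij_betw_side_val:
  assumes R: "\<And>k. k \<in> {1..n} \<Longrightarrow> Rs (int k) = R (q k)" "\<And>k. k \<in> {1..n} \<Longrightarrow> Rs (- int k) = R k"
  shows "bij_betw (\<lambda>\<beta>. restrict (side_val \<beta> (\<beta> \<circ> q)) (side_labels n)) (PiE {1..n} (\<lambda>k. R k \<times> UNIV))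
    {f \<in> PiE (side_labels n) (\<lambda>x. Rs x \<times> UNIV). \<forall>x\<in>side_labels n. f (partner (matching_of n q) x) = flip (f x)}"
    (is "bij_betw ?v ?D ?E")
proof (rule bij_betw_byWitness[where f' = "\<lambda>f. \<lambda>k\<in>{1..n}. flip (f (- int k))"])
  have qim: "q ` {1..n} = {1..n}" using q by (simp add: bij_betw_def)
  have pos: "?v \<beta> (int k) = \<beta> (q k)" and neg: "?v \<beta> (- int k) = flip (\<beta> k)" if "k \<in> {1..n}" for \<beta> k
    using that by (auto simp: side_val_def side_labels_def)
  have split: "\<And>P. (\<And>k. k \<in> {1..n} \<Longrightarrow> P (int k)) \<Longrightarrow> (\<And>k. k \<in> {1..n} \<Longrightarrow> P (- int k)) \<Longrightarrow>
      x \<in> side_labels n \<Longrightarrow> P x" for x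
    unfolding side_labels_eq_sides sides_def by blast
  have mem: "int k \<in> side_labels n" "- int k \<in> side_labels n" if "k \<in> {1..n}" for k
    using that by (auto simp: side_labels_def)
  have flip_mem: "flip s \<in> X \<times> UNIV \<longleftrightarrow> s \<in> X \<times> UNIV" for s :: "'a \<times> bool" and X
    by (simp add: mem_Times_iff)
  let ?i = "\<lambda>f. \<lambda>k\<in>{1..n}. flip (f (- int k))"
  show "\<forall>\<beta>\<in>?D. ?i (?v \<beta>) = \<beta>"
  proof
    fix \<beta> assume \<beta>: "\<beta> \<in> ?D"
    show "?i (?v \<beta>) = \<beta>"
    proof
      fix k show "?i (?v \<beta>) k = \<beta> k"
      proof (cases "k \<in> {1..n}")
        case True
        then show ?thesis using neg[OF True, of \<beta>] by (simp only: restrict_apply flip_flip if_True)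
      next
        case False
        then show ?thesis using PiE_arb[OF \<beta> False] by (simp only: restrict_apply if_False)
      qed
    qed
  qed
  show "\<forall>f\<in>?E. ?v (?i f) = f"
  proof
    fix f assume f: "f \<in> ?E"
    show "?v (?i f) = f"
    proof
      fix x
      show "?v (?i f) x = f x"
      proof (cases "x \<in> side_labels n")
        case True
        then show ?thesis
        proof (rule split[rotated 2])
          fix k assume k: "k \<in> {1..n}"
          have qk: "q k \<in> {1..n}" using qim k by blast
          have "f (- int (q k)) = flip (f (int k))"
            using f mem(1)[OF k] partner_matching_of(1)[OF k] by (metis (mono_tags, lifting) mem_Collect_eq)
          then show "?v (?i f) (int k) = f (int k)"
            unfolding pos[OF k] using qk by (simp only: restrict_apply if_True flip_flip)
        next
          fix k assume k: "k \<in> {1..n}"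
          show "?v (?i f) (- int k) = f (- int k)"
            unfolding neg[OF k] using k by (simp only: restrict_apply if_True flip_flip)
        qed
      next
        case False
        have "f \<in> PiE (side_labels n) (\<lambda>x. Rs x \<times> UNIV)" using f by blast
        from PiE_arb[OF this False] show ?thesis using False by (simp only: restrict_apply if_False)
      qed
    qed
  qed
  show "?v ` ?D \<subseteq> ?E"
  proof (rule image_subsetI)
    fix \<beta> assume \<beta>: "\<beta> \<in> ?D"
    have "?v \<beta> x \<in> Rs x \<times> UNIV" if "x \<in> side_labels n" for x
      using that
    proof (rule split[rotated 2])
      fix k assume k: "k \<in> {1..n}"
      have "q k \<in> {1..n}" using qim k by blast
      from PiE_mem[OF \<beta> this] show "?v \<beta> (int k) \<in> Rs (int k) \<times> UNIV"
        unfolding pos[OF k] R(1)[OF k] .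
      from PiE_mem[OF \<beta> k] show "?v \<beta> (- int k) \<in> Rs (- int k) \<times> UNIV"
        unfolding neg[OF k] R(2)[OF k] flip_mem .
    qed
    moreover have "?v \<beta> (partner (matching_of n q) x) = flip (?v \<beta> x)" if "x \<in> side_labels n" for x
      using that
    proof (rule split[rotated 2])
      fix k assume k: "k \<in> {1..n}"
      have qk: "q k \<in> {1..n}" using qim k by blast
      show "?v \<beta> (partner (matching_of n q) (int k)) = flip (?v \<beta> (int k))"
        unfolding partner_matching_of(1)[OF k] pos[OF k] neg[OF qk] ..
      obtain k' where k': "k' \<in> {1..n}" "k = q k'" using qim k by blast
      show "?v \<beta> (partner (matching_of n q) (- int k)) = flip (?v \<beta> (- int k))"
        unfolding neg[OF k] unfolding k'(2) partner_matching_of(2)[OF k'(1)] pos[OF k'(1)] flip_flip ..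
    qed
    ultimately show "?v \<beta> \<in> ?E" by (simp only: mem_Collect_eq PiE_iff extensional_restrict) simp
  qed
  show "?i ` ?E \<subseteq> ?D"
  proof (rule image_subsetI)
    fix f assume f: "f \<in> ?E"
    have "flip (f (- int k)) \<in> R k \<times> UNIV" if k: "k \<in> {1..n}" for k
      using f mem(2)[OF k] R(2)[OF k] flip_mem by (metis (mono_tags, lifting) PiE_mem mem_Collect_eq)
    then show "(?i f) \<in> ?D" by (simp only: restrict_PiE_iff) simp
  qed
qed

text \<open>\<open>spin_sum\<close> for indices attached to positions: \<open>q = id\<close> gives the row indices, whose loops are the
  white vertices, and \<open>q = block_next m j\<close> the column indices, whose loops are the faces.\<close>

lemma spin_sum_edges:
  assumes \<gamma>: "pair_partition (side_labels n) \<gamma>"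
    and F: "transversal (side_labels n) (partner (matching_of n q)) F"
      "transversal (side_labels n) (partner \<gamma>) F"
    and Q: "transversal (side_labels n) (partner \<gamma>) Q"
    and R: "\<And>k. k \<in> {1..n} \<Longrightarrow> Rs (int k) = R (q k)" "\<And>k. k \<in> {1..n} \<Longrightarrow> Rs (- int k) = R k"
      "\<And>k. k \<in> {1..n} \<Longrightarrow> finite (R k)"
    and T: "\<And>C x. C \<in> cycles (matching_of n q) \<gamma> \<Longrightarrow> x \<in> C \<Longrightarrow> Rs x = T C"
  shows "(\<Sum>\<beta>\<in>PiE {1..n} (\<lambda>k. R k \<times> UNIV). (\<Prod>k\<in>{1..n}. spin_sign (snd (\<beta> k))) *
      (\<Prod>x\<in>Q. spin_form (side_val \<beta> (\<beta> \<circ> q) x) (side_val \<beta> (\<beta> \<circ> q) (partner \<gamma> x)))) =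
    (- 1) ^ (card (int ` {1..n} - F) + card (Q - F)) *
      (\<Prod>C\<in>cycles (matching_of n q) \<gamma>. of_nat (2 * card (T C)))"
proof -
  let ?A = "side_labels n" and ?\<pi> = "matching_of n q" and ?P = "int ` {1..n}"
  let ?v = "\<lambda>\<beta>. restrict (side_val \<beta> (\<beta> \<circ> q)) ?A"
  have qim: "q ` {1..n} = {1..n}" using q by (simp add: bij_betw_def)
  have Rfin: "finite (Rs x)" if x: "x \<in> ?A" for x
  proof -
    consider k where "k \<in> {1..n}" "x = int k" | k where "k \<in> {1..n}" "x = - int k"
      using x unfolding side_labels_eq_sides sides_def by blast
    then show ?thesis
    proof cases
      case 1
      moreover have "q k \<in> {1..n}" using qim 1 by blast
      ultimately show ?thesis using R(1,3) by simp
    qed (use R(2,3) in simp)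
  qed
  have "(\<Sum>\<beta>\<in>PiE {1..n} (\<lambda>k. R k \<times> UNIV). (\<Prod>k\<in>{1..n}. spin_sign (snd (\<beta> k))) *
      (\<Prod>x\<in>Q. spin_form (side_val \<beta> (\<beta> \<circ> q) x) (side_val \<beta> (\<beta> \<circ> q) (partner \<gamma> x)))) =
    (\<Sum>\<beta>\<in>PiE {1..n} (\<lambda>k. R k \<times> UNIV). (\<Prod>x\<in>?P. spin_sign (snd (?v \<beta> x))) *
      (\<Prod>x\<in>Q. spin_form (?v \<beta> x) (?v \<beta> (partner \<gamma> x))))"
  proof (intro sum.cong refl arg_cong2[of _ _ _ _ "(*)"])
    fix \<beta> :: "nat \<Rightarrow> 'a \<times> bool"
    have "(\<Prod>x\<in>?P. spin_sign (snd (?v \<beta> x))) = (\<Prod>k\<in>{1..n}. spin_sign (snd (?v \<beta> (int k))))"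
      by (simp only: prod.reindex[OF inj_on_of_nat] o_def)
    also have "\<dots> = (\<Prod>k\<in>{1..n}. spin_sign (snd (\<beta> (q k))))"
      by (intro prod.cong refl) (simp add: side_val_def side_labels_def)
    also have "\<dots> = (\<Prod>k\<in>{1..n}. spin_sign (snd (\<beta> k)))"
      by (rule prod.reindex_bij_betw[OF q])
    finally show "(\<Prod>k\<in>{1..n}. spin_sign (snd (\<beta> k))) = (\<Prod>x\<in>?P. spin_sign (snd (?v \<beta> x)))" ..
    show "(\<Prod>x\<in>Q. spin_form (side_val \<beta> (\<beta> \<circ> q) x) (side_val \<beta> (\<beta> \<circ> q) (partner \<gamma> x))) =
        (\<Prod>x\<in>Q. spin_form (?v \<beta> x) (?v \<beta> (partner \<gamma> x)))"
      using transversalD(1)[OF Q] matching_onD(1)[OF matching_on_partner[OF \<gamma>]]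
      by (intro prod.cong refl) (simp del: o_apply)
  qed
  also have "\<dots> = (\<Sum>f\<in>{f \<in> PiE ?A (\<lambda>x. Rs x \<times> UNIV). \<forall>x\<in>?A. f (partner ?\<pi> x) = flip (f x)}.
      (\<Prod>x\<in>?P. spin_sign (snd (f x))) * (\<Prod>x\<in>Q. spin_form (f x) (f (partner \<gamma> x))))"
    by (rule sum.reindex_bij_betw[OF bij_betw_side_val[OF R(1,2)]])
  also have "\<dots> = (- 1) ^ (card (?P - F) + card (Q - F)) * (\<Prod>C\<in>cycles ?\<pi> \<gamma>. of_nat (2 * card (T C)))"
    using Rfin
    by (intro spin_sum[OF _ pair_partition_matching_of \<gamma> F transversal_matching_of Q _ T])
       (simp_all add: side_labels_eq_sides)
  finally show ?thesis .
qed

end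

lemma delta_eq_matching_of: "delta n = matching_of n id"
  by (auto simp: delta_def matching_of_def)

definition block :: "(nat \<Rightarrow> nat) \<Rightarrow> nat \<Rightarrow> nat set" where
  "block j r = {block_first j r..block_last j r}"

definition block_next :: "nat \<Rightarrow> (nat \<Rightarrow> nat) \<Rightarrow> nat \<Rightarrow> nat" where
  "block_next m j k = (if k \<in> block_last j ` {1..m}
     then block_first j (THE r. r \<in> {1..m} \<and> block_last j r = k) else Suc k)"

context
  fixes m :: nat and j :: "nat \<Rightarrow> nat"
  assumes j: "\<forall>r\<in>{1..m}. j r \<ge> 1"
begin

lemma block_first_eq: "r \<ge> 1 \<Longrightarrow> block_first j r = Suc (block_last j (r - 1))"
  by (cases r) (auto simp: block_first_def block_last_def atLeastLessThanSuc_atLeastAtMost)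

lemma block_last_Suc: "block_last j (Suc r) = block_last j r + j (Suc r)"
  by (simp add: block_last_def)

lemma block_last_mono: "r \<le> r' \<Longrightarrow> block_last j r \<le> block_last j r'"
  by (simp add: block_last_def sum_mono2)

lemma block_first_le_last: "r \<in> {1..m} \<Longrightarrow> block_first j r \<le> block_last j r"
  using j block_last_Suc[of "r - 1"] block_first_eq[of r] by fastforce

lemma UN_blocks: "r \<le> m \<Longrightarrow> (\<Union>i\<in>{1..r}. block j i) = {1..block_last j r}"
proof (induction r)
  case 0
  then show ?case by (simp add: block_last_def)
next
  case (Suc r)
  have "{1..Suc r} = insert (Suc r) {1..r}" by auto
  moreover have "block j (Suc r) = {Suc (block_last j r)..block_last j (Suc r)}"
    using block_first_eq[of "Suc r"] by (simp add: block_def)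
  ultimately show ?case using Suc block_last_mono[of r "Suc r"] by auto
qed

lemma blocks_disjoint:
  assumes "r \<in> {1..m}" "r' \<in> {1..m}" "r \<noteq> r'"
  shows "block j r \<inter> block j r' = {}"
proof -
  have "block j r \<inter> block j r' = {}" if "r < r'" for r r'
  proof -
    have "block_last j r \<le> block_last j (r' - 1)" using that by (intro block_last_mono) simp
    then show ?thesis using block_first_eq[of r'] that by (auto simp: block_def)
  qed
  from this[of r r'] this[of r' r] show ?thesis using assms(3) by (metis Int_commute linorder_neqE_nat)
qed

lemma block_next_in_block:
  assumes r: "r \<in> {1..m}" and k: "k \<in> block j r"
  shows "block_next m j k = (if k = block_last j r then block_first j r else Suc k)"
    "block_next m j k \<in> block j r"
proof -
  have last: "block_last j r' \<in> block j r'" if "r' \<in> {1..m}" for r'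
    using block_first_le_last[OF that] by (simp add: block_def)
  have iff: "block_last j r' = k \<longleftrightarrow> r' = r \<and> k = block_last j r" if "r' \<in> {1..m}" for r'
    using blocks_disjoint[OF that r] last[OF that] k by blast
  show eq: "block_next m j k = (if k = block_last j r then block_first j r else Suc k)"
  proof (cases "k = block_last j r")
    case True
    then have "(THE r. r \<in> {1..m} \<and> block_last j r = k) = r"
      using iff r by (intro the_equality) blast+
    then show ?thesis using True r by (auto simp: block_next_def)
  next
    case False
    then have "k \<notin> block_last j ` {1..m}" using iff by blast
    then show ?thesis using False by (simp add: block_next_def)
  qed
  show "block_next m j k \<in> block j r"
    using k block_first_le_last[OF r] unfolding eq by (auto simp: block_def)
qed

lemma obtain_block:
  assumes "k \<in> {1..block_last j m}"
  obtains r where "r \<in> {1..m}" "k \<in> block j r"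
  using assms UN_blocks[of m] by blast

lemma block_next_bij: "bij_betw (block_next m j) {1..block_last j m} {1..block_last j m}"
proof -
  have sub: "block j r \<subseteq> {1..block_last j m}" if "r \<in> {1..m}" for r
    using UN_blocks[of m] that by blast
  have "block_next m j ` {1..block_last j m} \<subseteq> {1..block_last j m}"
  proof (rule image_subsetI)
    fix k assume "k \<in> {1..block_last j m}"
    then obtain r where r: "r \<in> {1..m}" "k \<in> block j r" by (rule obtain_block)
    show "block_next m j k \<in> {1..block_last j m}" using block_next_in_block(2)[OF r] sub[OF r(1)] by blast
  qed
  moreover have "inj_on (block_next m j) {1..block_last j m}"
  proof (rule inj_onI)
    fix k k' assume k: "k \<in> {1..block_last j m}" "k' \<in> {1..block_last j m}"
      "block_next m j k = block_next m j k'"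
    obtain r where r: "r \<in> {1..m}" "k \<in> block j r" using k(1) by (rule obtain_block)
    obtain r' where r': "r' \<in> {1..m}" "k' \<in> block j r'" using k(2) by (rule obtain_block)
    have "r = r'"
      using blocks_disjoint[OF r(1) r'(1)] block_next_in_block(2)[OF r] block_next_in_block(2)[OF r'] k(3)
      by force
    then show "k = k'"
      using block_next_in_block(1)[OF r] block_next_in_block(1)[OF r'] k(3) r r'
      by (auto simp: block_def split: if_splits)
  qed
  ultimately show ?thesis by (simp add: bij_betw_def endo_inj_surj)
qed

lemma sigma_eq_matching_of: "sigma m j = matching_of (block_last j m) (block_next m j)"
proof -
  have "{{int k, - (int k + 1)} |k. block_first j r \<le> k \<and> k < block_last j r} \<union>
      {{int (block_last j r), - int (block_first j r)}} =
      (\<lambda>k. {int k, - int (block_next m j k)}) ` block j r" if r: "r \<in> {1..m}" for r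
  proof -
    have "block j r = insert (block_last j r) {k. block_first j r \<le> k \<and> k < block_last j r}"
      using block_first_le_last[OF r] by (auto simp: block_def)
    moreover have "(\<lambda>k. {int k, - int (block_next m j k)}) ` {k. block_first j r \<le> k \<and> k < block_last j r} =
        {{int k, - (int k + 1)} |k. block_first j r \<le> k \<and> k < block_last j r}"
    proof -
      have "block_next m j k = Suc k" if "block_first j r \<le> k" "k < block_last j r" for k
        using block_next_in_block(1)[OF r, of k] that by (simp add: block_def)
      then have "{int k, - int (block_next m j k)} = {int k, - (int k + 1)}"
        if "block_first j r \<le> k" "k < block_last j r" for k using that by (simp add: algebra_simps)
      then show ?thesis by (auto simp: image_def)
    qed
    moreover have "block_next m j (block_last j r) = block_first j r"
      using block_next_in_block(1)[OF r, of "block_last j r"] block_first_le_last[OF r] by (simp add: block_def)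
    ultimately show ?thesis by simp
  qed
  then have "sigma m j = (\<Union>r\<in>{1..m}. (\<lambda>k. {int k, - int (block_next m j k)}) ` block j r)"
    unfolding sigma_def by (intro SUP_cong refl) simp
  also have "\<dots> = matching_of (block_last j m) (block_next m j)"
    unfolding matching_of_def UN_blocks[OF order_refl, symmetric] by blast
  finally show ?thesis .
qed

text \<open>The sides of a block are closed under both matchings, and \<open>\<sigma>\<close> followed by \<open>\<delta>\<close> runs cyclically through
  the block, so they form a single cycle.\<close>

lemma cycles_delta_sigma:
  "cycles (delta (block_last j m)) (sigma m j) = (\<lambda>r. sides (block j r)) ` {1..m}"
proof -
  let ?n = "block_last j m" and ?\<pi> = "delta (block_last j m)" and ?\<rho> = "sigma m j" and ?q = "block_next m j"
  let ?A = "side_labels ?n"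
  have idb: "bij_betw id {1..?n} {1..?n}" by simp
  note qb = block_next_bij
  have fin: "finite ?A" by (simp add: side_labels_def)
  note pp1 = pair_partition_matching_of[OF idb, folded delta_eq_matching_of]
  note pp2 = pair_partition_matching_of[OF qb, folded sigma_eq_matching_of]
  note closed = cycles_closed[OF fin pp1 pp2 refl refl] and unique = cycles_unique[OF fin pp1 pp2 refl refl]
  note d = partner_matching_of[OF idb, folded delta_eq_matching_of, unfolded id_apply]
  note g = partner_matching_of[OF qb, folded sigma_eq_matching_of]
  have sub: "block j r \<subseteq> {1..?n}" if "r \<in> {1..m}" for r using UN_blocks[of m] that by blast
  have block_closed: "y \<in> ?A \<and> partner ?\<pi> y \<in> sides (block j r) \<and> partner ?\<rho> y \<in> sides (block j r)"
    if r: "r \<in> {1..m}" and y: "y \<in> sides (block j r)" for r y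
  proof -
    have pre: "\<exists>k'\<in>block j r. ?q k' = k" if k: "k \<in> block j r" for k
    proof -
      have "?q ` block j r \<subseteq> block j r" using block_next_in_block(2)[OF r] by blast
      moreover have "inj_on ?q (block j r)" using qb sub[OF r] by (auto simp: bij_betw_def intro: inj_on_subset)
      ultimately have "?q ` block j r = block j r" by (intro endo_inj_surj) (auto simp: block_def)
      then show ?thesis using k by (metis imageE)
    qed
    have A: "sides (block j r) \<subseteq> ?A" unfolding side_labels_eq_sides using sub[OF r] by (auto simp: sides_def)
    consider k where "k \<in> block j r" "y = int k" | k where "k \<in> block j r" "y = - int k"
      using y by (auto simp: sides_def)
    then show ?thesis
    proof cases
      case 1
      then have "k \<in> {1..?n}" using sub[OF r] by blast
      then show ?thesis using d(1) g(1) 1 y A block_next_in_block(2)[OF r 1(1)] by (auto simp: sides_def)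
    next
      case 2
      then have k: "k \<in> {1..?n}" using sub[OF r] by blast
      obtain k' where k': "k' \<in> block j r" "?q k' = k" using pre[OF 2(1)] by blast
      then have "k' \<in> {1..?n}" using sub[OF r] by blast
      then show ?thesis using d(2)[OF k] g(2)[of k'] 2 k' y A by (auto simp: sides_def)
    qed
  qed
  have eq: "C = sides (block j r)" if C: "C \<in> cycles ?\<pi> ?\<rho>" "x \<in> C" and r: "r \<in> {1..m}" "x \<in> sides (block j r)"
    for C x r
  proof
    show "C \<subseteq> sides (block j r)" by (rule unique[OF C block_closed[OF r(1)] r(2)])
    have dC: "int k \<in> C \<longleftrightarrow> - int k \<in> C" if "k \<in> block j r" for k
      using closed(2)[OF C(1), of "int k"] closed(2)[OF C(1), of "- int k"] d[of k] sub[OF r(1)] that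
      by auto
    have step: "int (?q k) \<in> C" if "int k \<in> C" "k \<in> block j r" for k
    proof -
      have "k \<in> {1..?n}" using sub[OF r(1)] that(2) by blast
      then have "- int (?q k) \<in> C" using closed(3)[OF C(1) that(1)] g(1) by simp
      then show ?thesis using dC[OF block_next_in_block(2)[OF r(1) that(2)]] by simp
    qed
    have up: "int k' \<in> C" if "int k \<in> C" "k \<in> block j r" "k \<le> k'" "k' \<le> block_last j r" for k k'
      using that(3,4)
    proof (induction k' rule: dec_induct)
      case (step k')
      then have k': "int k' \<in> C" "k' \<in> block j r" using that(2) by (auto simp: block_def)
      have "?q k' = Suc k'" using block_next_in_block(1)[OF r(1) k'(2)] step by simp
      then show ?case using \<open>\<And>k. int k \<in> C \<Longrightarrow> k \<in> block j r \<Longrightarrow> int (?q k) \<in> C\<close>[OF k'] by simp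
    qed (use that in simp)
    obtain k where k: "k \<in> block j r" "int k \<in> C" using r(2) C(2) dC by (auto simp: sides_def)
    have last: "block_last j r \<in> block j r" using block_first_le_last[OF r(1)] by (simp add: block_def)
    have "int (block_last j r) \<in> C" using up[OF k(2,1)] k(1) by (simp add: block_def)
    from step[OF this last] have first: "int (block_first j r) \<in> C"
      using block_next_in_block(1)[OF r(1) last] by simp
    have "block_first j r \<in> block j r" using block_first_le_last[OF r(1)] by (simp add: block_def)
    from up[OF first this] have "int k' \<in> C" if "k' \<in> block j r" for k' using that by (simp add: block_def)
    then show "sides (block j r) \<subseteq> C" using dC by (auto simp: sides_def)
  qed
  show ?thesis
  proof
    show "cycles ?\<pi> ?\<rho> \<subseteq> (\<lambda>r. sides (block j r)) ` {1..m}"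
    proof
      fix C assume C: "C \<in> cycles ?\<pi> ?\<rho>"
      then obtain x where x: "x \<in> C" using cycles_nonempty[OF fin pp1 pp2 refl refl C] by blast
      have "x \<in> sides {1..?n}" using closed(1)[OF C x] by (simp add: side_labels_eq_sides)
      then obtain k where k: "k \<in> {1..?n}" "x = int k \<or> x = - int k" by (auto simp: sides_def)
      obtain r where r: "r \<in> {1..m}" "k \<in> block j r" using k(1) by (rule obtain_block)
      have "x \<in> sides (block j r)" using k(2) r(2) by (auto simp: sides_def)
      from eq[OF C x r(1) this] show "C \<in> (\<lambda>r. sides (block j r)) ` {1..m}" using r(1) by blast
    qed
    show "(\<lambda>r. sides (block j r)) ` {1..m} \<subseteq> cycles ?\<pi> ?\<rho>"
    proof (rule image_subsetI)
      fix r assume r: "r \<in> {1..m}"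
      have first: "block_first j r \<in> block j r" using block_first_le_last[OF r] by (simp add: block_def)
      then have x: "int (block_first j r) \<in> sides (block j r)" by (simp add: sides_def)
      then have "int (block_first j r) \<in> ?A" using block_closed[OF r] by blast
      then obtain C where C: "C \<in> cycles ?\<pi> ?\<rho>" "int (block_first j r) \<in> C"
        using cycles_cover[OF fin pp1 pp2 refl refl] by blast
      from eq[OF C r x] show "sides (block j r) \<in> cycles ?\<pi> ?\<rho>" using C(1) by blast
    qed
  qed
qed

lemma card_black_vertices: "card (black_vertices m j) = m"
proof -
  have "inj_on (\<lambda>r. sides (block j r)) {1..m}"
  proof (rule inj_onI, rule ccontr)
    fix r r' assume r: "r \<in> {1..m}" "r' \<in> {1..m}" "sides (block j r) = sides (block j r')" "r \<noteq> r'"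
    have "block_first j r \<in> block j r" using block_first_le_last[OF r(1)] by (simp add: block_def)
    then have "int (block_first j r) \<in> sides (block j r')" using r(3) by (auto simp: sides_def)
    moreover have "block_first j r \<ge> 1" by (simp add: block_first_def)
    ultimately have "block_first j r \<in> block j r'" by (auto simp: sides_def)
    then show False using blocks_disjoint[OF r(1,2,4)] \<open>block_first j r \<in> block j r\<close> by blast
  qed
  then show ?thesis by (simp add: black_vertices_def cycles_delta_sigma card_image)
qed

lemma card_ribbons: "card (ribbons m j) = block_last j m"
proof -
  have "inj_on (\<lambda>k. {int k, - int k}) {1..block_last j m}"
    by (auto simp: inj_on_def doubleton_eq_iff)
  then show ?thesis by (simp add: ribbons_def delta_eq_matching_of matching_of_def card_image)
qed

lemma prod_of_traces:
  assumes A: "\<And>k. k \<in> {1..block_last j m} \<Longrightarrow> A k \<in> carrier_mat N N"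
  shows "(\<Prod>r=1..m. of_real (2 * qRe (qtrace (mat_prod N (map A [block_first j r..<block_last j r + 1]))))) =
    (\<Sum>\<beta>\<in>{1..block_last j m} \<rightarrow>\<^sub>E {..<N} \<times> UNIV. \<Prod>k\<in>{1..block_last j m}.
       spin_entry (A k) (\<beta> k) (\<beta> (block_next m j k)))"
proof -
  let ?S = "{..<N} \<times> (UNIV :: bool set)"
  let ?F = "\<lambda>r \<beta>. \<Prod>k\<in>block j r. spin_entry (A k) (\<beta> k) (\<beta> (block_next m j k))"
  have sub: "block j r \<subseteq> {1..block_last j m}" if "r \<in> {1..m}" for r using UN_blocks[of m] that by blast
  have "(\<Prod>r=1..m. of_real (2 * qRe (qtrace (mat_prod N (map A [block_first j r..<block_last j r + 1]))))) =
      (\<Prod>r=1..m. \<Sum>\<beta>\<in>PiE (block j r) (\<lambda>_. ?S). ?F r \<beta>)"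
  proof (intro prod.cong refl)
    fix r assume r: "r \<in> {1..m}"
    have "of_real (2 * qRe (qtrace (mat_prod N (map A [block_first j r..<block_last j r + 1])))) =
      (\<Sum>\<beta>\<in>block j r \<rightarrow>\<^sub>E ?S. \<Prod>k\<in>block j r.
         spin_entry (A k) (\<beta> k) (\<beta> (if k = block_last j r then block_first j r else Suc k)))"
      unfolding block_def using A sub[OF r] block_first_le_last[OF r]
      by (intro spin_trace_mat_prod) (auto simp: block_def)
    also have "\<dots> = (\<Sum>\<beta>\<in>block j r \<rightarrow>\<^sub>E ?S. ?F r \<beta>)"
      using block_next_in_block(1)[OF r] by (intro sum.cong prod.cong refl) simp
    finally show "of_real (2 * qRe (qtrace (mat_prod N (map A [block_first j r..<block_last j r + 1])))) =
      (\<Sum>\<beta>\<in>block j r \<rightarrow>\<^sub>E ?S. ?F r \<beta>)" .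
  qed
  also have "\<dots> = (\<Sum>\<beta>\<in>PiE (\<Union>r\<in>{1..m}. block j r) (\<lambda>_. ?S). \<Prod>r=1..m. ?F r (restrict \<beta> (block j r)))"
    using blocks_disjoint by (intro prod_sum_PiE_blocks) auto
  also have "\<dots> = (\<Sum>\<beta>\<in>PiE (\<Union>r\<in>{1..m}. block j r) (\<lambda>_. ?S). \<Prod>k\<in>(\<Union>r\<in>{1..m}. block j r).
       spin_entry (A k) (\<beta> k) (\<beta> (block_next m j k)))"
  proof (intro sum.cong refl)
    fix \<beta> :: "nat \<Rightarrow> nat \<times> bool"
    have "(\<Prod>r=1..m. ?F r (restrict \<beta> (block j r))) = (\<Prod>r=1..m. ?F r \<beta>)"
      using block_next_in_block(2) by (intro prod.cong refl) simp
    also have "\<dots> = (\<Prod>k\<in>(\<Union>r\<in>{1..m}. block j r). spin_entry (A k) (\<beta> k) (\<beta> (block_next m j k)))"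
      using blocks_disjoint by (intro prod.UNION_disjoint[symmetric]) (auto simp: block_def)
    finally show "(\<Prod>r=1..m. ?F r (restrict \<beta> (block j r))) = \<dots>" .
  qed
  finally show ?thesis unfolding UN_blocks[OF order_refl] .
qed

end

section \<open>The genus expansion\<close>

lemma card_Diff_commute:
  assumes "finite X" "finite Y" "card X = card Y"
  shows "card (X - Y) = card (Y - X)"
proof -
  have "card X = card (X \<inter> Y) + card (X - Y)" "card Y = card (Y \<inter> X) + card (Y - X)"
    using assms(1,2) by (metis card_Int_Diff)+
  then show ?thesis using assms(3) by (simp add: Int_commute)
qed

lemma colored_moebius_graphs_eq:
  "colored_moebius_graphs m j t = pairings (side_labels (block_last j m)) (side_color t)"
  by (simp add: colored_moebius_graphs_def moebius_graphs_def pairings_def)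

lemma quat_wishart_carrier:
  assumes "quat_wishart P N M W" "\<omega> \<in> space P"
  shows "W \<omega> \<in> carrier_mat N N"
proof -
  obtain X where "X \<omega> \<in> carrier_mat M N" "W \<omega> = qadjoint (X \<omega>) * X \<omega>"
    using assms unfolding quat_wishart_def quat_gaussian_matrix_def by blast
  then show ?thesis by (auto simp: qadjoint_def)
qed

text \<open>Wick's formula in the spin basis.  Here \<open>a x\<close> and \<open>b x\<close> are the row and column index at side \<open>x\<close> and
  \<open>clr x\<close> is the color of its matrix.  For each pairing the contributions of row and column indices
  separate.\<close>

lemma wick_spin:
  fixes a b :: "int \<Rightarrow> nat \<times> bool"
  assumes A: "finite A"
    and F: "\<And>\<gamma>. pair_partition A \<gamma> \<Longrightarrow> transversal A (partner \<gamma>) (F \<gamma>)"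
  shows "(\<Sum>u\<in>A \<rightarrow>\<^sub>E {0..3}. (\<Prod>x\<in>A. qunit (u x) (snd (a x)) (snd (b x))) *
      of_nat (card (pairings A (\<lambda>x. (clr x, (fst (a x), fst (b x)), u x))))) =
    (\<Sum>\<gamma>\<in>pairings A clr. 2 ^ card (F \<gamma>) *
      ((\<Prod>x\<in>F \<gamma>. spin_form (a x) (a (partner \<gamma> x))) * (\<Prod>x\<in>F \<gamma>. spin_form (b x) (b (partner \<gamma> x)))))"
proof -
  let ?p = "\<lambda>\<gamma> x. spin_form (a x) (a (partner \<gamma> x)) * spin_form (b x) (b (partner \<gamma> x))"
  let ?key = "\<lambda>x. (clr x, (fst (a x), fst (b x)))"
  let ?K = "pairings A ?key" and ?C = "pairings A clr"
  have "pairings A (\<lambda>x. (clr x, (fst (a x), fst (b x)), u x)) =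
      pairings A (\<lambda>x. (?key x, u x))" for u :: "int \<Rightarrow> nat"
    by (simp add: pairings_def)
  then have "(\<Sum>u\<in>A \<rightarrow>\<^sub>E {0..3}. (\<Prod>x\<in>A. qunit (u x) (snd (a x)) (snd (b x))) *
      of_nat (card (pairings A (\<lambda>x. (clr x, (fst (a x), fst (b x)), u x))))) =
    (\<Sum>\<gamma>\<in>?K. \<Prod>x\<in>F \<gamma>. \<Sum>e\<in>{0..3}. qunit e (snd (a x)) (snd (b x)) *
       qunit e (snd (a (partner \<gamma> x))) (snd (b (partner \<gamma> x))))"
    using wick[OF A, of "{0..3}" F "\<lambda>x e. qunit e (snd (a x)) (snd (b x))" ?key] F by simp
  also have "\<dots> = (\<Sum>\<gamma>\<in>?K. \<Prod>x\<in>F \<gamma>. 2 * ?p \<gamma> x)"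
  proof (intro sum.cong prod.cong refl)
    fix \<gamma> x assume \<gamma>: "\<gamma> \<in> ?K" and x: "x \<in> F \<gamma>"
    have pp: "pair_partition A \<gamma>" using \<gamma> by (simp add: pairings_def)
    have "x \<in> A" using transversalD(1)[OF F[OF pp] x] .
    from pairings_eq[OF \<gamma> partner_mem[OF pp this]]
    have "fst (a (partner \<gamma> x)) = fst (a x)" "fst (b (partner \<gamma> x)) = fst (b x)" by simp_all
    then show "(\<Sum>e\<in>{0..3}. qunit e (snd (a x)) (snd (b x)) *
       qunit e (snd (a (partner \<gamma> x))) (snd (b (partner \<gamma> x)))) =
       2 * ?p \<gamma> x"
      unfolding qunit_completeness by (simp add: spin_form_def flip_def prod_eq_iff)
  qed
  \<comment> \<open>Equality of the quaternionic indices may be dropped as a condition on the pairing: \<open>spin_form\<close> enforces it.\<close>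
  also have "\<dots> = (\<Sum>\<gamma>\<in>?C. \<Prod>x\<in>F \<gamma>. 2 * ?p \<gamma> x)"
  proof (rule sum.mono_neutral_left)
    show "finite ?C" by (rule finite_pairings[OF A])
    show "?K \<subseteq> ?C" by (auto simp: pairings_def)
    show "\<forall>\<gamma>\<in>?C - ?K. (\<Prod>x\<in>F \<gamma>. 2 * ?p \<gamma> x) = 0"
    proof (rule ballI, rule ccontr)
      fix \<gamma> assume \<gamma>: "\<gamma> \<in> ?C - ?K"
        and nz: "(\<Prod>x\<in>F \<gamma>. 2 * ?p \<gamma> x) \<noteq> 0"
      have pp: "pair_partition A \<gamma>" using \<gamma> by (simp add: pairings_def)
      note Fg = F[OF pp]
      have "F \<gamma> \<subseteq> A" using Fg by (simp add: transversal_def)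
      then have finF: "finite (F \<gamma>)" using A finite_subset by blast
      have key: "?key (partner \<gamma> x) = ?key x" if x: "x \<in> F \<gamma>" for x
      proof -
        have "spin_form (a x) (a (partner \<gamma> x)) \<noteq> 0" "spin_form (b x) (b (partner \<gamma> x)) \<noteq> 0"
          using nz x finF by (auto simp: prod_zero_iff)
        then have "fst (a (partner \<gamma> x)) = fst (a x)" "fst (b (partner \<gamma> x)) = fst (b x)"
          by (auto simp: spin_form_def split: if_splits)
        moreover have "x \<in> A" using transversalD(1)[OF Fg x] .
        moreover have "\<gamma> \<in> ?C" using \<gamma> by blast
        ultimately show ?thesis using pairings_eq[of \<gamma> A clr x "partner \<gamma> x"] partner_mem[OF pp]
          by simp
      qed
      have "\<forall>p\<in>\<gamma>. \<forall>x\<in>p. \<forall>y\<in>p. ?key x = ?key y"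
      proof
        fix p assume "p \<in> \<gamma>"
        then obtain x where "x \<in> F \<gamma>" "p = {x, partner \<gamma> x}"
          using pair_partition_transversal[OF pp Fg] unfolding bij_betw_def by blast
        then show "\<forall>x\<in>p. \<forall>y\<in>p. ?key x = ?key y" using key[of x] by simp
      qed
      with pp have "\<gamma> \<in> ?K" unfolding pairings_def mem_Collect_eq by (rule conjI)
      then show False using \<gamma> by blast
    qed
  qed
  finally show ?thesis by (simp only: prod.distrib prod_constant)
qed

lemma prod_white_vertices:
  fixes h :: "nat \<Rightarrow> 'c :: comm_semiring_1"
  assumes t: "\<And>k. k \<in> {1..block_last j m} \<Longrightarrow> t k \<in> {1..s}"
    and \<gamma>: "\<gamma> \<in> colored_moebius_graphs m j t"
  shows "\<And>C x. C \<in> white_vertices m j \<gamma> \<Longrightarrow> x \<in> C \<Longrightarrow> side_color t x = side_color t (SOME x. x \<in> C)"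
    and "(\<Prod>C\<in>white_vertices m j \<gamma>. h (side_color t (SOME x. x \<in> C))) =
      (\<Prod>l=1..s. h l ^ card (white_vertices_of_color m j t \<gamma> l))"
proof -
  let ?n = "block_last j m"
  let ?A = "side_labels ?n" and ?c = "\<lambda>C. side_color t (SOME x. x \<in> C)"
  have fin: "finite ?A" by (simp add: side_labels_def)
  have pp: "pair_partition ?A \<gamma>" using \<gamma> by (simp add: colored_moebius_graphs_eq pairings_def)
  have idb: "bij_betw id {1..?n} {1..?n}" by simp
  note pd = pair_partition_matching_of[OF idb, folded delta_eq_matching_of]
  note nonempty = cycles_nonempty[OF fin pd pp refl refl, folded white_vertices_def]
    and closed = cycles_closed[OF fin pd pp refl refl, folded white_vertices_def]
  have inv: "side_color t (partner (delta ?n) z) = side_color t z \<and> side_color t (partner \<gamma> z) = side_color t z"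
    if z: "z \<in> ?A" for z
  proof
    obtain k where k: "k \<in> {1..?n}" "z = int k \<or> z = - int k"
      using z by (auto simp: side_labels_eq_sides sides_def)
    then show "side_color t (partner (delta ?n) z) = side_color t z"
      using partner_matching_of[OF idb k(1), folded delta_eq_matching_of] by (auto simp: side_color_def)
    show "side_color t (partner \<gamma> z) = side_color t z"
      using pairings_eq[OF \<gamma>[unfolded colored_moebius_graphs_eq] partner_mem[OF pp z]] by simp
  qed
  show col: "side_color t x = ?c C" if C: "C \<in> white_vertices m j \<gamma>" "x \<in> C" for C x
  proof -
    have "(SOME x. x \<in> C) \<in> C" using C(2) by (rule someI)
    then show ?thesis
      using cycles_connected[OF fin pd pp refl refl C(1)[unfolded white_vertices_def] C(2), of _ "side_color t"] inv
      by blast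
  qed
  have wv: "white_vertices_of_color m j t \<gamma> l = {C \<in> white_vertices m j \<gamma>. ?c C = l}" for l
  proof -
    have "(\<forall>x\<in>C. side_color t x = l) \<longleftrightarrow> ?c C = l" if C: "C \<in> white_vertices m j \<gamma>" for C
    proof -
      obtain x where "x \<in> C" using nonempty[OF C] by blast
      then show ?thesis using col[OF C] by metis
    qed
    then show ?thesis unfolding white_vertices_of_color_def by blast
  qed
  have finW: "finite (white_vertices m j \<gamma>)"
    unfolding white_vertices_def by (rule finite_cycles[OF fin pd pp refl refl])
  have range: "?c ` white_vertices m j \<gamma> \<subseteq> {1..s}"
  proof (rule image_subsetI)
    fix C assume C: "C \<in> white_vertices m j \<gamma>"
    then obtain x where x: "x \<in> C" using nonempty by blast
    then have "x \<in> ?A" using closed(1)[OF C] by blast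
    then have "nat \<bar>x\<bar> \<in> {1..?n}" by (auto simp: side_labels_def)
    then show "?c C \<in> {1..s}" using t col[OF C x] unfolding side_color_def by metis
  qed
  have "(\<Prod>C\<in>white_vertices m j \<gamma>. h (?c C)) =
      (\<Prod>l=1..s. \<Prod>C\<in>{C \<in> white_vertices m j \<gamma>. ?c C = l}. h (?c C))"
    using prod.group[OF finW _ range, of "\<lambda>C. h (?c C)"] by simp
  also have "\<dots> = (\<Prod>l=1..s. h l ^ card (white_vertices_of_color m j t \<gamma> l))"
    unfolding wv by (intro prod.cong refl) simp
  finally show "(\<Prod>C\<in>white_vertices m j \<gamma>. h (?c C)) = \<dots>" .
qed

text \<open>For each pairing, \<open>spin_sum_edges\<close> evaluates the row and the column indices.  The pairs of \<open>\<gamma>\<close> are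
  oriented by \<open>F \<gamma>\<close>, which orients \<open>\<delta>\<close> as well, while \<open>\<delta>\<close> and \<open>\<sigma>\<close> are oriented by the positive sides in
  the expansion; \<open>three_matchings_parity\<close> combines the resulting signs.\<close>

theorem expected_product_of_real_traces:
  fixes P :: "'a measure" and j t M :: "nat \<Rightarrow> nat"
  assumes P: "prob_space P" and j: "\<forall>r\<in>{1..m}. j r \<ge> 1" and n: "n = block_last j m"
    and W: "\<And>l. l \<in> {1..s} \<Longrightarrow> quat_wishart P N (M l) (W l)" and ind: "indep_matrices P N W {1..s}"
    and t: "\<And>k. k \<in> {1..n} \<Longrightarrow> t k \<in> {1..s}"
  shows "has_bochner_integral P
    (\<lambda>\<omega>. \<Prod>r=1..m. 2 * qRe (qtrace (mat_prod N (map (\<lambda>k. W (t k) \<omega>) [block_first j r..<block_last j r + 1]))))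
    (\<Sum>\<gamma>\<in>colored_moebius_graphs m j t. 2 ^ n * (- 1) ^ (n + m + card (white_vertices m j \<gamma>) + card (faces m j \<gamma>)) *
       (\<Prod>l=1..s. (2 * real (M l)) ^ card (white_vertices_of_color m j t \<gamma> l)) *
       (2 * real N) ^ card (faces m j \<gamma>))"
    (is "has_bochner_integral P ?prod ?rhs")
proof -
  interpret prob_space P by (rule P)
  let ?A = "side_labels n" and ?q = "block_next m j" and ?S = "{..<N} \<times> (UNIV :: bool set)"
  let ?P = "int ` {1..n}" and ?C = "colored_moebius_graphs m j t"
  let ?w = "\<lambda>\<gamma>. card (white_vertices m j \<gamma>)" and ?f = "\<lambda>\<gamma>. card (faces m j \<gamma>)"
  let ?\<delta> = "delta n" and ?\<sigma> = "sigma m j"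
  have idb: "bij_betw id {1..n} {1..n}" by simp
  note qb = block_next_bij[OF j, folded n]
  note \<delta>_eq = delta_eq_matching_of[of n] and \<sigma>_eq = sigma_eq_matching_of[OF j, folded n]
  note pd = pair_partition_matching_of[OF idb, folded \<delta>_eq]
  note ps = pair_partition_matching_of[OF qb, folded \<sigma>_eq]
  note Pd = transversal_matching_of[OF idb, folded \<delta>_eq]
  note Ps = transversal_matching_of[OF qb, folded \<sigma>_eq]
  have finA: "finite ?A" by (simp add: side_labels_def)
  have C_eq: "?C = pairings ?A (side_color t)" by (simp add: colored_moebius_graphs_eq n)
  have pg: "pair_partition ?A \<gamma>" if "\<gamma> \<in> ?C" for \<gamma>
    using that by (simp add: C_eq pairings_def)
  define F where "F \<gamma> = (SOME F. transversal ?A (partner ?\<delta>) F \<and> transversal ?A (partner \<gamma>) F)" for \<gamma>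
  have F: "transversal ?A (partner ?\<delta>) (F \<gamma>)" "transversal ?A (partner \<gamma>) (F \<gamma>)"
    if "pair_partition ?A \<gamma>" for \<gamma>
  proof -
    have "\<exists>F. transversal ?A (partner ?\<delta>) F \<and> transversal ?A (partner \<gamma>) F"
      using common_transversal[OF finA pd that refl refl] by blast
    from someI_ex[OF this] show "transversal ?A (partner ?\<delta>) (F \<gamma>)" "transversal ?A (partner \<gamma>) (F \<gamma>)"
      by (simp_all add: F_def)
  qed
  have cardP: "card ?P = n" by (simp add: card_image)
  have cardF: "card X = n" if "matching_on ?A d" "transversal ?A d X" for d X
    using card_transversal[OF that finA] card_transversal[OF matching_on_partner[OF pd] Pd finA] cardP by simp
  have qmem: "?q k \<in> {1..n}" if "k \<in> {1..n}" for k using qb that bij_betwE by blast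
  \<comment> \<open>The composition with \<open>id\<close> gives both families of indices the form required by \<open>spin_sum_edges\<close>.\<close>
  let ?a = "\<lambda>\<alpha>. side_val \<alpha> (\<alpha> \<circ> id)" and ?b = "\<lambda>\<beta>. side_val \<beta> (\<beta> \<circ> ?q)"
  let ?B = "{1..n} \<rightarrow>\<^sub>E ?S"
  let ?D = "PiE {1..n} (\<lambda>k. {..<M (t k)} \<times> (UNIV :: bool set))"
  let ?s = "\<lambda>\<beta>. \<Prod>k\<in>{1..n}. spin_sign (snd (\<beta> k))"
  let ?pa = "\<lambda>\<gamma> \<alpha>. \<Prod>x\<in>F \<gamma>. spin_form (?a \<alpha> x) (?a \<alpha> (partner \<gamma> x))"
  let ?pb = "\<lambda>\<gamma> \<beta>. \<Prod>x\<in>F \<gamma>. spin_form (?b \<beta> x) (?b \<beta> (partner \<gamma> x))"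
  let ?c = "\<lambda>\<alpha> \<beta> u. of_nat (card (pairings ?A
      (\<lambda>x. (side_color t x, (fst (?a \<alpha> x), fst (?b \<beta> x)), u x)))) :: complex"
  let ?ww = "\<lambda>\<alpha> \<beta> u. wishart_weight {1..n} \<beta> (\<beta> \<circ> ?q) \<alpha> u"
  let ?Sa = "\<lambda>\<gamma>. \<Sum>\<alpha>\<in>?D. ?s \<alpha> * ?pa \<gamma> \<alpha>"
  let ?Sb = "\<lambda>\<gamma>. \<Sum>\<beta>\<in>?B. ?s \<beta> * ?pb \<gamma> \<beta>"
  have "has_bochner_integral P
    (\<lambda>\<omega>. \<Sum>\<beta>\<in>?B. \<Prod>k\<in>{1..n}. spin_entry (W (t k) \<omega>) (\<beta> k) ((\<beta> \<circ> ?q) k))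
    (\<Sum>\<beta>\<in>?B. \<Sum>\<alpha>\<in>?D. \<Sum>u\<in>?A \<rightarrow>\<^sub>E {0..3}. ?ww \<alpha> \<beta> u * ?c \<alpha> \<beta> u)"
  proof (rule has_bochner_integral_sum)
    fix \<beta> assume \<beta>: "\<beta> \<in> ?B"
    have "fst (\<beta> k) < N" if "k \<in> {1..n}" for k using PiE_mem[OF \<beta> that] by auto
    then have "\<And>k. k \<in> {1..n} \<Longrightarrow> fst (\<beta> k) < N" "\<And>k. k \<in> {1..n} \<Longrightarrow> fst ((\<beta> \<circ> ?q) k) < N"
      using qmem by simp_all
    moreover have "t ` {1..n} \<subseteq> {1..s}" using t by blast
    ultimately show "has_bochner_integral P
      (\<lambda>\<omega>. \<Prod>k\<in>{1..n}. spin_entry (W (t k) \<omega>) (\<beta> k) ((\<beta> \<circ> ?q) k))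
      (\<Sum>\<alpha>\<in>?D. \<Sum>u\<in>?A \<rightarrow>\<^sub>E {0..3}. ?ww \<alpha> \<beta> u * ?c \<alpha> \<beta> u)"
      using wishart_joint_moments[OF finite_atLeastAtMost W ind, of "{1..n}" t \<beta> "\<beta> \<circ> ?q"]
      by (simp only: comp_id side_color_def side_labels_eq_sides) simp
  qed
  moreover have "(\<Sum>\<beta>\<in>?B. \<Prod>k\<in>{1..n}. spin_entry (W (t k) \<omega>) (\<beta> k) ((\<beta> \<circ> ?q) k)) = of_real (?prod \<omega>)"
    if \<omega>: "\<omega> \<in> space P" for \<omega>
  proof -
    have "W (t k) \<omega> \<in> carrier_mat N N" if "k \<in> {1..block_last j m}" for k
      using quat_wishart_carrier[OF W[OF t] \<omega>] that n by simp
    from prod_of_traces[OF j this] show ?thesis by (simp only: of_real_prod n o_apply)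
  qed
  moreover have "(\<Sum>\<beta>\<in>?B. \<Sum>\<alpha>\<in>?D. \<Sum>u\<in>?A \<rightarrow>\<^sub>E {0..3}. ?ww \<alpha> \<beta> u * ?c \<alpha> \<beta> u) =
      (\<Sum>\<gamma>\<in>?C. 2 ^ n * (?Sa \<gamma> * ?Sb \<gamma>))" (is "?lhs = _")
  proof -
    have inner: "(\<Sum>u\<in>?A \<rightarrow>\<^sub>E {0..3}. ?ww \<alpha> \<beta> u * ?c \<alpha> \<beta> u) =
       (\<Sum>\<gamma>\<in>?C. 2 ^ n * ((?s \<alpha> * ?pa \<gamma> \<alpha>) *
          (?s \<beta> * ?pb \<gamma> \<beta>)))" for \<alpha> \<beta>
    proof -
      have "(\<Sum>u\<in>?A \<rightarrow>\<^sub>E {0..3}. ?ww \<alpha> \<beta> u * ?c \<alpha> \<beta> u) =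
       (?s \<alpha> * ?s \<beta>) * (\<Sum>u\<in>?A \<rightarrow>\<^sub>E {0..3}. (\<Prod>x\<in>?A. qunit (u x) (snd (?a \<alpha> x)) (snd (?b \<beta> x))) *
       ?c \<alpha> \<beta> u)"
        by (simp only: wishart_weight_def sum_distrib_left prod.distrib side_labels_eq_sides[symmetric]
            mult.assoc comp_id)
      also have "\<dots> = (?s \<alpha> * ?s \<beta>) * (\<Sum>\<gamma>\<in>?C. 2 ^ card (F \<gamma>) *
        (?pa \<gamma> \<alpha> * ?pb \<gamma> \<beta>))"
        unfolding C_eq by (subst wick_spin[OF finA F(2)]) auto
      also have "\<dots> = (\<Sum>\<gamma>\<in>?C. 2 ^ n * ((?s \<alpha> * ?pa \<gamma> \<alpha>) *
          (?s \<beta> * ?pb \<gamma> \<beta>)))"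
        unfolding sum_distrib_left
      proof (intro sum.cong refl)
        fix \<gamma> assume "\<gamma> \<in> ?C"
        then have "card (F \<gamma>) = n" using cardF matching_on_partner[OF pg] F(2)[OF pg] by blast
        then show "?s \<alpha> * ?s \<beta> * (2 ^ card (F \<gamma>) * (?pa \<gamma> \<alpha> *
            ?pb \<gamma> \<beta>)) =
          2 ^ n * ((?s \<alpha> * ?pa \<gamma> \<alpha>) *
          (?s \<beta> * ?pb \<gamma> \<beta>))" by (simp only: mult_ac)
      qed
      finally show ?thesis .
    qed
    have "?lhs = (\<Sum>\<beta>\<in>?B. \<Sum>\<gamma>\<in>?C. \<Sum>\<alpha>\<in>?D. 2 ^ n * ((?s \<alpha> * ?pa \<gamma> \<alpha>) *
          (?s \<beta> * ?pb \<gamma> \<beta>)))"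
      unfolding inner by (intro sum.cong refl sum.swap)
    also have "\<dots> = (\<Sum>\<gamma>\<in>?C. \<Sum>\<beta>\<in>?B. \<Sum>\<alpha>\<in>?D. 2 ^ n * ((?s \<alpha> * ?pa \<gamma> \<alpha>) *
          (?s \<beta> * ?pb \<gamma> \<beta>)))"
      by (rule sum.swap)
    also have "\<dots> = (\<Sum>\<gamma>\<in>?C. 2 ^ n * (?Sa \<gamma> * ?Sb \<gamma>))"
      by (simp only: sum_distrib_left[symmetric] sum_distrib_right[symmetric])
    finally show ?thesis .
  qed
  moreover have "2 ^ n * (?Sa \<gamma> * ?Sb \<gamma>) =
      of_real (2 ^ n * (- 1) ^ (n + m + ?w \<gamma> + ?f \<gamma>) *
       (\<Prod>l=1..s. (2 * real (M l)) ^ card (white_vertices_of_color m j t \<gamma> l)) *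
       (2 * real N) ^ card (faces m j \<gamma>))" if \<gamma>: "\<gamma> \<in> ?C" for \<gamma>
  proof -
    note pp = pg[OF \<gamma>] and mg = matching_on_partner[OF pg[OF \<gamma>]]
    obtain G where G: "transversal ?A (partner ?\<sigma>) G" "transversal ?A (partner \<gamma>) G"
      using common_transversal[OF finA ps pp refl refl] by blast
    note cycle_color = prod_white_vertices[of j m t s \<gamma>, folded n, OF t \<gamma>]
    have Sa: "?Sa \<gamma> = (- 1) ^ (card (?P - F \<gamma>) + card (F \<gamma> - F \<gamma>)) *
        (\<Prod>C\<in>cycles ?\<delta> \<gamma>. of_nat (2 * card {..<M (side_color t (SOME x. x \<in> C))}))"
      unfolding \<delta>_eq
    proof (rule spin_sum_edges[OF idb pp F(1)[OF pp, unfolded \<delta>_eq] F(2)[OF pp] F(2)[OF pp],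
          where Rs = "\<lambda>x. {..<M (side_color t x)}"])
      fix C x assume "C \<in> cycles (matching_of n id) \<gamma>" "x \<in> C"
      then have "side_color t x = side_color t (SOME x. x \<in> C)"
        by (intro cycle_color(1)) (simp_all add: white_vertices_def n delta_eq_matching_of)
      then show "{..<M (side_color t x)} = {..<M (side_color t (SOME x. x \<in> C))}" by simp
    qed (simp_all add: side_color_def)
    have Sb: "?Sb \<gamma> = (- 1) ^ (card (?P - G) + card (F \<gamma> - G)) *
        (\<Prod>C\<in>cycles ?\<sigma> \<gamma>. of_nat (2 * card {..<N}))"
      unfolding \<sigma>_eq
      by (rule spin_sum_edges[OF qb pp G(1)[unfolded \<sigma>_eq] G(2) F(2)[OF pp], where Rs = "\<lambda>_. {..<N}"]) simp_all
    have cP: "card (F \<gamma>) = n" "card G = n" using cardF mg F(2)[OF pp] G(2) by blast+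
    have finite: "finite (F \<gamma>)" "finite G"
      using F(1)[OF pp] G(1) finA finite_subset unfolding transversal_def by blast+
    have "(- 1 :: int) ^ (card ?P + m + card (cycles ?\<delta> \<gamma>) + card (cycles ?\<sigma> \<gamma>)) =
        (- 1) ^ (card (F \<gamma> - ?P) + card (?P - G) + card (G - F \<gamma>))"
    proof (rule three_matchings_parity[OF finA matching_on_partner[OF pd] matching_on_partner[OF ps] mg
          Pd Ps F[OF pp] G])
      show "card (invariant_colorings ?A (partner ?\<delta>) (partner ?\<sigma>)) = 2 ^ m"
        using card_invariant_colorings[OF finA pd ps refl refl] card_black_vertices[OF j]
        by (simp add: black_vertices_def n)
    qed (use card_invariant_colorings[OF finA _ _ refl refl] pd ps pp in blast)+
    then have "(- 1 :: int) ^ (n + m + ?w \<gamma> + ?f \<gamma>) =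
        (- 1) ^ (card (?P - F \<gamma>) + card (?P - G) + card (F \<gamma> - G))"
      using card_Diff_commute[of "F \<gamma>" ?P] card_Diff_commute[of "F \<gamma>" G] finite cP cardP
      by (simp add: white_vertices_def faces_def n)
    then have "of_int ((- 1 :: int) ^ (n + m + ?w \<gamma> + ?f \<gamma>)) =
        (of_int ((- 1) ^ (card (?P - F \<gamma>) + card (?P - G) + card (F \<gamma> - G))) :: complex)"
      by (simp only:)
    then have sign: "(- 1 :: complex) ^ (n + m + ?w \<gamma> + ?f \<gamma>) =
        (- 1) ^ (card (?P - F \<gamma>) + card (?P - G) + card (F \<gamma> - G))"
      by simp
    have "(\<Prod>C\<in>cycles ?\<delta> \<gamma>. of_nat (2 * card {..<M (side_color t (SOME x. x \<in> C))}) :: complex) =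
        (\<Prod>l=1..s. (of_nat (2 * M l)) ^ card (white_vertices_of_color m j t \<gamma> l))"
      using cycle_color(2)[of "\<lambda>l. of_nat (2 * M l) :: complex"] by (simp add: white_vertices_def n)
    note white = this
    have faces: "(\<Prod>C\<in>cycles ?\<sigma> \<gamma>. of_nat (2 * card {..<N}) :: complex) = of_nat (2 * N) ^ card (faces m j \<gamma>)"
      by (simp add: faces_def)
    have s: "(- 1 :: complex) ^ (card (?P - F \<gamma>) + card (F \<gamma> - F \<gamma>)) * (- 1) ^ (card (?P - G) + card (F \<gamma> - G)) =
        (- 1) ^ (n + m + ?w \<gamma> + ?f \<gamma>)"
      unfolding sign by (simp add: power_add)
    have "2 ^ n * (?Sa \<gamma> * ?Sb \<gamma>) = 2 ^ n * (- 1) ^ (n + m + ?w \<gamma> + ?f \<gamma>) *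
        (\<Prod>l=1..s. (of_nat (2 * M l)) ^ card (white_vertices_of_color m j t \<gamma> l)) *
        of_nat (2 * N) ^ card (faces m j \<gamma>)"
      unfolding Sa Sb white faces s[symmetric] by (simp only: mult_ac)
    then show ?thesis by simp
  qed
  ultimately have "has_bochner_integral P (\<lambda>\<omega>. of_real (?prod \<omega>)) (of_real ?rhs :: complex)"
    by (simp only: of_real_sum cong: has_bochner_integral_cong sum.cong)
  from has_bochner_integral_bounded_linear[OF bounded_linear_Re this]
  show ?thesis by (simp only: Re_complex_of_real)
qed

text \<open>Bookkeeping of the powers: \<open>w\<close>, \<open>f\<close> are the numbers of white vertices and faces, \<open>m + d\<close> is the number
  of edges, and the factor \<open>1 / 2 ^ m\<close> stems from \<open>Re q\<close> being half the trace of the matrix of \<open>q\<close>.\<close>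

lemma genus_weight:
  fixes N p :: real
  assumes "N > 0"
  shows "1 / (4 * N) ^ d * (1 / 2 ^ m * (2 ^ (m + d) * (- 1) ^ (m + d + m + w + f) * (2 ^ w * p) * (2 * N) ^ f)) =
    p / N ^ w * (- 2 * N) powi (int (m + w) - int (m + d) + int f)"
proof -
  have pow_diff: "(- 2 * N) powi (int a - int b) = (- 2 * N) ^ a / (- 2 * N) ^ b" for a b
    using assms by (simp add: power_int_diff)
  have "int (m + w) - int (m + d) + int f = int (w + f) - int d" by simp
  then have "(- 2 * N) powi (int (m + w) - int (m + d) + int f) = (- 2 * N) ^ (w + f) / (- 2 * N) ^ d"
    using assms by (simp only: pow_diff)
  also have "\<dots> = (- 1) ^ (w + f) * 2 ^ (w + f) * N ^ (w + f) / ((- 1) ^ d * (2 * N) ^ d)"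
    by (simp only: power_mult_distrib[symmetric]) simp
  finally have e: "(- 2 * N) powi (int (m + w) - int (m + d) + int f) = \<dots>" .
  have four: "(4 * N) ^ d = 2 ^ d * (2 * N) ^ d" by (simp only: power_mult_distrib[symmetric]) simp
  have neg: "x / ((- 1) ^ d * y) = (- 1) ^ d * x / y" for x y :: real
    by (cases "even d") simp_all
  have sgn: "(- 1 :: real) ^ (m + d + m + w + f) = (- 1) ^ d * (- 1) ^ (w + f)"
  proof -
    have "m + d + m + w + f = (m + m) + (d + (w + f))" by simp
    then show ?thesis by (simp only: power_add) (simp flip: power_add)
  qed
  show ?thesis
    unfolding e four neg sgn using assms by (simp add: field_simps power_add power_mult_distrib)
qed

section \<open>Powers of a single Wishart matrix\<close>

lemma qcnj_mult: "qcnj (x * y) = qcnj y * qcnj x"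
  by (simp add: qcnj_def times_quat_def)

lemma qcnj_qcnj [simp]: "qcnj (qcnj x) = x"
  by (simp add: qcnj_def)

lemma qcnj_add: "qcnj (x + y) = qcnj x + qcnj y" and qcnj_0 [simp]: "qcnj 0 = 0"
  by (simp_all add: qcnj_def zero_quat_def plus_quat_def)

lemma qcnj_sum: "qcnj (\<Sum>x\<in>A. f x) = (\<Sum>x\<in>A. qcnj (f x))"
  by (induction A rule: infinite_finite_induct)
     (simp_all add: qcnj_add)

lemma of_real_quat: "of_real r = Quat r 0 0 0"
  by (simp add: of_real_def scaleR_quat_def one_quat_def)

lemma qcnj_fixed: "qcnj q = q \<Longrightarrow> q = of_real (qRe q)"
  by (simp add: qcnj_def of_real_quat quat_eq_iff)

lemma qadjoint_mult:
  assumes "A \<in> carrier_mat m n" "B \<in> carrier_mat n l"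
  shows "qadjoint (A * B) = qadjoint B * qadjoint A"
  using assms by (intro eq_matI)
    (auto simp: qadjoint_def scalar_prod_def qcnj_sum qcnj_mult intro!: sum.cong)

lemma qadjoint_qadjoint: "qadjoint (qadjoint A) = A"
  by (intro eq_matI) (auto simp: qadjoint_def)

lemma pow_mat_Suc_left:
  fixes A :: "'b :: semiring_1 mat"
  assumes A: "A \<in> carrier_mat n n"
  shows "A ^\<^sub>m Suc k = A * A ^\<^sub>m k"
proof (induction k)
  case (Suc k)
  have "A ^\<^sub>m Suc (Suc k) = A * A ^\<^sub>m k * A" using Suc by simp
  also have "\<dots> = A * (A ^\<^sub>m k * A)"
    by (rule assoc_mult_mat[OF A pow_carrier_mat[OF A] A])
  finally show ?case by simp
qed (use A in simp)

lemma pow_mat_eq_mat_prod: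
  assumes "A \<in> carrier_mat N N"
  shows "A ^\<^sub>m k = mat_prod N (replicate k A)"
proof (induction k)
  case 0
  then show ?case using assms by (simp add: mat_prod_def)
next
  case (Suc k)
  then show ?case unfolding pow_mat_Suc_left[OF assms] by (simp add: mat_prod_Cons)
qed

text \<open>Powers of a self-adjoint matrix are self-adjoint, so their diagonal entries equal their conjugates.\<close>

lemma qtrace_power_real:
  assumes A: "A \<in> carrier_mat N N" and herm: "qadjoint A = A"
  shows "qtrace (A ^\<^sub>m k) = of_real (qRe (qtrace (A ^\<^sub>m k)))"
proof -
  have "qadjoint (A ^\<^sub>m k) = A ^\<^sub>m k"
  proof (induction k)
    case 0
    show ?case using A by (intro eq_matI) (auto simp: qadjoint_def one_mat_def qcnj_def one_quat_def zero_quat_def)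
  next
    case (Suc k)
    have "qadjoint (A ^\<^sub>m Suc k) = A * A ^\<^sub>m k"
      using qadjoint_mult[OF pow_carrier_mat[OF A] A] Suc herm by simp
    then show ?case using pow_mat_Suc_left[OF A] by simp
  qed
  moreover have "A ^\<^sub>m k \<in> carrier_mat N N" using A by simp
  ultimately have "qcnj ((A ^\<^sub>m k) $$ (a, a)) = (A ^\<^sub>m k) $$ (a, a)" if "a < N" for a
    using that by (metis (no_types, lifting) carrier_matD case_prod_conv index_mat(1) qadjoint_def)
  then have "qcnj (qtrace (A ^\<^sub>m k)) = qtrace (A ^\<^sub>m k)"
    using \<open>A ^\<^sub>m k \<in> carrier_mat N N\<close> by (auto simp: qtrace_def qcnj_sum intro!: sum.cong)
  then show ?thesis by (rule qcnj_fixed)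
qed

lemma wishart_hermitian:
  assumes "quat_wishart P N M W" "\<omega> \<in> space P"
  shows "qadjoint (W \<omega>) = W \<omega>"
proof -
  obtain X where X: "X \<omega> \<in> carrier_mat M N" "W \<omega> = qadjoint (X \<omega>) * X \<omega>"
    using assms unfolding quat_wishart_def quat_gaussian_matrix_def by blast
  moreover have "qadjoint (X \<omega>) \<in> carrier_mat N M" using X(1) by (auto simp: qadjoint_def)
  ultimately show ?thesis using qadjoint_mult[of "qadjoint (X \<omega>)" N M "X \<omega>" N] by (simp add: qadjoint_qadjoint)
qed

lemma qcnj_eq: "qcnj q = of_real (2 * qRe q) - q"
  by (simp add: qcnj_def of_real_quat minus_quat_def)

lemma borel_measurable_qcnj [measurable]: "qcnj \<in> borel_measurable borel"
proof -
  have "(\<lambda>q. qcoord q 0) \<in> borel_measurable borel" by (rule borel_measurable_qcoord)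
  then have [measurable]: "qRe \<in> borel_measurable borel" by (simp add: qcoord_def[abs_def])
  have "(\<lambda>q. of_real (2 * qRe q) - q :: quat) \<in> borel_measurable borel" by measurable
  then show ?thesis by (simp add: qcnj_eq[abs_def])
qed

text \<open>A one-element family is independent as soon as it is measurable.  This allows the single-matrix
  formula to be read off the formula for several matrices.\<close>

lemma indep_matrices_singleton:
  assumes P: "prob_space P" and W: "quat_wishart P N M W"
  shows "indep_matrices P N (\<lambda>_. W) {l}"
proof -
  interpret prob_space P by (rule P)
  obtain X where X: "quat_gaussian_matrix P M N X" and WX: "\<And>\<omega>. \<omega> \<in> space P \<Longrightarrow> W \<omega> = qadjoint (X \<omega>) * X \<omega>"
    using W unfolding quat_wishart_def by blast
  have "(\<lambda>\<omega>. W \<omega> $$ ab) \<in> borel_measurable P" if ab: "ab \<in> {..<N} \<times> {..<N}" for ab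
  proof -
    obtain a b where [simp]: "ab = (a, b)" and "a < N" "b < N" using ab by blast
    have "W \<omega> $$ ab = (\<Sum>k<M. qcnj (X \<omega> $$ (k, a)) * X \<omega> $$ (k, b))" if "\<omega> \<in> space P" for \<omega>
    proof -
      have "X \<omega> \<in> carrier_mat M N" using X that by (simp add: quat_gaussian_matrix_def)
      then show ?thesis using WX[OF that] \<open>a < N\<close> \<open>b < N\<close>
        by (auto simp: qadjoint_def scalar_prod_def lessThan_atLeast0 intro!: sum.cong)
    qed
    moreover have "(\<lambda>\<omega>. X \<omega> $$ (k, c)) \<in> borel_measurable P" if "k < M" "c < N" for k c
      using X that by (auto simp: quat_gaussian_matrix_def indep_vars_def)
    then have "(\<lambda>\<omega>. \<Sum>k<M. qcnj (X \<omega> $$ (k, a)) * X \<omega> $$ (k, b)) \<in> borel_measurable P"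
      using \<open>a < N\<close> \<open>b < N\<close>
      by (intro borel_measurable_sum borel_measurable_times measurable_compose[OF _ borel_measurable_qcnj]) auto
    ultimately show ?thesis by (simp cong: measurable_cong)
  qed
  then have "(\<lambda>\<omega>. \<lambda>ab\<in>{..<N} \<times> {..<N}. W \<omega> $$ ab) \<in> measurable P (PiM ({..<N} \<times> {..<N}) (\<lambda>_. borel))"
    by (intro measurable_restrict) auto
  then show ?thesis unfolding indep_matrices_def indep_vars_def2
  proof (intro conjI ballI indep_setsI)
    fix A J assume "J \<noteq> {}" "J \<subseteq> {l}"
    then have "J = {l}" by blast
    then show "prob (\<Inter>j\<in>J. A j) = (\<Prod>j\<in>J. prob (A j))" by simp
  qed (auto intro: measurable_sets)
qed

theorem theorem4p2:
  fixes P :: "'a measure" and N m n :: nat and j :: "nat \<Rightarrow> nat"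
  assumes "prob_space P"
    and "N \<ge> 1"
    and "\<forall>r\<in>{1..m}. j r \<ge> 1"
    and "n = (\<Sum>r=1..m. j r)"
  shows
    "(\<forall>(M::nat) (lam::real) (W :: 'a \<Rightarrow> quat mat).
        quat_wishart P N M W \<and> real M = lam * real N \<longrightarrow>
        integrable P (\<lambda>\<omega>. prod_list (map (\<lambda>r. qtrace (W \<omega> ^\<^sub>m j r)) [1..<m + 1])) \<and>
        prob_space.expectation P (\<lambda>\<omega>. prod_list (map (\<lambda>r. qtrace (W \<omega> ^\<^sub>m j r)) [1..<m + 1])) =
          of_real (real N ^ (n - m) * 4 ^ (n - m) *
            (\<Sum>\<gamma>\<in>moebius_graphs m j.
               lam ^ card (white_vertices m j \<gamma>) * (- 2 * real N) powi euler_char m j \<gamma>)))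
     \<and>
     (\<forall>(s::nat) (M :: nat \<Rightarrow> nat) (W :: nat \<Rightarrow> 'a \<Rightarrow> quat mat) (t :: nat \<Rightarrow> nat) (lam :: nat \<Rightarrow> real).
        (\<forall>l\<in>{1..s}. quat_wishart P N (M l) (W l)) \<and>
        indep_matrices P N W {1..s} \<and>
        (\<forall>k\<in>{1..n}. t k \<in> {1..s}) \<and>
        (\<forall>l\<in>{1..s}. lam l = real (M l) / real N) \<longrightarrow>
        integrable P (\<lambda>\<omega>. \<Prod>r=1..m.
          qRe (qtrace (mat_prod N (map (\<lambda>k. W (t k) \<omega>) [block_first j r..<block_last j r + 1])))) \<and>
        1 / (4 * real N) ^ (n - m) *
        prob_space.expectation P (\<lambda>\<omega>. \<Prod>r=1..m.
          qRe (qtrace (mat_prod N (map (\<lambda>k. W (t k) \<omega>) [block_first j r..<block_last j r + 1])))) =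
          (\<Sum>\<gamma>\<in>colored_moebius_graphs m j t.
             (\<Prod>l=1..s. lam l ^ card (white_vertices_of_color m j t \<gamma> l)) *
             (- 2 * real N) powi euler_char m j \<gamma>))"
proof -
  have n: "n = block_last j m" using assms(4) by (simp add: block_last_def)
  have "m \<le> n"
    using sum_mono[of "{1..m}" "\<lambda>_. 1" j] assms(3,4) by simp
  then obtain d where d: "n = m + d" using le_Suc_ex by blast
  have N: "real N > 0" using assms(2) by simp
  have traces: "integrable P (\<lambda>\<omega>. \<Prod>r=1..m.
        qRe (qtrace (mat_prod N (map (\<lambda>k. W (t k) \<omega>) [block_first j r..<block_last j r + 1])))) \<and>
      1 / (4 * real N) ^ (n - m) *
      prob_space.expectation P (\<lambda>\<omega>. \<Prod>r=1..m.
        qRe (qtrace (mat_prod N (map (\<lambda>k. W (t k) \<omega>) [block_first j r..<block_last j r + 1])))) =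
        (\<Sum>\<gamma>\<in>colored_moebius_graphs m j t.
           (\<Prod>l=1..s. lam l ^ card (white_vertices_of_color m j t \<gamma> l)) *
           (- 2 * real N) powi euler_char m j \<gamma>)"
    if W: "\<And>l. l \<in> {1..s} \<Longrightarrow> quat_wishart P N (M l) (W l)" and ind: "indep_matrices P N W {1..s}"
      and t: "\<And>k. k \<in> {1..n} \<Longrightarrow> t k \<in> {1..s}" and lam: "\<And>l. l \<in> {1..s} \<Longrightarrow> lam l = real (M l) / real N"
    for s M W t and lam :: "nat \<Rightarrow> real"
  proof -
    let ?g = "\<lambda>\<omega>. \<Prod>r=1..m.
        qRe (qtrace (mat_prod N (map (\<lambda>k. W (t k) \<omega>) [block_first j r..<block_last j r + 1])))"
    let ?C = "colored_moebius_graphs m j t"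
    let ?w = "\<lambda>\<gamma>. card (white_vertices m j \<gamma>)" and ?f = "\<lambda>\<gamma>. card (faces m j \<gamma>)"
      and ?wl = "\<lambda>\<gamma> l. card (white_vertices_of_color m j t \<gamma> l)"
    let ?T = "\<lambda>\<gamma>. 2 ^ n * (- 1) ^ (n + m + ?w \<gamma> + ?f \<gamma>) * (\<Prod>l=1..s. (2 * real (M l)) ^ ?wl \<gamma> l) *
       (2 * real N) ^ ?f \<gamma>"
    have "has_bochner_integral P (\<lambda>\<omega>. 2 ^ m * ?g \<omega>) (\<Sum>\<gamma>\<in>?C. ?T \<gamma>)"
      using expected_product_of_real_traces[OF assms(1,3) n W ind t]
      by (simp add: prod.distrib)
    from has_bochner_integral_mult_right[OF this, of "1 / 2 ^ m"]
    have g: "has_bochner_integral P ?g (1 / 2 ^ m * (\<Sum>\<gamma>\<in>?C. ?T \<gamma>))" by simp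
    have "1 / (4 * real N) ^ (n - m) * (1 / 2 ^ m * ?T \<gamma>) =
        (\<Prod>l=1..s. lam l ^ ?wl \<gamma> l) * (- 2 * real N) powi euler_char m j \<gamma>" if \<gamma>: "\<gamma> \<in> ?C" for \<gamma>
    proof -
      note color = prod_white_vertices(2)[of j m t s \<gamma>, folded n, OF t \<gamma>]
      have pow: "x ^ ?w \<gamma> = (\<Prod>l=1..s. x ^ ?wl \<gamma> l)" for x :: real
        using color[of "\<lambda>_. x"] by simp
      have 1: "(\<Prod>l=1..s. (2 * real (M l)) ^ ?wl \<gamma> l) = 2 ^ ?w \<gamma> * (\<Prod>l=1..s. real (M l) ^ ?wl \<gamma> l)"
        by (simp add: pow power_mult_distrib prod.distrib)
      have 2: "(\<Prod>l=1..s. lam l ^ ?wl \<gamma> l) = (\<Prod>l=1..s. real (M l) ^ ?wl \<gamma> l) / real N ^ ?w \<gamma>"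
        by (simp add: pow lam power_divide prod_dividef)
      have 3: "euler_char m j \<gamma> = int (m + ?w \<gamma>) - int (m + d) + int (?f \<gamma>)"
        using card_black_vertices[OF assms(3)] card_ribbons[OF assms(3)] n d by (simp add: euler_char_def)
      show ?thesis unfolding 1 2 3 unfolding d diff_add_inverse by (rule genus_weight[OF N])
    qed
    then have "1 / (4 * real N) ^ (n - m) * (1 / 2 ^ m * (\<Sum>\<gamma>\<in>?C. ?T \<gamma>)) =
        (\<Sum>\<gamma>\<in>?C. (\<Prod>l=1..s. lam l ^ ?wl \<gamma> l) * (- 2 * real N) powi euler_char m j \<gamma>)"
      by (simp only: sum_distrib_left cong: sum.cong)
    then show ?thesis using g by (simp only: has_bochner_integral_iff)
  qed
  have powers: "integrable P (\<lambda>\<omega>. prod_list (map (\<lambda>r. qtrace (W \<omega> ^\<^sub>m j r)) [1..<m + 1])) \<and>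
        prob_space.expectation P (\<lambda>\<omega>. prod_list (map (\<lambda>r. qtrace (W \<omega> ^\<^sub>m j r)) [1..<m + 1])) =
          of_real (real N ^ (n - m) * 4 ^ (n - m) *
            (\<Sum>\<gamma>\<in>moebius_graphs m j.
               lam ^ card (white_vertices m j \<gamma>) * (- 2 * real N) powi euler_char m j \<gamma>))"
    if W: "quat_wishart P N M W" and lam: "real M = lam * real N" for M lam W
  proof -
    let ?t = "\<lambda>_ :: nat. 1 :: nat"
    let ?g = "\<lambda>\<omega>. \<Prod>r=1..m. qRe (qtrace (mat_prod N (map (\<lambda>k. W \<omega>) [block_first j r..<block_last j r + 1])))"
    let ?R = "\<Sum>\<gamma>\<in>moebius_graphs m j. lam ^ card (white_vertices m j \<gamma>) * (- 2 * real N) powi euler_char m j \<gamma>"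
    have "colored_moebius_graphs m j ?t = moebius_graphs m j"
      by (simp add: colored_moebius_graphs_def side_color_def)
    moreover have "white_vertices_of_color m j ?t \<gamma> 1 = white_vertices m j \<gamma>" for \<gamma>
      by (simp add: white_vertices_of_color_def side_color_def)
    moreover have "indep_matrices P N (\<lambda>_. W) {1..1}"
      using indep_matrices_singleton[OF assms(1) W, of 1] by simp
    ultimately have g: "integrable P ?g" "1 / (4 * real N) ^ (n - m) * prob_space.expectation P ?g = ?R"
      using traces[of 1 "\<lambda>_. M" "\<lambda>_. W" ?t "\<lambda>_. lam"] W lam N by simp_all
    have eq: "prod_list (map (\<lambda>r. qtrace (W \<omega> ^\<^sub>m j r)) [1..<m + 1]) = of_real (?g \<omega>)" if \<omega>: "\<omega> \<in> space P" for \<omega>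
    proof -
      note car = quat_wishart_carrier[OF W \<omega>]
      have len: "map (\<lambda>k. W \<omega>) [block_first j r..<block_last j r + 1] = replicate (j r) (W \<omega>)"
        if "r \<in> {1..m}" for r
      proof -
        have "block_last j r + 1 - block_first j r = j r"
          using that by (cases r) (auto simp: block_first_def block_last_def atLeastLessThanSuc_atLeastAtMost)
        then show ?thesis by (simp add: map_replicate_const del: upt_Suc)
      qed
      have "map (\<lambda>r. qtrace (W \<omega> ^\<^sub>m j r)) [1..<m + 1] =
          map of_real (map (\<lambda>r. qRe (qtrace (mat_prod N (map (\<lambda>k. W \<omega>) [block_first j r..<block_last j r + 1])))) [1..<m + 1])"
      proof -
        have "qtrace (W \<omega> ^\<^sub>m j r) = of_real (qRe (qtrace (mat_prod N (map (\<lambda>k. W \<omega>) [block_first j r..<block_last j r + 1]))))"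
          if "r \<in> {1..m}" for r
          using qtrace_power_real[OF car wishart_hermitian[OF W \<omega>], of "j r"] pow_mat_eq_mat_prod[OF car] len[OF that]
          by (simp only:)
        then show ?thesis by (simp del: upt_Suc)
      qed
      moreover have "prod_list (map of_real xs) = (of_real (prod_list xs) :: quat)" for xs :: "real list"
        by (induction xs) simp_all
      moreover have "prod_list (map h [1..<m + 1]) = (\<Prod>r=1..m. h r)" for h :: "nat \<Rightarrow> real"
        using prod.distinct_set_conv_list[of "[1..<m + 1]" h]
        by (simp add: atLeastLessThanSuc_atLeastAtMost del: upt_Suc)
      ultimately show ?thesis by (simp only:)
    qed
    have "has_bochner_integral P ?g (real N ^ (n - m) * 4 ^ (n - m) * ?R)"
      using g N by (simp add: has_bochner_integral_iff field_simps power_mult_distrib)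
    from has_bochner_integral_of_real[OF this, where 'a = quat]
    have "has_bochner_integral P (\<lambda>\<omega>. prod_list (map (\<lambda>r. qtrace (W \<omega> ^\<^sub>m j r)) [1..<m + 1]))
        (of_real (real N ^ (n - m) * 4 ^ (n - m) * ?R))"
      by (rule has_bochner_integral_cong[THEN iffD2, rotated 3]) (use eq in auto)
    then show ?thesis by (simp only: has_bochner_integral_iff)
  qed
  show ?thesis
    by (rule conjI; intro allI impI; elim conjE) ((rule powers; assumption), (rule traces; blast))
qed

end
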